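(* For integers $d,k$ let $$U=\begin{pmatrix} 1&1&0&0\\ 0&1&0&0\\ d&d&1&0\\ 0&-k&-1&1 \end{pmatrix},\qquad T=\begin{pmatrix} 1&0&0&0\\ 0&1&0&1\\ 0&0&1&0\\ 0&0&0&1 \end{pmatrix},\qquad R=TU,$$ which are elements of $\mathrm{Sp}(4,\mathbf{Z})$, and let $G=\langle R,T\rangle=\langle R,T,U\rangle\subset \mathrm{Sp}(4,\mathbf{Z})$. Among the fourteen hypergeometric groups in $\mathrm{Sp}(4,\mathbf{Z})$ with $U$ maximally unipotent (listed in the context by parameters and pairs $(d,k)$), in the following seven cases the group $G$ splits as a free or an amalgamated product, as indicated: 1. $(d,k)=(5,5)$, parameters $(\frac15,\frac25,\frac35,\frac45)$: $G=\langle T\rangle *\langle R\rangle\cong \mathbf{Z}*\mathbf{Z}/5\mathbf{Z}$. 2. $(d,k)=(2,4)$, parameters $(\frac18,\frac38,\frac58,\frac78)$: $R^4=-I$ and $G=\langle R^4,T\rangle *_{\langle R^4\rangle}\langle R\rangle\cong(\mathbf{Z}\times\mathbf{Z}/2\mathbf{Z})*_{\mathbf{Z}/2\mathbf{Z}}\mathbf{Z}/8\mathbf{Z}$. 3. $(d,k)=(1,4)$, parameters $(\frac1{12},\frac5{12},\frac7{12},\frac{11}{12})$: $R^6=-I$ and $G=\langle R^6,T\rangle *_{\langle R^6\rangle}\langle R\rangle\cong(\mathbf{Z}\times\mathbf{Z}/2\mathbf{Z})*_{\mathbf{Z}/2\mathbf{Z}}\mathbf{Z}/12\mathbf{Z}$.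 4. $(d,k)=(16,8)$, parameters $(\frac12,\frac12,\frac12,\frac12)$: $G=\langle T\rangle *\langle R\rangle\cong\mathbf{Z}*\mathbf{Z}$. 5. $(d,k)=(12,7)$, parameters $(\frac13,\frac12,\frac12,\frac23)$: $G=\langle T\rangle *\langle R\rangle\cong\mathbf{Z}*\mathbf{Z}$. 6. $(d,k)=(8,6)$, parameters $(\frac14,\frac12,\frac12,\frac34)$: $G=\langle T\rangle *\langle R\rangle\cong\mathbf{Z}*\mathbf{Z}$. 7. $(d,k)=(4,5)$, parameters $(\frac16,\frac12,\frac12,\frac56)$: $G=\langle T\rangle *\langle R\rangle\cong\mathbf{Z}*\mathbf{Z}$. Moreover, in each of these seven cases $G$ contains a free subgroup of finite index. In particular, in each of these seven cases $G$ is thin: it is Zariski dense in $\mathrm{Sp}(4,\mathbf{R})$ (which has real rank $2$) and has infinite index in $\mathrm{Sp}(4,\mathbf{Z})$.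
   Context: Here $\mathrm{Sp}(4,\mathbf{Z})$ and $\mathrm{Sp}(4,\mathbf{R})$ denote the groups of $4\times 4$ matrices with entries in $\mathbf{Z}$, respectively $\mathbf{R}$, preserving the symplectic form with matrix $$J=\begin{pmatrix}0&0&1&0\\ 0&0&0&1\\ -1&0&0&0\\ 0&-1&0&0 \end{pmatrix}.$$ A triple $R,T,U\in \mathrm{GL}_n(\mathbf{C})$ with $R=TU$ is called (irreducible) hypergeometric if $\mathrm{rank}(T-I)=1$ and $R^{-1},U$ have no common eigenvalues; the group $\langle R,T,U\rangle$ is then called a hypergeometric group. Such groups are the monodromy groups of generalised hypergeometric ordinary differential equations. There are exactly fourteen examples with $R,T,U\in\mathrm{Sp}(4,\mathbf{Z})$ and $U$ maximally unipotent (a single unipotent Jordan block of size $4$). They are labelled by parameters $(a_1,a_2,a_3,a_4)\in\mathbf{Q}^4$ such that the eigenvalues of $R$ are $\exp(2\pi i a_j)$. In a suitable basis they are given by the matrices $U,T,R=TU$ displayed in the claim, with pairs $(d,k)$ as follows: the seven listed in the claim, together with $(\frac14,\frac13,\frac23,\frac34)$: $(2,3)$; $(\frac16,\frac16,\frac56,\frac56)$: $(1,2)$; $(\frac16,\frac14,\frac34,\frac56)$: $(6,5)$; $(\frac16,\frac13,\frac23,\frac56)$: $(3,4)$; $(\frac1{10},\frac3{10},\frac7{10},\frac9{10})$: $(1,3)$; $(\frac14,\frac14,\frac34,\frac34)$: $(4,4)$; $(\frac13,\frac13,\frac23,\frac23)$: $(9,6)$. An equality $G=G_1*_H G_2$ for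 subgroups $G_1,G_2\subset G$ with $H=G_1\cap G_2$ means that the natural homomorphism from the abstract amalgamated product of $G_1$ and $G_2$ over $H$ to $G$ is an isomorphism; $G=G_1*G_2$ is the case where $H$ is trivial. A subgroup of $\mathrm{Sp}(4,\mathbf{Z})$ that is Zariski dense in $\mathrm{Sp}(4,\mathbf{R})$ is called thin (non-arithmetic) if it has infinite index in $\mathrm{Sp}(4,\mathbf{Z})$. *)

theory Defs
  imports "HOL-Analysis.Analysis" "HOL-Algebra.Elementary_Groups"
begin

section \<open>Groups given by generators and relations\<close>

inductive_set pres_cong :: "'x set \<Rightarrow> ('x list \<times> 'x list) set \<Rightarrow> ('x list \<times> 'x list) set"
  for X :: "'x set" and rel :: "('x list \<times> 'x list) set"
where
  base: "\<lbrakk>(l, r) \<in> rel; l \<in> lists X; r \<in> lists X; u \<in> lists X; v \<in> lists X\<rbrakk>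
    \<Longrightarrow> (u @ l @ v, u @ r @ v) \<in> pres_cong X rel"
| refl: "w \<in> lists X \<Longrightarrow> (w, w) \<in> pres_cong X rel"
| sym: "(v, w) \<in> pres_cong X rel \<Longrightarrow> (w, v) \<in> pres_cong X rel"
| trans: "\<lbrakk>(u, v) \<in> pres_cong X rel; (v, w) \<in> pres_cong X rel\<rbrakk> \<Longrightarrow> (u, w) \<in> pres_cong X rel"

text \<open>This is a monoid presentation. The relations used below make each generator invertible,
  so the monoids presented are groups.\<close>

definition pres_monoid :: "'x set \<Rightarrow> ('x list \<times> 'x list) set \<Rightarrow> 'x list set monoid" where
  "pres_monoid X rel =
    \<lparr>carrier = lists X // pres_cong X rel,
     monoid.mult = (\<lambda>A B. \<Union>u\<in>A. \<Union>v\<in>B. pres_cong X rel `` {u @ v}),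
     one = pres_cong X rel `` {[]}\<rparr>"

definition word_eval :: "('g, 'm) monoid_scheme \<Rightarrow> ('x \<Rightarrow> 'g) \<Rightarrow> 'x list \<Rightarrow> 'g" where
  "word_eval G \<phi> w = foldr (\<lambda>x y. \<phi> x \<otimes>\<^bsub>G\<^esub> y) w \<one>\<^bsub>G\<^esub>"

text \<open>The homomorphism induced by a map on generators; it is only meaningful if the evaluation
  of words is constant on congruence classes.\<close>

definition pres_lift :: "('g, 'm) monoid_scheme \<Rightarrow> ('x \<Rightarrow> 'g) \<Rightarrow> 'x list set \<Rightarrow> 'g" where
  "pres_lift G \<phi> A = the_elem (word_eval G \<phi> ` A)"

lemma pres_cong_lists: "(v, w) \<in> pres_cong X rel \<Longrightarrow> v \<in> lists X \<and> w \<in> lists X"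
  by (induction rule: pres_cong.induct) auto

lemma equiv_pres_cong: "equiv (lists X) (pres_cong X rel)"
proof (rule equivI)
  show "pres_cong X rel \<subseteq> lists X \<times> lists X"
    using pres_cong_lists by fast
  show "refl_on (lists X) (pres_cong X rel)"
    by (rule refl_onI) (rule pres_cong.refl)
  show "sym (pres_cong X rel)"
    by (rule symI) (rule pres_cong.sym)
  show "trans (pres_cong X rel)"
    by (rule transI) (rule pres_cong.trans)
qed

lemma pres_cong_context:
  "(v, w) \<in> pres_cong X rel \<Longrightarrow> a \<in> lists X \<Longrightarrow> b \<in> lists X
    \<Longrightarrow> (a @ v @ b, a @ w @ b) \<in> pres_cong X rel"
proof (induction rule: pres_cong.induct)
  case (base l r u v)
  then show ?case
    using pres_cong.base[of l r rel X "a @ u" "v @ b"] by simp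
next
  case (refl w)
  then show ?case by - (rule pres_cong.refl, simp_all)
next
  case (sym v w)
  then show ?case by - (rule pres_cong.sym[of "a @ v @ b"], simp_all)
next
  case (trans u v w)
  then show ?case by - (rule pres_cong.trans[of "a @ u @ b" "a @ v @ b"], simp_all)
qed

lemma pres_mult_class:
  assumes "u \<in> lists X" "v \<in> lists X"
  shows "(pres_cong X rel `` {u}) \<otimes>\<^bsub>pres_monoid X rel\<^esub> (pres_cong X rel `` {v})
    = pres_cong X rel `` {u @ v}"
proof -
  have "pres_cong X rel `` {u' @ v'} = pres_cong X rel `` {u @ v}"
    if "(u, u') \<in> pres_cong X rel" "(v, v') \<in> pres_cong X rel" for u' v'
  proof -
    have "(u @ v, u' @ v) \<in> pres_cong X rel"
      using pres_cong_context[OF that(1), of "[]" v] assms by simp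
    moreover have "(u' @ v, u' @ v') \<in> pres_cong X rel"
      using pres_cong_context[OF that(2), of u' "[]"] pres_cong_lists[OF that(1)] by simp
    ultimately have "(u @ v, u' @ v') \<in> pres_cong X rel"
      by (rule pres_cong.trans)
    then show ?thesis
      by (rule equiv_class_eq[OF equiv_pres_cong, symmetric])
  qed
  note key = this
  have uu: "(u, u) \<in> pres_cong X rel" "(v, v) \<in> pres_cong X rel"
    using assms by (auto intro: pres_cong.refl)
  have "(\<Union>u'\<in>pres_cong X rel `` {u}. \<Union>v'\<in>pres_cong X rel `` {v}. pres_cong X rel `` {u' @ v'})
      = (\<Union>u'\<in>pres_cong X rel `` {u}. \<Union>v'\<in>pres_cong X rel `` {v}. pres_cong X rel `` {u @ v})"
    by (intro SUP_cong refl key) simp_all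
  also have "\<dots> = pres_cong X rel `` {u @ v}"
    using uu by auto
  finally show ?thesis
    by (simp add: pres_monoid_def)
qed

lemma pres_group:
  assumes inv: "\<And>x. x \<in> X \<Longrightarrow> \<exists>y\<in>X. ([y, x], []) \<in> pres_cong X rel"
  shows "group (pres_monoid X rel)"
proof (rule groupI)
  have cl: "pres_cong X rel `` {u} \<in> carrier (pres_monoid X rel)" if "u \<in> lists X" for u
    using that by (auto simp: pres_monoid_def quotient_def)
  have ex: "\<exists>u\<in>lists X. a = pres_cong X rel `` {u}" if "a \<in> carrier (pres_monoid X rel)" for a
    using that by (auto simp: pres_monoid_def quotient_def)
  have one: "\<one>\<^bsub>pres_monoid X rel\<^esub> = pres_cong X rel `` {[]}"
    by (simp add: pres_monoid_def)
  show "\<one>\<^bsub>pres_monoid X rel\<^esub> \<in> carrier (pres_monoid X rel)"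
    using cl[of "[]"] one by simp
  fix a assume a: "a \<in> carrier (pres_monoid X rel)"
  then obtain u where u: "u \<in> lists X" "a = pres_cong X rel `` {u}" using ex by blast
  show "\<one>\<^bsub>pres_monoid X rel\<^esub> \<otimes>\<^bsub>pres_monoid X rel\<^esub> a = a"
    using pres_mult_class[of "[]" X u rel] u one by simp
  have "\<exists>w\<in>lists X. (w @ u, []) \<in> pres_cong X rel"
    using u(1)
  proof (induction u)
    case Nil
    then show ?case using pres_cong.refl[of "[]" X rel] by (intro bexI[of _ "[]"]) simp_all
  next
    case (Cons x u)
    then obtain w where w: "w \<in> lists X" "(w @ u, []) \<in> pres_cong X rel" by auto
    from Cons inv obtain y where y: "y \<in> X" "([y, x], []) \<in> pres_cong X rel" by blast
    have "(w @ [y, x] @ u, w @ [] @ u) \<in> pres_cong X rel"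
      using pres_cong_context[OF y(2), of w u] w Cons by simp
    then have "((w @ [y]) @ x # u, []) \<in> pres_cong X rel"
      using pres_cong.trans[of "w @ [y, x] @ u" "w @ u" X rel "[]"] w(2) by simp
    moreover have "w @ [y] \<in> lists X" using w y by simp
    ultimately show ?case by blast
  qed
  then obtain w where w: "w \<in> lists X" "(w @ u, []) \<in> pres_cong X rel" by blast
  have "pres_cong X rel `` {w @ u} = pres_cong X rel `` {[]}"
    using w(2) by (rule equiv_class_eq[OF equiv_pres_cong])
  then have "pres_cong X rel `` {w} \<otimes>\<^bsub>pres_monoid X rel\<^esub> a = \<one>\<^bsub>pres_monoid X rel\<^esub>"
    using pres_mult_class[of w X u rel] w u one by simp
  then show "\<exists>b\<in>carrier (pres_monoid X rel). b \<otimes>\<^bsub>pres_monoid X rel\<^esub> a = \<one>\<^bsub>pres_monoid X rel\<^esub>"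
    using cl w by blast
  fix b assume b: "b \<in> carrier (pres_monoid X rel)"
  then obtain v where v: "v \<in> lists X" "b = pres_cong X rel `` {v}" using ex by blast
  have uv: "u @ v \<in> lists X" using u v by simp
  show "a \<otimes>\<^bsub>pres_monoid X rel\<^esub> b \<in> carrier (pres_monoid X rel)"
    using u v cl[OF uv] by (simp add: pres_mult_class)
  fix c assume c: "c \<in> carrier (pres_monoid X rel)"
  then obtain z where z: "z \<in> lists X" "c = pres_cong X rel `` {z}" using ex by blast
  show "a \<otimes>\<^bsub>pres_monoid X rel\<^esub> b \<otimes>\<^bsub>pres_monoid X rel\<^esub> c
      = a \<otimes>\<^bsub>pres_monoid X rel\<^esub> (b \<otimes>\<^bsub>pres_monoid X rel\<^esub> c)"
    using u v z pres_mult_class[OF uv z(1), of rel] pres_mult_class[OF u(1), of "v @ z" rel]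
    by (simp add: pres_mult_class)
qed


section \<open>Free groups, free products and amalgamated products\<close>

definition free_group :: "'s set \<Rightarrow> ('s \<times> bool) list set monoid" where
  "free_group S = pres_monoid (S \<times> UNIV) {([(s, b), (s, \<not> b)], []) | s b. s \<in> S}"

lemma group_free_group: "group (free_group S)"
  unfolding free_group_def
proof (rule pres_group)
  fix x :: "'a \<times> bool" assume "x \<in> S \<times> UNIV"
  then obtain s b where x: "x = (s, b)" "s \<in> S" by blast
  let ?rel = "{([(s, b), (s, \<not> b)], []) | s b. s \<in> S}"
  have "([(s, \<not> b), x], []) \<in> ?rel"
    using x by (auto intro!: exI[of _ "\<not> b"])
  then have "([(s, \<not> b), x], []) \<in> pres_cong (S \<times> UNIV) ?rel"
    using pres_cong.base[of "[(s, \<not> b), x]" "[]" ?rel "S \<times> UNIV" "[]" "[]"] x by simp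
  then show "\<exists>y\<in>S \<times> UNIV. ([y, x], []) \<in> pres_cong (S \<times> UNIV) ?rel"
    using x by (intro bexI[of _ "(s, \<not> b)"]) auto
qed

text \<open>A group is free if the natural map from the free group on some subset (a basis) is an
  isomorphism.\<close>

definition is_free_group :: "('g, 'm) monoid_scheme \<Rightarrow> bool" where
  "is_free_group G \<longleftrightarrow> group G \<and>
    (\<exists>S\<subseteq>carrier G.
      pres_lift G (\<lambda>(s, b). if b then s else inv\<^bsub>G\<^esub> s) \<in> iso (free_group S) G)"

text \<open>The amalgamated product of \<open>A\<close> and \<open>B\<close> along homomorphisms \<open>f\<close> and \<open>g\<close> from \<open>H\<close>.\<close>

definition amalgam_rel ::
  "('a, 'm) monoid_scheme \<Rightarrow> ('b, 'n) monoid_scheme \<Rightarrow> ('h, 'k) monoid_scheme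
    \<Rightarrow> ('h \<Rightarrow> 'a) \<Rightarrow> ('h \<Rightarrow> 'b) \<Rightarrow> (('a + 'b) list \<times> ('a + 'b) list) set" where
  "amalgam_rel A B H f g =
     {([Inl x, Inl y], [Inl (x \<otimes>\<^bsub>A\<^esub> y)]) | x y. x \<in> carrier A \<and> y \<in> carrier A}
   \<union> {([Inr x, Inr y], [Inr (x \<otimes>\<^bsub>B\<^esub> y)]) | x y. x \<in> carrier B \<and> y \<in> carrier B}
   \<union> {([Inl \<one>\<^bsub>A\<^esub>], []), ([Inr \<one>\<^bsub>B\<^esub>], [])}
   \<union> {([Inl (f h)], [Inr (g h)]) | h. h \<in> carrier H}"

definition amalgam ::
  "('a, 'm) monoid_scheme \<Rightarrow> ('b, 'n) monoid_scheme \<Rightarrow> ('h, 'k) monoid_scheme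
    \<Rightarrow> ('h \<Rightarrow> 'a) \<Rightarrow> ('h \<Rightarrow> 'b) \<Rightarrow> ('a + 'b) list set monoid" where
  "amalgam A B H f g = pres_monoid (carrier A <+> carrier B) (amalgam_rel A B H f g)"

lemma group_amalgam:
  assumes "group A" "group B"
  shows "group (amalgam A B H f g)"
  unfolding amalgam_def
proof (rule pres_group)
  interpret A: group A by fact
  interpret B: group B by fact
  let ?X = "carrier A <+> carrier B" and ?rel = "amalgam_rel A B H f g"
  note base = pres_cong.base[where X = ?X and rel = ?rel and u = "[]" and v = "[]", simplified]
  fix x assume "x \<in> ?X"
  then show "\<exists>y\<in>?X. ([y, x], []) \<in> pres_cong ?X ?rel"
  proof (elim PlusE)
    fix a assume a: "a \<in> carrier A" "x = Inl a"
    have "([Inl (inv\<^bsub>A\<^esub> a), x], [Inl \<one>\<^bsub>A\<^esub>]) \<in> ?rel"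
      unfolding amalgam_rel_def
      by (rule UnI1, rule UnI1, rule UnI1, intro CollectI exI[of _ "inv\<^bsub>A\<^esub> a"] exI[of _ a])
        (simp add: a)
    moreover have "([Inl \<one>\<^bsub>A\<^esub>], []) \<in> ?rel"
      by (simp add: amalgam_rel_def)
    ultimately have "([Inl (inv\<^bsub>A\<^esub> a), x], []) \<in> pres_cong ?X ?rel"
      using a base[of "[Inl (inv\<^bsub>A\<^esub> a), x]" "[Inl \<one>\<^bsub>A\<^esub>]"] base[of "[Inl \<one>\<^bsub>A\<^esub>]" "[]"]
      by - (rule pres_cong.trans[of _ "[Inl \<one>\<^bsub>A\<^esub>]"], simp_all add: InlI)
    then show ?thesis using a by blast
  next
    fix a assume a: "a \<in> carrier B" "x = Inr a"
    have "([Inr (inv\<^bsub>B\<^esub> a), x], [Inr \<one>\<^bsub>B\<^esub>]) \<in> ?rel"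
      unfolding amalgam_rel_def
      by (rule UnI1, rule UnI1, rule UnI2, intro CollectI exI[of _ "inv\<^bsub>B\<^esub> a"] exI[of _ a])
        (simp add: a)
    moreover have "([Inr \<one>\<^bsub>B\<^esub>], []) \<in> ?rel"
      by (simp add: amalgam_rel_def)
    ultimately have "([Inr (inv\<^bsub>B\<^esub> a), x], []) \<in> pres_cong ?X ?rel"
      using a base[of "[Inr (inv\<^bsub>B\<^esub> a), x]" "[Inr \<one>\<^bsub>B\<^esub>]"] base[of "[Inr \<one>\<^bsub>B\<^esub>]" "[]"]
      by - (rule pres_cong.trans[of _ "[Inr \<one>\<^bsub>B\<^esub>]"], simp_all add: InrI)
    then show ?thesis using a by blast
  qed
qed

definition free_product ::
  "('a, 'm) monoid_scheme \<Rightarrow> ('b, 'n) monoid_scheme \<Rightarrow> ('a + 'b) list set monoid" where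
  "free_product A B = amalgam A B (singleton_group ()) (\<lambda>_. \<one>\<^bsub>A\<^esub>) (\<lambda>_. \<one>\<^bsub>B\<^esub>)"

text \<open>\<open>G\<close> is the internal amalgamated product of its subgroups \<open>A\<close> and \<open>B\<close> over their
  intersection \<open>H\<close>: the natural homomorphism from the abstract amalgamated product, which
  extends both inclusions, is an isomorphism.\<close>

definition is_amalgam :: "('g, 'm) monoid_scheme \<Rightarrow> 'g set \<Rightarrow> 'g set \<Rightarrow> 'g set \<Rightarrow> bool" where
  "is_amalgam G A B H \<longleftrightarrow> group G \<and> subgroup A G \<and> subgroup B G \<and> H = A \<inter> B \<and>
    pres_lift G (case_sum id id)
      \<in> iso (amalgam (G\<lparr>carrier := A\<rparr>) (G\<lparr>carrier := B\<rparr>) (G\<lparr>carrier := H\<rparr>) id id) G"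

definition is_free_product :: "('g, 'm) monoid_scheme \<Rightarrow> 'g set \<Rightarrow> 'g set \<Rightarrow> bool" where
  "is_free_product G A B \<longleftrightarrow> is_amalgam G A B {\<one>\<^bsub>G\<^esub>}"

text \<open>Infinite index has to be expressed by \<open>\<not> finite_index\<close>, since the cardinality of an
  infinite set is \<open>0\<close>.\<close>

definition finite_index :: "('g, 'm) monoid_scheme \<Rightarrow> 'g set \<Rightarrow> bool" where
  "finite_index G H \<longleftrightarrow> finite (rcosets\<^bsub>G\<^esub> H)"


section \<open>Symplectic groups\<close>

definition J4 :: "'a::comm_ring_1 ^ 4 ^ 4" where
  "J4 = vector [vector [ 0,  0, 1, 0],
                vector [ 0,  0, 0, 1],
                vector [-1,  0, 0, 0],
                vector [ 0, -1, 0, 0]]"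

definition Sp4 :: "('a::comm_ring_1 ^ 4 ^ 4) monoid" where
  "Sp4 = \<lparr>carrier = {A. transpose A ** J4 ** A = J4}, monoid.mult = (**), one = mat 1\<rparr>"

abbreviation Sp4Z :: "(int ^ 4 ^ 4) monoid" where "Sp4Z \<equiv> Sp4"
abbreviation Sp4R :: "(real ^ 4 ^ 4) monoid" where "Sp4R \<equiv> Sp4"

lemma int_matrix_left_right_inverse:
  fixes A B :: "int ^ 'n ^ 'n"
  assumes "A ** B = mat 1"
  shows "B ** A = mat 1"
proof -
  let ?r = "map_matrix real_of_int :: int ^ 'n ^ 'n \<Rightarrow> real ^ 'n ^ 'n"
  have mul: "?r (C ** D) = ?r C ** ?r D" for C D
    by (simp add: vec_eq_iff matrix_matrix_mult_def)
  have one: "?r (mat 1) = mat 1"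
    by (simp add: vec_eq_iff mat_def)
  have "?r B ** ?r A = mat 1"
    using arg_cong[OF assms, of ?r] by (simp add: mul one matrix_left_right_inverse)
  then have "?r (B ** A) = ?r (mat 1)"
    by (simp add: mul one)
  then show ?thesis
    by (simp add: vec_eq_iff)
qed

lemma group_Sp4Z: "group Sp4Z"
proof (rule groupI)
  let ?G = "Sp4Z"
  have JJ: "J4 ** J4 = (- mat 1 :: int ^ 4 ^ 4)"
    by (simp_all add: J4_def vec_eq_iff forall_4 matrix_matrix_mult_def sum_4 mat_def
        vector_def)
  have neg: "(- A) ** B = - (A ** B)" for A B :: "int ^ 4 ^ 4"
    by (simp_all add: vec_eq_iff matrix_matrix_mult_def sum_negf)
  show "\<one>\<^bsub>?G\<^esub> \<in> carrier ?G"
    by (simp add: Sp4_def transpose_mat)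
  fix x assume x: "x \<in> carrier ?G"
  then have xJ: "transpose x ** J4 ** x = J4" by (simp add: Sp4_def)
  show "\<one>\<^bsub>?G\<^esub> \<otimes>\<^bsub>?G\<^esub> x = x" by (simp add: Sp4_def)
  have inv: "(- (J4 ** transpose x ** J4)) ** x = mat 1"
  proof -
    have "(- (J4 ** transpose x ** J4)) ** x = - (J4 ** (transpose x ** J4 ** x))"
      by (simp only: neg matrix_mul_assoc)
    then show ?thesis by (simp add: xJ JJ)
  qed
  define y where "y = - (J4 ** transpose x ** J4)"
  have yx: "y ** x = mat 1" using inv by (simp add: y_def)
  have "transpose y ** J4 ** y = transpose y ** (transpose x ** J4 ** x) ** y"
    by (simp add: xJ)
  also have "\<dots> = transpose (x ** y) ** J4 ** (x ** y)"
    by (simp only: matrix_transpose_mul matrix_mul_assoc)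
  also have "x ** y = mat 1"
    using yx by (rule int_matrix_left_right_inverse)
  finally have "transpose y ** J4 ** y = J4" by (simp add: transpose_mat)
  then show "\<exists>y\<in>carrier ?G. y \<otimes>\<^bsub>?G\<^esub> x = \<one>\<^bsub>?G\<^esub>"
    using yx by (auto simp: Sp4_def)
  fix y assume y: "y \<in> carrier ?G"
  show "x \<otimes>\<^bsub>?G\<^esub> y \<in> carrier ?G"
  proof -
    have "transpose (x ** y) ** J4 ** (x ** y) = transpose y ** (transpose x ** J4 ** x) ** y"
      by (simp only: matrix_transpose_mul matrix_mul_assoc)
    then show ?thesis using x y by (simp add: Sp4_def)
  qed
  fix z assume z: "z \<in> carrier ?G"
  show "x \<otimes>\<^bsub>?G\<^esub> y \<otimes>\<^bsub>?G\<^esub> z = x \<otimes>\<^bsub>?G\<^esub> (y \<otimes>\<^bsub>?G\<^esub> z)"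
    by (simp add: Sp4_def matrix_mul_assoc)
qed

definition zariski_closed :: "(real ^ 'n ^ 'n) set \<Rightarrow> bool" where
  "zariski_closed Z \<longleftrightarrow>
    (\<exists>P. (\<forall>p\<in>P. real_polynomial_function p) \<and> Z = {A. \<forall>p\<in>P. p A = 0})"

definition zariski_dense_in :: "(real ^ 'n ^ 'n) set \<Rightarrow> (real ^ 'n ^ 'n) set \<Rightarrow> bool" where
  "zariski_dense_in S X \<longleftrightarrow> S \<subseteq> X \<and> (\<forall>Z. zariski_closed Z \<and> S \<subseteq> Z \<longrightarrow> X \<subseteq> Z)"

definition thin :: "(int ^ 4 ^ 4) set \<Rightarrow> bool" where
  "thin H \<longleftrightarrow> subgroup H Sp4Z
    \<and> zariski_dense_in (map_matrix of_int ` H) (carrier Sp4R)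
    \<and> \<not> finite_index Sp4Z H"

text \<open>The real rank of a linear group is the largest dimension of a connected subgroup that is
  diagonalisable over the reals. Such a subgroup is the conjugate by some \<open>P\<close> of the exponential
  of a linear space \<open>V\<close> of diagonal matrices, here identified with their diagonals.\<close>

definition real_rank :: "(real ^ 'n ^ 'n) set \<Rightarrow> nat" where
  "real_rank S = (GREATEST r. \<exists>(V :: (real ^ 'n) set) P. subspace V \<and> dim V = r \<and> invertible P \<and>
    (\<forall>v\<in>V. P ** (\<chi> i j. if i = j then exp (v $ i) else 0) ** matrix_inv P \<in> S))"


section \<open>Hypergeometric groups\<close>

definition is_eigenvalue :: "complex ^ 'n ^ 'n \<Rightarrow> complex \<Rightarrow> bool" where
  "is_eigenvalue A c \<longleftrightarrow> (\<exists>v. v \<noteq> 0 \<and> A *v v = c *s v)"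

definition hypergeometric ::
  "complex ^ 'n ^ 'n \<Rightarrow> complex ^ 'n ^ 'n \<Rightarrow> complex ^ 'n ^ 'n \<Rightarrow> bool" where
  "hypergeometric R T U \<longleftrightarrow> invertible R \<and> invertible T \<and> invertible U \<and> R = T ** U \<and>
    rank (T - mat 1) = 1 \<and>
    \<not> (\<exists>c. is_eigenvalue (matrix_inv R) c \<and> is_eigenvalue U c)"

definition maximally_unipotent :: "complex ^ 4 ^ 4 \<Rightarrow> bool" where
  "maximally_unipotent A \<longleftrightarrow> (\<exists>P :: complex ^ 4 ^ 4. invertible P \<and>
    A = P ** vector [vector [1, 1, 0, 0],
                     vector [0, 1, 1, 0],
                     vector [0, 0, 1, 1],
                     vector [0, 0, 0, 1]] ** matrix_inv P)"

text \<open>The eigenvalues, counted with algebraic multiplicity, are \<open>exp (2 * pi * \<i> * a)\<close> for \<open>a\<close>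
  in the list.\<close>

definition has_parameters :: "complex ^ 'n ^ 'n \<Rightarrow> rat list \<Rightarrow> bool" where
  "has_parameters R as \<longleftrightarrow>
    (\<forall>x. det (mat x - R) = (\<Prod>a\<leftarrow>as. x - exp (2 * of_real pi * \<i> * of_rat a)))"

abbreviation to_complex :: "int ^ 'n ^ 'n \<Rightarrow> complex ^ 'n ^ 'n" where
  "to_complex \<equiv> map_matrix of_int"

definition U_mat :: "int \<Rightarrow> int \<Rightarrow> int ^ 4 ^ 4" where
  "U_mat d k = vector [vector [1,  1,  0, 0],
                       vector [0,  1,  0, 0],
                       vector [d,  d,  1, 0],
                       vector [0, -k, -1, 1]]"

definition T_mat :: "int ^ 4 ^ 4" where
  "T_mat = vector [vector [1, 0, 0, 0],
                   vector [0, 1, 0, 1],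
                   vector [0, 0, 1, 0],
                   vector [0, 0, 0, 1]]"

definition R_mat :: "int \<Rightarrow> int \<Rightarrow> int ^ 4 ^ 4" where
  "R_mat d k = T_mat ** U_mat d k"

definition hyp_case :: "int \<Rightarrow> int \<Rightarrow> rat list \<Rightarrow> bool" where
  "hyp_case d k as \<longleftrightarrow>
    hypergeometric (to_complex (R_mat d k)) (to_complex T_mat) (to_complex (U_mat d k)) \<and>
    maximally_unipotent (to_complex (U_mat d k)) \<and>
    has_parameters (to_complex (R_mat d k)) as"

definition hyp_group :: "int \<Rightarrow> int \<Rightarrow> (int ^ 4 ^ 4) monoid" where
  "hyp_group d k = Sp4Z\<lparr>carrier := generate Sp4Z {R_mat d k, T_mat}\<rparr>"

end

theory Submission
  imports Defs
begin

text \<open>The splittings come from a game of ping-pong that \<open>T\<close> and \<open>R\<close> play on the lattice \<open>\<int>\<^sup>4\<close>.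
Put \<open>U = T\<^sup>-\<^sup>1 R\<close>. Both \<open>U\<close> and its conjugate \<open>T U\<^sup>-\<^sup>1 T\<^sup>-\<^sup>1 = T R\<^sup>-\<^sup>1\<close> are maximally unipotent,
and a maximally unipotent \<open>exp N\<close> maps every simplicial cone with edges \<open>v, N v, N\<^sup>2 v, N\<^sup>3 v\<close>
into itself. For \<open>T R\<^sup>-\<^sup>1\<close> and a suitable \<open>v\<close> this gives a cone \<open>K\<close> (\<open>cone_K\<close>), and an involution
\<open>E\<close> (\<open>reflection\<close>) which inverts both \<open>T\<close> and \<open>R\<close> turns it into a cone \<open>E K\<close> invariant under \<open>U\<close>.
Let \<open>M\<close> (\<open>cone_M\<close>) consist of the points which \<open>T\<close> maps into \<open>K\<close> and \<open>T\<^sup>-\<^sup>1\<close> maps into \<open>- E K\<close>.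
Up to sign, the positive powers of \<open>T\<close> carry \<open>M\<close> into \<open>K\<close>, the negative ones carry \<open>M\<close>
into \<open>E K\<close>, and the three regions are disjoint. The whole question is then whether every power
\<open>R\<^sup>i\<close> other than \<open>1\<close> and \<open>- 1\<close> maps \<open>K\<close> and \<open>E K\<close> into \<open>M\<close>, up to sign.

For each of the seven pairs \<open>(d, k)\<close> this is a finite set of linear inequalities. If \<open>R\<close> has finite
order there are only finitely many powers. Otherwise some \<open>(- R)\<^sup>p\<close> is unipotent, and a point
stays in \<open>M\<close> under all powers of \<open>(- R)\<^sup>p\<close> once its images under the powers of the nilpotent
\<open>(- R)\<^sup>p - 1\<close> lie in the closed cone (\<open>persistent_cone_M\<close>). Negative powers of \<open>R\<close> follow by
conjugation with \<open>E\<close>. The locale \<open>ping_pong_cones\<close> collects what is needed of a pair \<open>(d, k)\<close>, and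
\<open>alternating_nontrivial\<close> is the resulting statement that no alternating word is trivial.

The rest of the theorem is derived from this. By the normal form of words (\<open>amalgam_normal_form\<close>,
\<open>amalgam_iso\<close>) the group is an amalgam of \<open>\<langle>R\<rangle>\<close> with \<open>\<langle>T\<rangle>\<close>, or with \<open>\<langle>- 1, T\<rangle>\<close> when some power of
\<open>R\<close> is \<open>- 1\<close>. If \<open>R\<close> has infinite order, \<open>T\<close> and \<open>R\<close> are free generators. If it has finite order,
the finitely many conjugates \<open>R\<^sup>i T R\<^sup>-\<^sup>i\<close> play ping-pong with each other and generate a free normal
subgroup whose quotient is a quotient of \<open>\<langle>R\<rangle>\<close>. The index in \<open>Sp(4, \<int>)\<close> is infinite
(\<open>splitting_infinite_index\<close>) because the centraliser of \<open>T\<close> in \<open>Sp(4, \<int>)\<close> contains an infinite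
group that meets \<open>\<langle>- 1, T\<rangle>\<close> trivially, whereas in an amalgam the centraliser of \<open>T\<close> is no larger
than \<open>\<langle>- 1, T\<rangle>\<close>.

Zariski density is a separate matter: \<open>T\<close> is a symplectic transvection, hence the Zariski
closure contains the full line of transvections through it, and it contains their conjugates under
powers of \<open>U\<close>. The directions of transvections in the closure form an increasing family of subspaces
that reaches \<open>\<real>\<^sup>4\<close>, and transvections generate \<open>Sp(4, \<real>)\<close> (\<open>zariski_dense_hyp_group\<close>). The real rank
is bounded by looking at the symplectic form in a basis that diagonalises a torus
(\<open>torus_dim_le\<close>).\<close>
section \<open>Evaluating words in a presented group\<close>

context group begin

lemma word_eval_Nil [simp]: "word_eval G \<phi> [] = \<one>"
  by (simp add: word_eval_def)

lemma word_eval_Cons [simp]: "word_eval G \<phi> (x # w) = \<phi> x \<otimes> word_eval G \<phi> w"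
  by (simp add: word_eval_def)

lemma word_eval_closed: "\<phi> ` set w \<subseteq> carrier G \<Longrightarrow> word_eval G \<phi> w \<in> carrier G"
  by (induction w) auto

lemma word_eval_append:
  "\<phi> ` set u \<subseteq> carrier G \<Longrightarrow> \<phi> ` set v \<subseteq> carrier G \<Longrightarrow>
    word_eval G \<phi> (u @ v) = word_eval G \<phi> u \<otimes> word_eval G \<phi> v"
  by (induction u) (auto simp: m_assoc word_eval_closed)

lemma word_eval_map: "word_eval G id (map \<phi> w) = word_eval G \<phi> w"
  by (induction w) auto

lemma word_eval_pres_cong:
  assumes \<phi>: "\<phi> ` X \<subseteq> carrier G"
    and rel: "\<And>l r. (l, r) \<in> rel \<Longrightarrow> word_eval G \<phi> l = word_eval G \<phi> r"
    and vw: "(v, w) \<in> pres_cong X rel"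
  shows "word_eval G \<phi> v = word_eval G \<phi> w"
  using vw
proof (induction rule: pres_cong.induct)
  case (base l r u v)
  have in_lists: "\<phi> ` set x \<subseteq> carrier G" if "x \<in> lists X" for x
    using that \<phi> by auto
  have "l @ v \<in> lists X" "r @ v \<in> lists X"
    using base by simp_all
  with base show ?case
    using rel[OF base(1)] by (simp only: word_eval_append in_lists)
qed auto

text \<open>A word problem criterion: a homomorphism out of a presented group is injective as soon as every
word that evaluates to the identity can be rewritten to the empty word.\<close>
lemma pres_lift_iso:
  assumes \<phi>: "\<phi> ` X \<subseteq> carrier G"
    and rel: "\<And>l r. (l, r) \<in> rel \<Longrightarrow> word_eval G \<phi> l = word_eval G \<phi> r"
    and P: "group (pres_monoid X rel)"
    and ker: "\<And>w. w \<in> lists X \<Longrightarrow> word_eval G \<phi> w = \<one> \<Longrightarrow> (w, []) \<in> pres_cong X rel"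
    and surj: "carrier G \<subseteq> word_eval G \<phi> ` lists X"
  shows "pres_lift G \<phi> \<in> iso (pres_monoid X rel) G"
proof -
  let ?P = "pres_monoid X rel"
  have in_lists: "\<phi> ` set w \<subseteq> carrier G" if "w \<in> lists X" for w
    using that \<phi> by auto
  have lift: "pres_lift G \<phi> (pres_cong X rel `` {w}) = word_eval G \<phi> w" if "w \<in> lists X" for w
  proof -
    have "w \<in> pres_cong X rel `` {w}"
      using pres_cong.refl[OF that, of rel] by simp
    moreover have "word_eval G \<phi> v = word_eval G \<phi> w" if "v \<in> pres_cong X rel `` {w}" for v
      using word_eval_pres_cong[OF \<phi> rel, where v = w and w = v] that by simp
    ultimately have "word_eval G \<phi> ` (pres_cong X rel `` {w}) = {word_eval G \<phi> w}"
      by blast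
    then show ?thesis by (simp add: pres_lift_def)
  qed
  have carrier: "carrier ?P = (\<lambda>w. pres_cong X rel `` {w}) ` lists X"
    by (auto simp: pres_monoid_def quotient_def)
  have one: "\<one>\<^bsub>?P\<^esub> = pres_cong X rel `` {[]}"
    by (simp add: pres_monoid_def)
  have hom: "pres_lift G \<phi> \<in> hom ?P G"
  proof (rule homI)
    fix a assume "a \<in> carrier ?P"
    then obtain u where u: "u \<in> lists X" "a = pres_cong X rel `` {u}"
      unfolding carrier by blast
    then show "pres_lift G \<phi> a \<in> carrier G"
      by (simp add: lift word_eval_closed in_lists)
    fix b assume "b \<in> carrier ?P"
    then obtain v where v: "v \<in> lists X" "b = pres_cong X rel `` {v}"
      unfolding carrier by blast
    have "u @ v \<in> lists X" using u v by simp
    then show "pres_lift G \<phi> (a \<otimes>\<^bsub>?P\<^esub> b) = pres_lift G \<phi> a \<otimes> pres_lift G \<phi> b"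
      using u v by (simp only: pres_mult_class lift word_eval_append in_lists)
  qed
  interpret h: group_hom ?P G "pres_lift G \<phi>"
    using P hom by (intro group_hom.intro group_hom_axioms.intro) (auto intro: is_group)
  have "a = \<one>\<^bsub>?P\<^esub>" if a: "a \<in> carrier ?P" "pres_lift G \<phi> a = \<one>" for a
  proof -
    obtain u where u: "u \<in> lists X" "a = pres_cong X rel `` {u}"
      using a(1) unfolding carrier by blast
    then have "(u, []) \<in> pres_cong X rel"
      using ker[of u] lift[of u] a(2) by simp
    then show ?thesis
      unfolding u(2) one by (rule equiv_class_eq[OF equiv_pres_cong])
  qed
  then have "inj_on (pres_lift G \<phi>) (carrier ?P)"
    by (simp add: h.inj_on_one_iff)
  moreover have "carrier G \<subseteq> pres_lift G \<phi> ` carrier ?P"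
  proof
    fix g assume "g \<in> carrier G"
    then obtain w where w: "w \<in> lists X" "g = word_eval G \<phi> w"
      using surj by blast
    have "pres_lift G \<phi> (pres_cong X rel `` {w}) \<in> pres_lift G \<phi> ` carrier ?P"
      using w(1) unfolding carrier by blast
    then show "g \<in> pres_lift G \<phi> ` carrier ?P"
      using w by (simp add: lift)
  qed
  then have "pres_lift G \<phi> ` carrier ?P = carrier G"
    using h.hom_closed by blast
  ultimately show ?thesis
    using hom by (simp add: iso_def bij_betw_def)
qed

end

section \<open>Alternating words and amalgamated products\<close>

definition alternating :: "'g set \<Rightarrow> 'g set \<Rightarrow> 'g list \<Rightarrow> bool" where
  "alternating A B w \<longleftrightarrow>
    set w \<subseteq> (A - B) \<union> (B - A) \<and> successively (\<lambda>x y. x \<in> A \<longleftrightarrow> y \<in> B) w"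

lemma alternating_Cons_Cons:
  "alternating A B (x # y # w) \<longleftrightarrow>
    (x \<in> A - B \<and> y \<in> B - A \<or> x \<in> B - A \<and> y \<in> A - B) \<and> alternating A B (y # w)"
  by (auto simp: alternating_def)

context group begin

text \<open>The existence half of the normal form theorem: whenever two adjacent
letters lie in the same factor they can be merged, and a letter from the amalgamated subgroup can be
moved into the neighbouring factor and merged there, so that a shortest representative alternates
strictly. The factors are abstract groups \<open>A\<close> and \<open>B\<close> with maps \<open>\<alpha>\<close> and \<open>\<beta>\<close> into \<open>G\<close>. In this form
the same lemma applies to subgroups of \<open>G\<close> and to external models such as \<open>\<int>\<close> and \<open>\<int>/5\<close>.\<close>
lemma amalgam_normal_form:
  fixes A :: "('x, 'm) monoid_scheme" and B :: "('y, 'n) monoid_scheme"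
  assumes A: "group A" and B: "group B"
    and f: "f ` carrier H \<subseteq> carrier A" and g: "g ` carrier H \<subseteq> carrier B"
    and inter: "\<And>a b. a \<in> carrier A \<Longrightarrow> b \<in> carrier B \<Longrightarrow> \<alpha> a = \<beta> b \<Longrightarrow>
      \<exists>h\<in>carrier H. a = f h \<and> b = g h"
    and w: "w \<in> lists (carrier A <+> carrier B)"
  obtains v where "v \<in> lists (carrier A <+> carrier B)"
    "(w, v) \<in> pres_cong (carrier A <+> carrier B) (amalgam_rel A B H f g)"
    "length v \<le> 1 \<or> alternating (\<alpha> ` carrier A) (\<beta> ` carrier B) (map (case_sum \<alpha> \<beta>) v)"
proof -
  let ?X = "carrier A <+> carrier B"
  let ?C = "pres_cong ?X (amalgam_rel A B H f g)"
  let ?alt = "alternating (\<alpha> ` carrier A) (\<beta> ` carrier B)"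
  define reduced where "reduced v \<longleftrightarrow> v \<in> lists ?X \<and>
    (length v \<le> 1 \<or> ?alt (map (case_sum \<alpha> \<beta>) v))" for v
  interpret A: group A by fact
  interpret B: group B by fact
  have base: "(l @ v, r @ v) \<in> ?C"
    if "(l, r) \<in> amalgam_rel A B H f g" "l \<in> lists ?X" "r \<in> lists ?X" "v \<in> lists ?X" for l r v
    using pres_cong.base[of l r "amalgam_rel A B H f g" ?X "[]" v] that by simp
  have mergeA: "(Inl a # Inl b # v, Inl (a \<otimes>\<^bsub>A\<^esub> b) # v) \<in> ?C"
    if "a \<in> carrier A" "b \<in> carrier A" "v \<in> lists ?X" for a b v
    using that base[of "[Inl a, Inl b]" "[Inl (a \<otimes>\<^bsub>A\<^esub> b)]" v]
    by (auto simp: amalgam_rel_def)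
  have mergeB: "(Inr a # Inr b # v, Inr (a \<otimes>\<^bsub>B\<^esub> b) # v) \<in> ?C"
    if "a \<in> carrier B" "b \<in> carrier B" "v \<in> lists ?X" for a b v
    using that base[of "[Inr a, Inr b]" "[Inr (a \<otimes>\<^bsub>B\<^esub> b)]" v]
    by (auto simp: amalgam_rel_def)
  have cross: "([Inl (f h)], [Inr (g h)]) \<in> ?C" if "h \<in> carrier H" for h
    using that base[of "[Inl (f h)]" "[Inr (g h)]" "[]"] f g
    by (auto simp: amalgam_rel_def)
  \<comment> \<open>Prepending a letter to a reduced word either keeps it reduced or absorbs the next letter,
    and in the second case the argument is repeated on a shorter word.\<close>
  have push: "\<exists>u. reduced u \<and> (x # v, u) \<in> ?C" if "x \<in> ?X" "reduced v" for x v
    using that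
  proof (induction v arbitrary: x)
    case Nil
    then show ?case
      by (intro exI[of _ "[x]"]) (auto simp: reduced_def intro: pres_cong.refl)
  next
    case (Cons y v)
    have v: "reduced v" and y: "y \<in> ?X" and vX: "v \<in> lists ?X"
      using Cons.prems(2) by (cases v; auto simp: reduced_def alternating_Cons_Cons)+
    have step: ?case if "z \<in> ?X" "(x # y # v, z # v) \<in> ?C" for z
      using Cons.IH[OF that(1) v] that(2) by (meson pres_cong.trans)
    have alt: ?case if "?alt (case_sum \<alpha> \<beta> x # case_sum \<alpha> \<beta> y # map (case_sum \<alpha> \<beta>) v)"
      using that Cons.prems
      by (intro exI[of _ "x # y # v"]) (auto simp: reduced_def intro!: pres_cong.refl)
    have tail: "?alt (case_sum \<alpha> \<beta> y # map (case_sum \<alpha> \<beta>) v)"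
      if "case_sum \<alpha> \<beta> y \<in> (\<alpha> ` carrier A - \<beta> ` carrier B) \<union> (\<beta> ` carrier B - \<alpha> ` carrier A)"
      using Cons.prems(2) that by (cases v) (auto simp: reduced_def alternating_def)
    consider (ll) a b where "x = Inl a" "y = Inl b" "a \<in> carrier A" "b \<in> carrier A"
      | (rr) a b where "x = Inr a" "y = Inr b" "a \<in> carrier B" "b \<in> carrier B"
      | (lr) a b where "x = Inl a" "y = Inr b" "a \<in> carrier A" "b \<in> carrier B"
      | (rl) a b where "x = Inr a" "y = Inl b" "a \<in> carrier B" "b \<in> carrier A"
      using Cons.prems(1) y by blast
    then show ?case
    proof cases
      case ll
      then show ?thesis using mergeA[of a b v] vX by (intro step[of "Inl (a \<otimes>\<^bsub>A\<^esub> b)"]) auto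
    next
      case rr
      then show ?thesis using mergeB[of a b v] vX by (intro step[of "Inr (a \<otimes>\<^bsub>B\<^esub> b)"]) auto
    next
      case lr
      show ?thesis
      proof (cases "\<alpha> a \<in> \<beta> ` carrier B")
        case True
        then obtain h where h: "h \<in> carrier H" "a = f h" using inter lr by blast
        have gh: "g h \<in> carrier B" using g h by auto
        have "(x # y # v, Inr (g h) # Inr b # v) \<in> ?C"
          using pres_cong_context[OF cross[OF h(1)], of "[]" "Inr b # v"] lr h vX by auto
        then have "(x # y # v, Inr (g h \<otimes>\<^bsub>B\<^esub> b) # v) \<in> ?C"
          using mergeB[OF gh lr(4) vX] pres_cong.trans by metis
        then show ?thesis using gh lr by (intro step) auto
      next
        case aB: False
        show ?thesis
        proof (cases "\<beta> b \<in> \<alpha> ` carrier A")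
          case True
          then obtain a' where "a' \<in> carrier A" "\<alpha> a' = \<beta> b" by auto
          then obtain h where h: "h \<in> carrier H" "b = g h" using inter lr by blast
          have fh: "f h \<in> carrier A" using f h by auto
          have "(x # y # v, Inl a # Inl (f h) # v) \<in> ?C"
            using pres_cong_context[OF pres_cong.sym[OF cross[OF h(1)]], of "[Inl a]" v] lr h vX
            by auto
          then have "(x # y # v, Inl (a \<otimes>\<^bsub>A\<^esub> f h) # v) \<in> ?C"
            using mergeA[OF lr(3) fh vX] pres_cong.trans by metis
          then show ?thesis using fh lr by (intro step) auto
        next
          case False
          then show ?thesis using aB lr tail by (intro alt) (auto simp: alternating_Cons_Cons)
        qed
      qed
    next
      case rl
      show ?thesis
      proof (cases "\<beta> a \<in> \<alpha> ` carrier A")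
        case True
        then obtain a' where "a' \<in> carrier A" "\<alpha> a' = \<beta> a" by auto
        then obtain h where h: "h \<in> carrier H" "a = g h" using inter rl by blast
        have fh: "f h \<in> carrier A" using f h by auto
        have "(x # y # v, Inl (f h) # Inl b # v) \<in> ?C"
          using pres_cong_context[OF pres_cong.sym[OF cross[OF h(1)]], of "[]" "Inl b # v"] rl h vX
          by auto
        then have "(x # y # v, Inl (f h \<otimes>\<^bsub>A\<^esub> b) # v) \<in> ?C"
          using mergeA[OF fh rl(4) vX] pres_cong.trans by metis
        then show ?thesis using fh rl by (intro step) auto
      next
        case aA: False
        show ?thesis
        proof (cases "\<alpha> b \<in> \<beta> ` carrier B")
          case True
          then obtain h where h: "h \<in> carrier H" "b = f h" using inter rl by blast
          have gh: "g h \<in> carrier B" using g h by auto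
          have "(x # y # v, Inr a # Inr (g h) # v) \<in> ?C"
            using pres_cong_context[OF cross[OF h(1)], of "[Inr a]" v] rl h vX by auto
          then have "(x # y # v, Inr (a \<otimes>\<^bsub>B\<^esub> g h) # v) \<in> ?C"
            using mergeB[OF rl(3) gh vX] pres_cong.trans by metis
          then show ?thesis using gh rl by (intro step) auto
        next
          case False
          then show ?thesis using aA rl tail by (intro alt) (auto simp: alternating_Cons_Cons)
        qed
      qed
    qed
  qed
  have "\<exists>v. reduced v \<and> (w, v) \<in> ?C"
    using w
  proof (induction w)
    case Nil
    then show ?case by (intro exI[of _ "[]"]) (auto simp: reduced_def intro: pres_cong.refl)
  next
    case (Cons x w)
    then obtain v where v: "reduced v" "(w, v) \<in> ?C" by auto
    have x: "x \<in> ?X" using Cons.hyps by blast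
    from push[OF x v(1)] obtain u where u: "reduced u" "(x # v, u) \<in> ?C" by blast
    have "(x # w, x # v) \<in> ?C"
      using pres_cong_context[OF v(2), of "[x]" "[]"] x by simp
    with u(2) have "(x # w, u) \<in> ?C" by (metis pres_cong.trans)
    with u(1) show ?case by blast
  qed
  with that show thesis by (auto simp: reduced_def)
qed

lemma amalgam_rel_eval:
  assumes \<alpha>: "\<alpha> \<in> hom A G" and \<beta>: "\<beta> \<in> hom B G" and A: "group A" and B: "group B"
    and agree: "\<And>h. h \<in> carrier H \<Longrightarrow> \<alpha> (f h) = \<beta> (g h)"
    and lr: "(l, r) \<in> amalgam_rel A B H f g"
  shows "word_eval G (case_sum \<alpha> \<beta>) l = word_eval G (case_sum \<alpha> \<beta>) r"
proof -
  interpret a: group_hom A G \<alpha>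
    using \<alpha> A by (intro group_hom.intro group_hom_axioms.intro) (auto intro: is_group)
  interpret b: group_hom B G \<beta>
    using \<beta> B by (intro group_hom.intro group_hom_axioms.intro) (auto intro: is_group)
  show ?thesis
    using lr agree unfolding amalgam_rel_def by (auto simp: m_assoc)
qed

lemma word_eval_generate:
  assumes S: "S \<subseteq> carrier G" and X: "\<phi> ` X \<subseteq> carrier G"
    and S_img: "\<And>s. s \<in> S \<Longrightarrow> s \<in> \<phi> ` X \<and> inv s \<in> \<phi> ` X"
  shows "generate G S \<subseteq> word_eval G \<phi> ` lists X"
proof
  have letter: "\<phi> x \<in> word_eval G \<phi> ` lists X" if "x \<in> X" for x
    using that X by (intro image_eqI[of _ _ "[x]"]) auto
  have in_lists: "\<phi> ` set w \<subseteq> carrier G" if "w \<in> lists X" for w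
    using that X by auto
  fix g assume "g \<in> generate G S"
  then show "g \<in> word_eval G \<phi> ` lists X"
  proof (induction rule: generate.induct)
    case one
    then show ?case by (intro image_eqI[of _ _ "[]"]) auto
  next
    case (incl h)
    then show ?case using S_img letter by auto
  next
    case (inv h)
    then show ?case using S_img[of h] letter by auto
  next
    case (eng h1 h2)
    then obtain u v where "u \<in> lists X" "v \<in> lists X"
      "h1 = word_eval G \<phi> u" "h2 = word_eval G \<phi> v" by blast
    then show ?case
      by (intro image_eqI[of _ _ "u @ v"]) (simp_all add: word_eval_append in_lists)
  qed
qed

text \<open>Words of length at least two are excluded from the kernel by \<open>nontrivial\<close>, and a word of length
one by the injectivity of \<open>\<alpha>\<close> and \<open>\<beta>\<close>.\<close>
lemma amalgam_iso:
  assumes A: "group A" and B: "group B"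
    and \<alpha>: "\<alpha> \<in> mon A G" and \<beta>: "\<beta> \<in> mon B G"
    and f: "f ` carrier H \<subseteq> carrier A" and g: "g ` carrier H \<subseteq> carrier B"
    and agree: "\<And>h. h \<in> carrier H \<Longrightarrow> \<alpha> (f h) = \<beta> (g h)"
    and inter: "\<And>a b. a \<in> carrier A \<Longrightarrow> b \<in> carrier B \<Longrightarrow> \<alpha> a = \<beta> b \<Longrightarrow>
      \<exists>h\<in>carrier H. a = f h \<and> b = g h"
    and gen: "carrier G = generate G (\<alpha> ` carrier A \<union> \<beta> ` carrier B)"
    and nontrivial: "\<And>w. alternating (\<alpha> ` carrier A) (\<beta> ` carrier B) w \<Longrightarrow> 2 \<le> length w \<Longrightarrow>
      word_eval G id w \<noteq> \<one>"
  shows "pres_lift G (case_sum \<alpha> \<beta>) \<in> iso (amalgam A B H f g) G"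
  unfolding amalgam_def
proof (rule pres_lift_iso)
  let ?X = "carrier A <+> carrier B"
  let ?C = "pres_cong ?X (amalgam_rel A B H f g)"
  interpret a: group_hom A G \<alpha>
    using \<alpha> A by (intro group_hom.intro group_hom_axioms.intro) (auto simp: mon_def intro: is_group)
  interpret b: group_hom B G \<beta>
    using \<beta> B by (intro group_hom.intro group_hom_axioms.intro) (auto simp: mon_def intro: is_group)
  show img: "case_sum \<alpha> \<beta> ` ?X \<subseteq> carrier G"
    by auto
  show rel: "word_eval G (case_sum \<alpha> \<beta>) l = word_eval G (case_sum \<alpha> \<beta>) r"
    if "(l, r) \<in> amalgam_rel A B H f g" for l r
    by (rule amalgam_rel_eval[where A = A and B = B and H = H and f = f and g = g])
      (use A B \<alpha> \<beta> agree that in \<open>auto simp: mon_def\<close>)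
  show "group (pres_monoid ?X (amalgam_rel A B H f g))"
    using group_amalgam[OF A B] by (simp add: amalgam_def)
  show "carrier G \<subseteq> word_eval G (case_sum \<alpha> \<beta>) ` lists ?X"
  proof -
    have "s \<in> case_sum \<alpha> \<beta> ` ?X \<and> inv s \<in> case_sum \<alpha> \<beta> ` ?X"
      if "s \<in> \<alpha> ` carrier A \<union> \<beta> ` carrier B" for s
      using that
    proof
      assume "s \<in> \<alpha> ` carrier A"
      then obtain a where a: "a \<in> carrier A" "s = \<alpha> a" by blast
      then have "s = case_sum \<alpha> \<beta> (Inl a)" "inv s = case_sum \<alpha> \<beta> (Inl (inv\<^bsub>A\<^esub> a))"
        by simp_all
      moreover have "Inl a \<in> ?X" "Inl (inv\<^bsub>A\<^esub> a) \<in> ?X" using a by auto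
      ultimately show ?thesis by blast
    next
      assume "s \<in> \<beta> ` carrier B"
      then obtain a where a: "a \<in> carrier B" "s = \<beta> a" by blast
      then have "s = case_sum \<alpha> \<beta> (Inr a)" "inv s = case_sum \<alpha> \<beta> (Inr (inv\<^bsub>B\<^esub> a))"
        by simp_all
      moreover have "Inr a \<in> ?X" "Inr (inv\<^bsub>B\<^esub> a) \<in> ?X" using a by auto
      ultimately show ?thesis by blast
    qed
    then show ?thesis
      unfolding gen by (intro word_eval_generate[OF _ img]) auto
  qed
  fix w assume w: "w \<in> lists ?X" "word_eval G (case_sum \<alpha> \<beta>) w = \<one>"
  obtain v where v: "v \<in> lists ?X" "(w, v) \<in> ?C"
    "length v \<le> 1 \<or> alternating (\<alpha> ` carrier A) (\<beta> ` carrier B) (map (case_sum \<alpha> \<beta>) v)"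
    by (rule amalgam_normal_form[where \<alpha> = \<alpha> and \<beta> = \<beta>, OF A B f g _ w(1)]) (use inter in blast)+
  have eval_v: "word_eval G (case_sum \<alpha> \<beta>) v = \<one>"
    using word_eval_pres_cong[OF img rel v(2)] w(2) by simp
  have "length v \<le> 1"
    using v(3) nontrivial[of "map (case_sum \<alpha> \<beta>) v"] eval_v
    by (force simp: word_eval_map)
  moreover have "([Inl \<one>\<^bsub>A\<^esub>], []) \<in> ?C" "([Inr \<one>\<^bsub>B\<^esub>], []) \<in> ?C"
    using pres_cong.base[of "[Inl \<one>\<^bsub>A\<^esub>]" "[]" "amalgam_rel A B H f g" ?X "[]" "[]"]
      pres_cong.base[of "[Inr \<one>\<^bsub>B\<^esub>]" "[]" "amalgam_rel A B H f g" ?X "[]" "[]"]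
    by (auto simp: amalgam_rel_def)
  moreover have "a = \<one>\<^bsub>A\<^esub>" if "a \<in> carrier A" "\<alpha> a = \<one>" for a
    using that \<alpha> a.inj_on_one_iff by (auto simp: mon_def)
  moreover have "b = \<one>\<^bsub>B\<^esub>" if "b \<in> carrier B" "\<beta> b = \<one>" for b
    using that \<beta> b.inj_on_one_iff by (auto simp: mon_def)
  ultimately have "(v, []) \<in> ?C"
    using v(1) eval_v pres_cong.refl[of "[]" ?X]
    by (cases v) (auto split: sum.splits)
  then show "(w, []) \<in> ?C"
    using v(2) pres_cong.trans by metis
qed

end

section \<open>Ping-pong\<close>

lemma alternating_append:
  "alternating A B (u @ v) \<longleftrightarrow> alternating A B u \<and> alternating A B v \<and>
    (u \<noteq> [] \<longrightarrow> v \<noteq> [] \<longrightarrow> (last u \<in> A \<longleftrightarrow> hd v \<in> B))"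
  by (auto simp: alternating_def successively_append_iff)

context group begin

lemma word_eval_rev_inv:
  assumes "set w \<subseteq> carrier G"
  shows "word_eval G id (map (\<lambda>x. inv x) (rev w)) = inv (word_eval G id w)"
  using assms
proof (induction w)
  case (Cons a w)
  have "id ` set (map (\<lambda>x. inv x) (rev w)) \<subseteq> carrier G" "id ` set [inv a] \<subseteq> carrier G"
    using Cons.prems by auto
  then have "word_eval G id (map (\<lambda>x. inv x) (rev w) @ [inv a])
      = word_eval G id (map (\<lambda>x. inv x) (rev w)) \<otimes> word_eval G id [inv a]"
    by (rule word_eval_append)
  also have "word_eval G id (map (\<lambda>x. inv x) (rev w)) = inv (word_eval G id w)"
    using Cons.prems by (intro Cons.IH) simp
  also have "word_eval G id [inv a] = inv a"
    using Cons.prems by simp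
  also have "inv (word_eval G id w) \<otimes> inv a = inv (word_eval G id (a # w))"
    using word_eval_closed[of id w] Cons.prems by (simp add: inv_mult_group)
  finally show ?case by (simp only: rev.simps map_append list.map)
qed simp

text \<open>One player moves \<open>Y\<close> into \<open>X True\<close> or \<open>X False\<close>, the other moves both of these into \<open>Y\<close>. It is
irrelevant which of the two sets is hit, but that there are two of them matters: a word that begins
in \<open>A\<close> and ends in \<open>B\<close> maps both into a single one and hence is not the identity.\<close>
lemma alternating_ping_pong:
  fixes act :: "'a \<Rightarrow> 'x \<Rightarrow> 'x" and X :: "bool \<Rightarrow> 'x set"
  assumes AB: "A \<subseteq> carrier G" "B \<subseteq> carrier G"
    and act_one: "\<And>x. act \<one> x = x"
    and act_mult: "\<And>g h x. g \<in> carrier G \<Longrightarrow> h \<in> carrier G \<Longrightarrow> act (g \<otimes> h) x = act g (act h x)"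
    and A: "\<And>a. a \<in> A - B \<Longrightarrow> \<exists>s. act a ` Y \<subseteq> X s"
    and B: "\<And>b s. b \<in> B - A \<Longrightarrow> act b ` X s \<subseteq> Y"
    and disjoint: "X True \<inter> X False = {}" "\<And>s. X s \<inter> Y = {}"
    and nonempty: "\<And>s. X s \<noteq> {}" "Y \<noteq> {}"
    and w: "alternating A B w" "2 \<le> length w"
  shows "word_eval G id w \<noteq> \<one>"
proof -
  have in_carrier: "id ` set w \<subseteq> carrier G" if "alternating A B w" for w
    using that AB by (auto simp: alternating_def)
  have move: "\<exists>s. \<forall>t. act (word_eval G id w) ` (if last w \<in> A then Y else X t)
      \<subseteq> (if hd w \<in> A then X s else Y)" if "alternating A B w" "w \<noteq> []" for w
    using that
  proof (induction w)
    case (Cons x w)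
    show ?case
    proof (cases w)
      case Nil
      then have "x \<in> A - B \<or> x \<in> B - A" and x: "x \<in> carrier G"
        using Cons.prems AB by (auto simp: alternating_def)
      then show ?thesis
        using A[of x] B[of x] by (auto simp: Nil image_subset_iff)
    next
      case (Cons y v)
      then have alt: "alternating A B w" "w \<noteq> []"
        and xy: "x \<in> A - B \<and> y \<in> B - A \<or> x \<in> B - A \<and> y \<in> A - B"
        using Cons.prems by (auto simp: alternating_Cons_Cons)
      obtain s where s: "\<And>t. act (word_eval G id w) ` (if last w \<in> A then Y else X t)
          \<subseteq> (if hd w \<in> A then X s else Y)"
        using Cons.IH[OF alt] by blast
      have eval: "act (word_eval G id (x # w)) p = act x (act (word_eval G id w) p)" for p
        using act_mult[OF _ word_eval_closed[OF in_carrier[OF alt(1)]], of x] xy AB by auto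
      have last: "last (x # w) = last w" and hd: "hd w = y" using Cons by simp_all
      have eval_image: "act (word_eval G id (x # w)) ` Z = act x ` act (word_eval G id w) ` Z" for Z
        unfolding image_image by (rule image_cong[OF HOL.refl eval])
      from xy show ?thesis
      proof
        assume x: "x \<in> A - B \<and> y \<in> B - A"
        then obtain s' where "act x ` Y \<subseteq> X s'" using A by blast
        moreover have "act (word_eval G id w) ` (if last w \<in> A then Y else X t) \<subseteq> Y" for t
          using s[of t] x hd by simp
        ultimately show ?thesis
          unfolding last eval_image list.sel using x by (intro exI[of _ s'] allI) force
      next
        assume x: "x \<in> B - A \<and> y \<in> A - B"
        then have "act x ` X s \<subseteq> Y" using B by blast
        moreover have "act (word_eval G id w) ` (if last w \<in> A then Y else X t) \<subseteq> X s" for t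
          using s[of t] x hd by simp
        ultimately show ?thesis
          unfolding last eval_image list.sel using x by (intro exI[of _ s] allI) force
      qed
    qed
  qed simp
  have A_first: "word_eval G id w \<noteq> \<one>" if w: "alternating A B w" "w \<noteq> []" "hd w \<in> A" for w
  proof
    assume one: "word_eval G id w = \<one>"
    obtain s where s: "\<And>t. (if last w \<in> A then Y else X t) \<subseteq> X s"
      using move[OF w(1,2)] w(3) one act_one by auto
    show False
    proof (cases "last w \<in> A")
      case True
      then show ?thesis using s disjoint(2)[of s] nonempty(2) by auto
    next
      case False
      then have "X (\<not> s) \<subseteq> X s" using s[of "\<not> s"] by simp
      then show ?thesis using disjoint(1) nonempty(1)[of "\<not> s"] by (cases s) auto
    qed
  qed
  show ?thesis
  proof (cases "hd w \<in> A")
    case True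
    then show ?thesis using A_first w by force
  next
    case hd: False
    obtain v a where va: "w = v @ [a]" "v \<noteq> []"
    proof
      have "w \<noteq> []" "length (butlast w) \<noteq> 0" using w(2) by auto
      then show "w = butlast w @ [last w]" "butlast w \<noteq> []" by (simp, metis list.size(3))
    qed
    show ?thesis
    proof (cases "last w \<in> A")
      case True
      \<comment> \<open>Moving the last letter to the front conjugates the word and makes it begin in \<open>A\<close>.\<close>
      have "alternating A B (a # v)"
        using w(1) va True hd alternating_append[of A B v "[a]"]
        by (cases v) (auto simp: alternating_Cons_Cons alternating_def[of A B "[_]"] alternating_def[of A B "_ # _ @ _"])
      then have "a \<otimes> word_eval G id v \<noteq> \<one>"
        using A_first[of "a # v"] True va by simp
      moreover have "id ` set v \<subseteq> carrier G" "a \<in> carrier G"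
        using in_carrier[OF w(1)] va by auto
      ultimately show ?thesis
        using va inv_comm[of "word_eval G id v" a]
        by (auto simp: word_eval_append word_eval_closed)
    next
      case False
      show ?thesis
      proof
        assume "word_eval G id w = \<one>"
        moreover have "w \<noteq> []" using w(2) by auto
        ultimately have "X True \<subseteq> Y"
          using move[of w] w(1) hd False act_one by simp
        then show False using disjoint(2)[of True] nonempty(1)[of True] by auto
      qed
    qed
  qed
qed

text \<open>If \<open>g\<close> is an alternating word that begins and ends in \<open>B\<close>, then \<open>g t g\<^sup>-\<^sup>1 t\<^sup>-\<^sup>1\<close> is
alternating as it stands, hence nontrivial. A first or last letter in \<open>A\<close> commutes with \<open>t\<close> and can
be removed.\<close>
lemma alternating_centralizer:
  assumes A: "subgroup A G" and B: "subgroup B G" and gen: "carrier G = generate G (A \<union> B)"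
    and abelian: "\<And>a b. a \<in> A \<Longrightarrow> b \<in> A \<Longrightarrow> a \<otimes> b = b \<otimes> a"
    and nontrivial: "\<And>w. alternating A B w \<Longrightarrow> 2 \<le> length w \<Longrightarrow> word_eval G id w \<noteq> \<one>"
    and t: "t \<in> A - B" and g: "g \<in> carrier G" "g \<otimes> t = t \<otimes> g"
  shows "g \<in> A"
proof -
  interpret A: subgroup A G by fact
  interpret B: subgroup B G by fact
  have tG: "t \<in> carrier G" using t by auto
  have in_carrier: "id ` set w \<subseteq> carrier G" if "alternating A B w" for w
    using that by (auto simp: alternating_def)
  have cancel: "h \<otimes> t = t \<otimes> h" if "a \<in> A" "h \<in> carrier G" "(a \<otimes> h) \<otimes> t = t \<otimes> (a \<otimes> h)" for a h
  proof -
    have "a \<otimes> (h \<otimes> t) = a \<otimes> (t \<otimes> h)"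
      using that tG abelian[of a t] t by (simp add: m_assoc[symmetric])
    then show ?thesis using that tG by (simp add: A.mem_carrier)
  qed
  have cancel': "h \<otimes> t = t \<otimes> h" if "a \<in> A" "h \<in> carrier G" "(h \<otimes> a) \<otimes> t = t \<otimes> (h \<otimes> a)" for a h
  proof -
    have "(h \<otimes> t) \<otimes> a = (t \<otimes> h) \<otimes> a"
      using that tG abelian[of a t] t by (simp add: m_assoc)
    then show ?thesis using that tG by (simp add: A.mem_carrier)
  qed
  have main: "word_eval G id w \<in> A"
    if "alternating A B w" "word_eval G id w \<otimes> t = t \<otimes> word_eval G id w" for w
    using that
  proof (induction "length w" arbitrary: w rule: less_induct)
    case less
    note alt = less.prems(1) and comm = less.prems(2)
    have wG: "word_eval G id w \<in> carrier G"
      by (rule word_eval_closed[OF in_carrier[OF alt]])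
    consider "w = []" | "w \<noteq> []" "hd w \<in> A" | "w \<noteq> []" "last w \<in> A"
      | "w \<noteq> []" "hd w \<notin> A" "last w \<notin> A"
      by blast
    then show ?case
    proof cases
      case 1
      then show ?thesis by simp
    next
      case 2
      then obtain a v where w: "w = a # v" "a \<in> A" by (cases w) auto
      then have v: "alternating A B v"
        using alt alternating_append[of A B "[a]" v] by simp
      have "word_eval G id v \<in> A"
        using cancel[OF w(2) word_eval_closed[OF in_carrier[OF v]]] comm w v
        by (intro less.hyps) auto
      then show ?thesis using w by simp
    next
      case 3
      then obtain a v where w: "w = v @ [a]" "a \<in> A" by (cases w rule: rev_cases) auto
      then have v: "alternating A B v"
        using alt alternating_append[of A B v "[a]"] by simp
      have eval: "word_eval G id w = word_eval G id v \<otimes> a"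
        using w in_carrier[OF v] by (simp add: word_eval_append A.mem_carrier)
      have "word_eval G id v \<otimes> t = t \<otimes> word_eval G id v"
        using comm unfolding eval
        by (rule cancel'[OF w(2) word_eval_closed[OF in_carrier[OF v]]])
      then have "word_eval G id v \<in> A"
        using w v by (intro less.hyps) auto
      then show ?thesis using w eval by simp
    next
      case 4
      let ?inv = "map (\<lambda>x. inv x) (rev w)"
      let ?u = "w @ [t] @ ?inv @ [inv t]"
      have inv_in: "inv x \<in> A \<longleftrightarrow> x \<in> A" "inv x \<in> B \<longleftrightarrow> x \<in> B" if "x \<in> carrier G" for x
        using that A.m_inv_closed[of "inv x"] B.m_inv_closed[of "inv x"] by auto
      have "last w \<in> set w" "hd w \<in> set w" using 4 by simp_all
      then have last: "last w \<in> B - A" and hd: "hd w \<in> B - A"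
        using 4 alt unfolding alternating_def by blast+
      have "alternating A B ?inv"
        unfolding alternating_def
      proof
        show "set ?inv \<subseteq> A - B \<union> (B - A)"
          using alt by (auto simp: alternating_def inv_in)
        have "successively (\<lambda>x y. y \<in> A \<longleftrightarrow> x \<in> B) w"
          using alt unfolding alternating_def
          by (auto elim!: successively_mono)
        then show "successively (\<lambda>x y. x \<in> A \<longleftrightarrow> y \<in> B) ?inv"
          using in_carrier[OF alt]
          by (auto simp: successively_map successively_rev inv_in elim!: successively_mono)
      qed
      moreover have "hd ?inv = inv (last w)" "last ?inv = inv (hd w)" "?inv \<noteq> []"
        using 4 by (simp_all add: hd_map hd_rev last_map last_rev)
      ultimately have "alternating A B ?u"
        using alt t last hd tG inv_in alternating_append[of A B "[t]" "?inv @ [inv t]"]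
        by (auto simp: alternating_append alternating_def[of _ _ "[_]"] subset_iff)
      then have "word_eval G id ?u \<noteq> \<one>"
        using 4 by (intro nontrivial) (cases w, auto)
      moreover have "word_eval G id ?inv = inv (word_eval G id w)"
        using in_carrier[OF alt] by (intro word_eval_rev_inv) simp
      moreover have "id ` set ?inv \<subseteq> carrier G" using in_carrier[OF alt] by auto
      ultimately have "word_eval G id w \<otimes> t \<otimes> inv (word_eval G id w) \<otimes> inv t \<noteq> \<one>"
        using in_carrier[OF alt] tG wG by (simp add: word_eval_append m_assoc)
      then show ?thesis
        using comm tG wG by (simp add: m_assoc inv_mult_group[symmetric])
    qed
  qed
  have "carrier G \<subseteq> word_eval G (case_sum id id) ` lists (A <+> B)"
  proof -
    have "s \<in> case_sum id id ` (A <+> B) \<and> inv s \<in> case_sum id id ` (A <+> B)" if "s \<in> A \<union> B" for s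
      using that A.m_inv_closed[of s] B.m_inv_closed[of s] by force
    moreover have "A \<union> B \<subseteq> carrier G" "case_sum id id ` (A <+> B) \<subseteq> carrier G"
      by auto
    ultimately have "generate G (A \<union> B) \<subseteq> word_eval G (case_sum id id) ` lists (A <+> B)"
      by (rule word_eval_generate[rotated 2]) assumption
    then show ?thesis using gen by simp
  qed
  then obtain w where w: "w \<in> lists (A <+> B)" "g = word_eval G (case_sum id id) w"
    using g(1) by blast
  let ?A = "G\<lparr>carrier := A\<rparr>" and ?B = "G\<lparr>carrier := B\<rparr>" and ?H = "G\<lparr>carrier := A \<inter> B\<rparr>"
  have gr: "group ?A" "group ?B"
    using A B by (auto intro: subgroup.subgroup_is_group is_group)
  obtain v where v: "v \<in> lists (A <+> B)"
    "(w, v) \<in> pres_cong (A <+> B) (amalgam_rel ?A ?B ?H id id)"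
    "length v \<le> 1 \<or> alternating A B (map (case_sum id id) v)"
    using amalgam_normal_form[OF gr, of id "G\<lparr>carrier := A \<inter> B\<rparr>" id id id w] w(1) by auto
  have "id \<in> hom ?A G" "id \<in> hom ?B G" by (auto simp: hom_def)
  then have g_eval: "g = word_eval G (case_sum id id) v"
    unfolding w(2)
    by (intro word_eval_pres_cong[OF _ _ v(2)]
        amalgam_rel_eval[where A = ?A and B = ?B and H = ?H and f = id and g = id]) (auto simp: gr)
  show ?thesis
  proof (cases "alternating A B (map (case_sum id id) v)")
    case True
    then show ?thesis
      using main[OF True] g(2) g_eval by (simp add: word_eval_map)
  next
    case False
    then have len: "length v \<le> 1" using v(3) by simp
    have "g \<in> A \<union> B"
      using len v(1) g_eval by (cases v) (auto split: sum.splits)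
    then show ?thesis
    proof
      assume "g \<in> B"
      show ?thesis
      proof (rule ccontr)
        assume "g \<notin> A"
        then have "alternating A B [g]" using \<open>g \<in> B\<close> by (simp add: alternating_def)
        then show False using main[of "[g]"] g \<open>g \<notin> A\<close> by simp
      qed
    qed
  qed
qed

text \<open>The sets \<open>X i True\<close> and \<open>X i False\<close> receive everything that \<open>\<tau> i\<close> and its inverse act on, apart from
the set of the opposite letter. A reduced word thus maps the set of a letter \<open>y\<close> into the set of its
first letter, if \<open>y\<close> is not the inverse of its last letter. Two generators already provide enough
letters to choose \<open>y\<close> different from the first letter as well.\<close>
lemma free_group_ping_pong:
  fixes act :: "'a \<Rightarrow> 'x \<Rightarrow> 'x" and \<tau> :: "'i \<Rightarrow> 'a" and X :: "'i \<Rightarrow> bool \<Rightarrow> 'x set"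
  assumes \<tau>: "\<And>i. i \<in> I \<Longrightarrow> \<tau> i \<in> carrier G"
    and gen: "carrier G = generate G (\<tau> ` I)"
    and act_one: "\<And>x. act \<one> x = x"
    and act_mult: "\<And>g h x. g \<in> carrier G \<Longrightarrow> h \<in> carrier G \<Longrightarrow> act (g \<otimes> h) x = act g (act h x)"
    and ij: "i \<in> I" "j \<in> I" "i \<noteq> j"
    and nonempty: "\<And>i b. i \<in> I \<Longrightarrow> X i b \<noteq> {}"
    and disjoint: "\<And>i j b c. i \<in> I \<Longrightarrow> j \<in> I \<Longrightarrow> (i, b) \<noteq> (j, c) \<Longrightarrow> X i b \<inter> X j c = {}"
    and move: "\<And>i j b c. i \<in> I \<Longrightarrow> j \<in> I \<Longrightarrow> (j, c) \<noteq> (i, \<not> b) \<Longrightarrow>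
      act (if b then \<tau> i else inv (\<tau> i)) ` X j c \<subseteq> X i b"
  shows "is_free_group G"
proof -
  define S where "S = \<tau> ` I"
  define \<iota> where "\<iota> = inv_into I \<tau>"
  define letter where "letter = (\<lambda>(s, b). if b then s else inv s)"
  let ?rel = "{([(s, b), (s, \<not> b)], []) | s b. s \<in> S}"
  let ?X = "S \<times> (UNIV :: bool set)"
  have \<iota>: "\<iota> s \<in> I" "\<tau> (\<iota> s) = s" if "s \<in> S" for s
    using that by (auto simp: S_def \<iota>_def inv_into_into f_inv_into_f)
  have SG: "S \<subseteq> carrier G" using \<tau> by (auto simp: S_def)
  have letter_closed: "letter ` ?X \<subseteq> carrier G"
    using SG by (auto simp: letter_def)
  have in_lists: "letter ` set w \<subseteq> carrier G" if "w \<in> lists ?X" for w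
    using that letter_closed by auto
  have "\<tau> i \<noteq> \<tau> j"
  proof
    assume eq: "\<tau> i = \<tau> j"
    obtain x where "x \<in> X j True" using nonempty[OF ij(2)] by blast
    then have "act (\<tau> i) x \<in> X i True" "act (\<tau> j) x \<in> X j True"
      using move[of i j True True] move[of j j True True] ij by auto
    then show False using disjoint[of i j True True] ij eq by auto
  qed
  then have two: "\<tau> i \<in> S" "\<tau> j \<in> S" "\<tau> i \<noteq> \<tau> j"
    using ij by (auto simp: S_def)
  define reduced :: "('a \<times> bool) list \<Rightarrow> bool" where
    "reduced = successively (\<lambda>x y. y \<noteq> (fst x, \<not> snd x))"
  define P where "P = (\<lambda>x :: 'a \<times> bool. X (\<iota> (fst x)) (snd x))"
  have P_move: "act (letter x) ` P y \<subseteq> P x" if "x \<in> ?X" "y \<in> ?X" "y \<noteq> (fst x, \<not> snd x)" for x y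
  proof -
    have "(\<iota> (fst y), snd y) \<noteq> (\<iota> (fst x), \<not> snd x)"
      using that \<iota>(2)[of "fst x"] \<iota>(2)[of "fst y"] by (cases x; cases y) auto
    moreover have "letter x = (if snd x then \<tau> (\<iota> (fst x)) else inv (\<tau> (\<iota> (fst x))))"
      using that \<iota>(2)[of "fst x"] by (cases x) (auto simp: letter_def)
    moreover have "\<iota> (fst x) \<in> I" "\<iota> (fst y) \<in> I"
      using that \<iota> by auto
    ultimately show ?thesis
      using move[of "\<iota> (fst x)" "\<iota> (fst y)" "snd y" "snd x"] by (simp add: P_def)
  qed
  have P_disjoint: "P x \<inter> P y = {}" if "x \<in> ?X" "y \<in> ?X" "x \<noteq> y" for x y
  proof -
    have "(\<iota> (fst y), snd y) \<noteq> (\<iota> (fst x), snd x)"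
      using that \<iota>(2)[of "fst x"] \<iota>(2)[of "fst y"] by (cases x; cases y) auto
    then show ?thesis
      using disjoint[of "\<iota> (fst x)" "\<iota> (fst y)" "snd x" "snd y"] that \<iota>
      by (auto simp: P_def)
  qed
  have word_move: "act (word_eval G letter w) ` P y \<subseteq> P (hd w)"
    if "w \<in> lists ?X" "w \<noteq> []" "reduced w" "y \<in> ?X" "y \<noteq> (fst (last w), \<not> snd (last w))" for w y
    using that
  proof (induction w)
    case (Cons x w)
    have x: "letter x \<in> carrier G" using Cons.hyps letter_closed by auto
    show ?case
    proof (cases "w = []")
      case True
      then show ?thesis
        using P_move[of x y] Cons.prems Cons.hyps x by simp
    next
      case False
      then have "hd w \<noteq> (fst x, \<not> snd x)" "reduced w"
        using Cons.prems by (cases w; simp add: reduced_def)+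
      moreover have "hd w \<in> ?X" using False Cons.hyps by (cases w) auto
      ultimately have "act (letter x) ` P (hd w) \<subseteq> P x" "act (word_eval G letter w) ` P y \<subseteq> P (hd w)"
        using P_move[of x "hd w"] Cons False by auto
      then show ?thesis
        using act_mult[OF x word_eval_closed[OF in_lists]] Cons.hyps by auto
    qed
  qed simp
  have nontrivial: "word_eval G letter w \<noteq> \<one>" if w: "w \<in> lists ?X" "w \<noteq> []" "reduced w" for w
  proof -
    have hd: "hd w \<in> ?X" using w by (cases w) auto
    define z where "z = (fst (last w), \<not> snd (last w))"
    obtain y where y: "y \<in> ?X" "y \<noteq> z" "y \<noteq> hd w"
    proof -
      have "\<exists>y\<in>{(\<tau> i, True), (\<tau> i, False), (\<tau> j, True)}. y \<noteq> z \<and> y \<noteq> hd w"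
        using two by (cases z; cases "hd w") auto
      then show ?thesis using that two by auto
    qed
    have "act (word_eval G letter w) ` P y \<subseteq> P (hd w)"
      using word_move[OF w y(1)] y(2) by (simp add: z_def)
    moreover have "P y \<inter> P (hd w) = {}" using y by (intro P_disjoint hd)
    moreover have "P y \<noteq> {}" using nonempty[OF \<iota>(1)[of "fst y"]] y(1) by (cases y) (simp add: P_def)
    ultimately show ?thesis using act_one by auto
  qed
  let ?C = "pres_cong ?X ?rel"
  have "pres_lift G letter \<in> iso (free_group S) G"
    unfolding free_group_def
  proof (rule pres_lift_iso[OF letter_closed])
    show "word_eval G letter l = word_eval G letter r" if "(l, r) \<in> ?rel" for l r
      using that SG by (auto simp: letter_def subset_iff)
    show "group (pres_monoid ?X ?rel)"
      using group_free_group[of S] by (simp add: free_group_def)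
    show "carrier G \<subseteq> word_eval G letter ` lists ?X"
    proof -
      have "s \<in> letter ` ?X \<and> inv s \<in> letter ` ?X" if "s \<in> S" for s
        using that image_eqI[of s letter "(s, True)" ?X] image_eqI[of "inv s" letter "(s, False)" ?X]
        by (simp add: letter_def)
      then show ?thesis
        unfolding gen using word_eval_generate[OF SG letter_closed] by (simp add: S_def)
    qed
    fix w assume w: "w \<in> lists ?X" "word_eval G letter w = \<one>"
    have "\<exists>v. v \<in> lists ?X \<and> reduced v \<and> (w, v) \<in> ?C"
      using w(1)
    proof (induction w)
      case Nil
      then show ?case
        by (intro exI[of _ "[]"]) (auto simp: reduced_def intro: pres_cong.refl)
    next
      case (Cons x w)
      then obtain v where v: "v \<in> lists ?X" "reduced v" "(w, v) \<in> ?C" by blast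
      have xv: "(x # w, x # v) \<in> ?C"
        using pres_cong_context[OF v(3), of "[x]" "[]"] Cons.hyps by simp
      show ?case
      proof (cases "v \<noteq> [] \<and> hd v = (fst x, \<not> snd x)")
        case True
        then obtain u where u: "v = (fst x, \<not> snd x) # u" by (cases v) auto
        have uX: "u \<in> lists ?X" using v(1) u by simp
        obtain t b where tb: "x = (t, b)" "t \<in> S" using Cons.hyps by (cases x) auto
        then have "([(t, b), (t, \<not> b)], []) \<in> ?rel" by blast
        then have "([] @ [(t, b), (t, \<not> b)] @ u, [] @ [] @ u) \<in> ?C"
          by (rule pres_cong.base) (simp_all add: tb uX)
        then have "(x # v, u) \<in> ?C" using u tb by simp
        then have "(x # w, u) \<in> ?C" by (rule pres_cong.trans[OF xv])
        moreover have "reduced u" using v(2) u by (cases u) (auto simp: reduced_def)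
        ultimately show ?thesis using uX by blast
      next
        case False
        then have "reduced (x # v)" using v(2) by (cases v) (auto simp: reduced_def)
        moreover have "x # v \<in> lists ?X" using Cons.hyps v(1) by simp
        ultimately show ?thesis using xv by blast
      qed
    qed
    then obtain v where v: "v \<in> lists ?X" "reduced v" "(w, v) \<in> ?C" by blast
    have "word_eval G letter w = word_eval G letter v"
      using SG by (intro word_eval_pres_cong[OF letter_closed _ v(3)])
        (auto simp: letter_def subset_iff)
    then have "v = []" using nontrivial[OF v(1) _ v(2)] w(2) by auto
    then show "(w, []) \<in> ?C" using v(3) by simp
  qed
  then show ?thesis
    unfolding is_free_group_def letter_def using SG is_group by blast
qed

end

section \<open>The cones and the positive powers of \<open>- R\<close>\<close>

lemma vector_4_nth [simp]:
  "(vector [a, b, c, d] :: 'a::zero ^ 4) $ 1 = a"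
  "(vector [a, b, c, d] :: 'a::zero ^ 4) $ 2 = b"
  "(vector [a, b, c, d] :: 'a::zero ^ 4) $ 3 = c"
  "(vector [a, b, c, d] :: 'a::zero ^ 4) $ 4 = d"
  by (simp_all add: vector_def)

lemma mult_T_components:
  "(T_mat *v x) $ 1 = x$1" "(T_mat *v x) $ 2 = x$2 + x$4"
  "(T_mat *v x) $ 3 = x$3" "(T_mat *v x) $ 4 = x$4"
  by (simp_all add: T_mat_def matrix_vector_mult_def sum_4)

lemma mult_R_components:
  "(R_mat d k *v x) $ 1 = x$1 + x$2"
  "(R_mat d k *v x) $ 2 = x$2 - k * x$2 - x$3 + x$4"
  "(R_mat d k *v x) $ 3 = d * x$1 + d * x$2 + x$3"
  "(R_mat d k *v x) $ 4 = - k * x$2 - x$3 + x$4"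
  by (simp_all add: R_mat_def U_mat_def mult_T_components matrix_vector_mul_assoc[symmetric])
    (simp_all add: matrix_vector_mult_def sum_4)

text \<open>For \<open>N = log (T R\<^sup>-\<^sup>1)\<close> the edges of this simplicial cone are \<open>v, N v, N\<^sup>2 v, N\<^sup>3 v\<close> with
\<open>v = (0, 1, -2, 0)\<close>, which is \<open>e\<^sub>2 - (2/d) N\<^sup>2 e\<^sub>2\<close>. The cone is open, so that the ping-pong sets are
disjoint.\<close>
definition cone_K :: "int \<Rightarrow> int \<Rightarrow> int ^ 4 \<Rightarrow> bool" where
  "cone_K d k x \<longleftrightarrow> x$1 < 0 \<and> x$4 < x$2 \<and> d * x$1 + 4 * x$4 < 4 * x$2 + 2 * x$3
     \<and> 0 < (6 * k - d - 12) * x$1 + 6 * x$4"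

text \<open>The inequalities of \<open>cone_K\<close> for \<open>T y\<close> together with those for \<open>- E T\<^sup>-\<^sup>1 y\<close>, where \<open>E\<close> is
\<open>reflection d\<close>.\<close>
definition cone_M :: "int \<Rightarrow> int \<Rightarrow> int ^ 4 \<Rightarrow> bool" where
  "cone_M d k x \<longleftrightarrow> x$1 < 0 \<and> 0 < x$2 \<and> x$2 < x$4 \<and> d * x$1 < 4 * x$2 + 2 * x$3
     \<and> 4 * x$2 + 2 * x$3 < d * x$1 + 4 * x$4
     \<and> 0 < (6 * k - d - 12) * x$1 + 6 * x$4"

text \<open>The involution that conjugates \<open>T\<close> and \<open>R\<close> to their inverses. It makes negative exponents a mirror
image of positive ones.\<close>
definition reflection :: "int \<Rightarrow> int ^ 4 \<Rightarrow> int ^ 4" where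
  "reflection d x = vector [- x$1, x$2 - x$4, x$3 - d * x$1, - x$4]"

lemma reflection_components:
  "reflection d x $ 1 = - x$1" "reflection d x $ 2 = x$2 - x$4"
  "reflection d x $ 3 = x$3 - d * x$1" "reflection d x $ 4 = - x$4"
  by (simp_all add: reflection_def)

text \<open>The images of \<open>cone_K\<close> under the powers of \<open>R\<close> lie alternately in the negative of \<open>cone_M\<close> and in
\<open>cone_M\<close> itself; for \<open>- R\<close> they all lie in \<open>cone_M\<close>.\<close>
definition minus_R :: "int \<Rightarrow> int \<Rightarrow> int ^ 4 \<Rightarrow> int ^ 4" where
  "minus_R d k x = - (R_mat d k *v x)"

lemma minus_R_components:
  "minus_R d k x $ 1 = - x$1 - x$2"
  "minus_R d k x $ 2 = k * x$2 - x$2 + x$3 - x$4"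
  "minus_R d k x $ 3 = - d * x$1 - d * x$2 - x$3"
  "minus_R d k x $ 4 = k * x$2 + x$3 - x$4"
  by (simp_all add: minus_R_def mult_R_components)

lemma minus_R_pow_numeral:
  "(minus_R d k ^^ numeral n) x = minus_R d k ((minus_R d k ^^ pred_numeral n) x)"
  by (simp add: numeral_eq_Suc)

lemma minus_R_pow_add: "(minus_R d k ^^ n) (x + y) = (minus_R d k ^^ n) x + (minus_R d k ^^ n) y"
  by (induction n) (simp_all add: minus_R_def matrix_vector_right_distrib)

text \<open>The closure of \<open>cone_M\<close>. Adding a vector of it does not leave the open cone.\<close>
definition weak_cone_M :: "int \<Rightarrow> int \<Rightarrow> int ^ 4 \<Rightarrow> bool" where
  "weak_cone_M d k x \<longleftrightarrow> x$1 \<le> 0 \<and> 0 \<le> x$2 \<and> x$2 \<le> x$4 \<and> d * x$1 \<le> 4 * x$2 + 2 * x$3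
     \<and> 4 * x$2 + 2 * x$3 \<le> d * x$1 + 4 * x$4
     \<and> 0 \<le> (6 * k - d - 12) * x$1 + 6 * x$4"

lemma cone_M_add_weak: "cone_M d k x \<Longrightarrow> weak_cone_M d k y \<Longrightarrow> cone_M d k (x + y)"
  by (simp add: cone_M_def weak_cone_M_def algebra_simps)

lemma weak_cone_M_add: "weak_cone_M d k x \<Longrightarrow> weak_cone_M d k y \<Longrightarrow> weak_cone_M d k (x + y)"
  by (simp add: weak_cone_M_def algebra_simps)

lemma weak_cone_M_0 [simp]: "weak_cone_M d k 0"
  by (simp add: weak_cone_M_def)

definition increment :: "int \<Rightarrow> int \<Rightarrow> nat \<Rightarrow> int ^ 4 \<Rightarrow> int ^ 4" where
  "increment d k p x = (minus_R d k ^^ p) x - x"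

lemma increment_0 [simp]: "increment d k p 0 = 0"
proof -
  have "(minus_R d k ^^ p) 0 = 0"
    using minus_R_pow_add[of p d k 0 0] by simp
  then show ?thesis by (simp add: increment_def)
qed

lemma increment_add: "increment d k p (x + y) = increment d k p x + increment d k p y"
  by (simp add: increment_def minus_R_pow_add)

text \<open>Since \<open>(- R)\<^sup>p = 1 + D\<close>, the binomial expansion of \<open>(- R)\<^bsup>p q\<^esup> x\<close> has the vectors \<open>D\<^sup>t x\<close> with
nonnegative coefficients. The condition bounds all of these at once, and it is inherited by
\<open>(- R)\<^sup>p x\<close>, which makes it an induction hypothesis for all exponents. Four iterations of \<open>D\<close>
suffice because a nilpotent endomorphism in dimension four has vanishing fourth power.\<close>
definition persistent :: "int \<Rightarrow> int \<Rightarrow> nat \<Rightarrow> int ^ 4 \<Rightarrow> bool" where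
  "persistent d k p x \<longleftrightarrow>
    (let D = increment d k p in
      cone_M d k x \<and> weak_cone_M d k (D x) \<and> weak_cone_M d k (D (D x))
      \<and> weak_cone_M d k (D (D (D x))) \<and> D (D (D (D x))) = 0)"

lemma persistent_step:
  assumes "persistent d k p x"
  shows "persistent d k p ((minus_R d k ^^ p) x)"
proof -
  have "(minus_R d k ^^ p) x = x + increment d k p x"
    by (simp add: increment_def)
  then show ?thesis
    using assms
    by (simp add: persistent_def Let_def increment_add cone_M_add_weak weak_cone_M_add)
qed

lemma persistent_cone_M:
  assumes p: "0 < p"
    and base: "\<And>r. 1 \<le> r \<Longrightarrow> r \<le> p \<Longrightarrow> persistent d k p ((minus_R d k ^^ r) x)"
    and i: "1 \<le> i"
  shows "cone_M d k ((minus_R d k ^^ i) x)"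
proof -
  have "persistent d k p ((minus_R d k ^^ i) x)"
    using i
  proof (induction i rule: less_induct)
    case (less i)
    show ?case
    proof (cases "i \<le> p")
      case True
      then show ?thesis using base less.prems by simp
    next
      case False
      then have "persistent d k p ((minus_R d k ^^ p) ((minus_R d k ^^ (i - p)) x))"
        using less.IH[of "i - p"] p by (intro persistent_step) simp
      moreover have "(minus_R d k ^^ i) x = (minus_R d k ^^ p) ((minus_R d k ^^ (i - p)) x)"
        using False funpow_add[of p "i - p" "minus_R d k"] by simp
      ultimately show ?thesis by simp
    qed
  qed
  then show ?thesis by (simp add: persistent_def Let_def)
qed

lemma minus_R_pow_increment:
  "increment d k p ((minus_R d k ^^ r) x) = (minus_R d k ^^ r) (increment d k p x)"
proof -
  have diff: "(minus_R d k ^^ r) (u - v) = (minus_R d k ^^ r) u - (minus_R d k ^^ r) v" for u v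
    using minus_R_pow_add[of r d k "u - v" v] by (simp add: algebra_simps)
  have "(minus_R d k ^^ p) ((minus_R d k ^^ r) x) = (minus_R d k ^^ r) ((minus_R d k ^^ p) x)"
    by (metis add.commute comp_apply funpow_add)
  then show ?thesis by (simp add: increment_def diff)
qed

text \<open>The case of Jordan blocks of size at most two in \<open>(- R)\<^sup>p\<close>.\<close>
lemma cone_M_powers_of_quasi_unipotent:
  assumes "0 < p" and nil: "\<And>v. increment d k p (increment d k p v) = 0"
    and base: "\<And>r. r \<in> {1..p} \<Longrightarrow> cone_M d k ((minus_R d k ^^ r) x)
      \<and> weak_cone_M d k ((minus_R d k ^^ r) (increment d k p x))"
    and "1 \<le> i"
  shows "cone_M d k ((minus_R d k ^^ i) x)"
proof (rule persistent_cone_M[OF assms(1) _ assms(4)])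
  fix r :: nat assume "1 \<le> r" "r \<le> p"
  then show "persistent d k p ((minus_R d k ^^ r) x)"
    using base[of r] nil by (simp add: persistent_def Let_def flip: minus_R_pow_increment)
qed

text \<open>Powers of \<open>- R\<close> in coordinates. With these tables, membership of \<open>(- R)\<^sup>i x\<close> in \<open>cone_M\<close> is a system
of linear inequalities that follows from the four inequalities of \<open>cone_K\<close> for \<open>x\<close> or its mirror image. For
\<open>(d, k) = (5, 5)\<close>, \<open>(2, 4)\<close> and \<open>(1, 4)\<close> the eigenvalues of \<open>R\<close> are distinct roots of unity and
\<open>(- R)\<^sup>m = - 1\<close> for \<open>m = 5\<close>, \<open>4\<close> and \<open>6\<close>, which leaves the exponents below \<open>m\<close>.\<close>
lemma minus_R_pow_5_5_1: "(minus_R 5 5 ^^ 1) x =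
    vector [- x$1 - x$2, 4 * x$2 + x$3 - x$4, - 5 * x$1 - 5 * x$2 - x$3, 5 * x$2 + x$3 - x$4]"
  by (simp add: vec_eq_iff forall_4 minus_R_components algebra_simps)

lemma minus_R_pow_5_5_2: "(minus_R 5 5 ^^ 2) x =
    vector [x$1 - 3 * x$2 - x$3 + x$4, - 5 * x$1 + 6 * x$2 + 2 * x$3 - 3 * x$4,
      10 * x$1 - 10 * x$2 - 4 * x$3 + 5 * x$4, - 5 * x$1 + 10 * x$2 + 3 * x$3 - 4 * x$4]"
  by (subst minus_R_pow_numeral)
    (simp add: minus_R_pow_5_5_1 vec_eq_iff forall_4 minus_R_components algebra_simps)

lemma minus_R_pow_5_5_3: "(minus_R 5 5 ^^ 3) x =
    vector [4 * x$1 - 3 * x$2 - x$3 + 2 * x$4, - 5 * x$1 + 4 * x$2 + x$3 - 3 * x$4,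
      10 * x$1 - 5 * x$2 - x$3 + 5 * x$4, - 10 * x$1 + 10 * x$2 + 3 * x$3 - 6 * x$4]"
  by (subst minus_R_pow_numeral)
    (simp add: minus_R_pow_5_5_2 vec_eq_iff forall_4 minus_R_components algebra_simps)

lemma minus_R_pow_5_5_4: "(minus_R 5 5 ^^ 4) x =
    vector [x$1 - x$2 + x$4, x$2 - x$4, - 5 * x$1 + x$3, - 5 * x$1 + 5 * x$2 + x$3 - 4 * x$4]"
  by (subst minus_R_pow_numeral)
    (simp add: minus_R_pow_5_5_3 vec_eq_iff forall_4 minus_R_components algebra_simps)

lemma minus_R_pow_5_5_5: "(minus_R 5 5 ^^ 5) x =
    vector [- x$1, - x$2, - x$3, - x$4]"
  by (subst minus_R_pow_numeral)
    (simp add: minus_R_pow_5_5_4 vec_eq_iff forall_4 minus_R_components algebra_simps)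

lemmas minus_R_pows_5_5 =
  minus_R_pow_5_5_1 minus_R_pow_5_5_2 minus_R_pow_5_5_3 minus_R_pow_5_5_4 minus_R_pow_5_5_5

lemma minus_R_pow_cone_5_5:
  assumes "x \<in> {y, reflection 5 y}" "cone_K 5 5 y" "i \<in> {1..<5}"
  shows "cone_M 5 5 ((minus_R 5 5 ^^ i) x)"
proof -
  have x: "x$1 = y$1 \<and> x$2 = y$2 \<and> x$3 = y$3 \<and> x$4 = y$4 \<or>
      x$1 = - y$1 \<and> x$2 = y$2 - y$4 \<and> x$3 = y$3 - 5 * y$1 \<and> x$4 = - y$4"
    using assms(1) by (auto simp: reflection_components)
  note cones = cone_K_def[of 5 5, simplified] cone_M_def[of 5 5, simplified]
    weak_cone_M_def[of 5 5, simplified]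
  note K = assms(2)[unfolded cones]
  have "i \<in> {1, 2, 3, 4}" using assms(3) by auto
  then show ?thesis
    using x K unfolding cones
    by - (elim insertE emptyE disjE conjE; intro conjI; simp only: minus_R_pows_5_5 vector_4_nth
      distrib_left right_diff_distrib mult_minus_right; linarith)
qed

lemma minus_R_pow_2_4_1: "(minus_R 2 4 ^^ 1) x =
    vector [- x$1 - x$2, 3 * x$2 + x$3 - x$4, - 2 * x$1 - 2 * x$2 - x$3, 4 * x$2 + x$3 - x$4]"
  by (simp add: vec_eq_iff forall_4 minus_R_components algebra_simps)

lemma minus_R_pow_2_4_2: "(minus_R 2 4 ^^ 2) x =
    vector [x$1 - 2 * x$2 - x$3 + x$4, - 2 * x$1 + 3 * x$2 + x$3 - 2 * x$4,
      4 * x$1 - 2 * x$2 - x$3 + 2 * x$4, - 2 * x$1 + 6 * x$2 + 2 * x$3 - 3 * x$4]"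
  by (subst minus_R_pow_numeral)
    (simp add: minus_R_pow_2_4_1 vec_eq_iff forall_4 minus_R_components algebra_simps)

lemma minus_R_pow_2_4_3: "(minus_R 2 4 ^^ 3) x =
    vector [x$1 - x$2 + x$4, x$2 - x$4, - 2 * x$1 + x$3, - 2 * x$1 + 4 * x$2 + x$3 - 3 * x$4]"
  by (subst minus_R_pow_numeral)
    (simp add: minus_R_pow_2_4_2 vec_eq_iff forall_4 minus_R_components algebra_simps)

lemma minus_R_pow_2_4_4: "(minus_R 2 4 ^^ 4) x =
    vector [- x$1, - x$2, - x$3, - x$4]"
  by (subst minus_R_pow_numeral)
    (simp add: minus_R_pow_2_4_3 vec_eq_iff forall_4 minus_R_components algebra_simps)

lemmas minus_R_pows_2_4 =
  minus_R_pow_2_4_1 minus_R_pow_2_4_2 minus_R_pow_2_4_3 minus_R_pow_2_4_4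

lemma minus_R_pow_cone_2_4:
  assumes "x \<in> {y, reflection 2 y}" "cone_K 2 4 y" "i \<in> {1..<4}"
  shows "cone_M 2 4 ((minus_R 2 4 ^^ i) x)"
proof -
  have x: "x$1 = y$1 \<and> x$2 = y$2 \<and> x$3 = y$3 \<and> x$4 = y$4 \<or>
      x$1 = - y$1 \<and> x$2 = y$2 - y$4 \<and> x$3 = y$3 - 2 * y$1 \<and> x$4 = - y$4"
    using assms(1) by (auto simp: reflection_components)
  note cones = cone_K_def[of 2 4, simplified] cone_M_def[of 2 4, simplified]
    weak_cone_M_def[of 2 4, simplified]
  note K = assms(2)[unfolded cones]
  have "i \<in> {1, 2, 3}" using assms(3) by auto
  then show ?thesis
    using x K unfolding cones
    by - (elim insertE emptyE disjE conjE; intro conjI; simp only: minus_R_pows_2_4 vector_4_nth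
      distrib_left right_diff_distrib mult_minus_right; linarith)
qed

lemma minus_R_pow_1_4_1: "(minus_R 1 4 ^^ 1) x =
    vector [- x$1 - x$2, 3 * x$2 + x$3 - x$4, - x$1 - x$2 - x$3, 4 * x$2 + x$3 - x$4]"
  by (simp add: vec_eq_iff forall_4 minus_R_components algebra_simps)

lemma minus_R_pow_1_4_2: "(minus_R 1 4 ^^ 2) x =
    vector [x$1 - 2 * x$2 - x$3 + x$4, - x$1 + 4 * x$2 + x$3 - 2 * x$4,
      2 * x$1 - x$2 + x$4, - x$1 + 7 * x$2 + 2 * x$3 - 3 * x$4]"
  by (subst minus_R_pow_numeral)
    (simp add: minus_R_pow_1_4_1 vec_eq_iff forall_4 minus_R_components algebra_simps)

lemma minus_R_pow_1_4_3: "(minus_R 1 4 ^^ 3) x =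
    vector [- 2 * x$2 + x$4, 4 * x$2 + x$3 - 2 * x$4,
      - 2 * x$1 - x$2, - x$1 + 8 * x$2 + 2 * x$3 - 4 * x$4]"
  by (subst minus_R_pow_numeral)
    (simp add: minus_R_pow_1_4_2 vec_eq_iff forall_4 minus_R_components algebra_simps)

lemma minus_R_pow_1_4_4: "(minus_R 1 4 ^^ 4) x =
    vector [- 2 * x$2 - x$3 + x$4, - x$1 + 3 * x$2 + x$3 - 2 * x$4,
      2 * x$1 - x$2 - x$3 + x$4, - x$1 + 7 * x$2 + 2 * x$3 - 4 * x$4]"
  by (subst minus_R_pow_numeral)
    (simp add: minus_R_pow_1_4_3 vec_eq_iff forall_4 minus_R_components algebra_simps)

lemma minus_R_pow_1_4_5: "(minus_R 1 4 ^^ 5) x =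
    vector [x$1 - x$2 + x$4, x$2 - x$4, - x$1 + x$3, - x$1 + 4 * x$2 + x$3 - 3 * x$4]"
  by (subst minus_R_pow_numeral)
    (simp add: minus_R_pow_1_4_4 vec_eq_iff forall_4 minus_R_components algebra_simps)

lemma minus_R_pow_1_4_6: "(minus_R 1 4 ^^ 6) x =
    vector [- x$1, - x$2, - x$3, - x$4]"
  by (subst minus_R_pow_numeral)
    (simp add: minus_R_pow_1_4_5 vec_eq_iff forall_4 minus_R_components algebra_simps)

lemmas minus_R_pows_1_4 =
  minus_R_pow_1_4_1 minus_R_pow_1_4_2 minus_R_pow_1_4_3 minus_R_pow_1_4_4 minus_R_pow_1_4_5
  minus_R_pow_1_4_6

lemma minus_R_pow_cone_1_4:
  assumes "x \<in> {y, reflection 1 y}" "cone_K 1 4 y" "i \<in> {1..<6}"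
  shows "cone_M 1 4 ((minus_R 1 4 ^^ i) x)"
proof -
  have x: "x$1 = y$1 \<and> x$2 = y$2 \<and> x$3 = y$3 \<and> x$4 = y$4 \<or>
      x$1 = - y$1 \<and> x$2 = y$2 - y$4 \<and> x$3 = y$3 - y$1 \<and> x$4 = - y$4"
    using assms(1) by (auto simp: reflection_components)
  note cones = cone_K_def[of 1 4, simplified] cone_M_def[of 1 4, simplified]
    weak_cone_M_def[of 1 4, simplified]
  note K = assms(2)[unfolded cones]
  have "i \<in> {1, 2, 3, 4, 5}" using assms(3) by auto
  then show ?thesis
    using x K unfolding cones
    by - (elim insertE emptyE disjE conjE; intro conjI; simp only: minus_R_pows_1_4 vector_4_nth
      distrib_left right_diff_distrib mult_minus_right; linarith)
qed

text \<open>The remaining four groups have an eigenvalue \<open>- 1\<close> with a nontrivial Jordan block. The order of the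
semisimple part of \<open>- R\<close> is the exponent \<open>p\<close>: it is \<open>6\<close>, \<open>4\<close> and \<open>3\<close> for \<open>(12, 7)\<close>, \<open>(8, 6)\<close> and
\<open>(4, 5)\<close>, where \<open>(- R)\<^sup>p\<close> has one Jordan block of size two.\<close>
lemma minus_R_pow_12_7_1: "(minus_R 12 7 ^^ 1) x =
    vector [- x$1 - x$2, 6 * x$2 + x$3 - x$4, - 12 * x$1 - 12 * x$2 - x$3, 7 * x$2 + x$3 - x$4]"
  by (simp add: vec_eq_iff forall_4 minus_R_components algebra_simps)

lemma minus_R_pow_12_7_2: "(minus_R 12 7 ^^ 2) x =
    vector [x$1 - 5 * x$2 - x$3 + x$4, - 12 * x$1 + 17 * x$2 + 4 * x$3 - 5 * x$4,
      24 * x$1 - 48 * x$2 - 11 * x$3 + 12 * x$4, - 12 * x$1 + 23 * x$2 + 5 * x$3 - 6 * x$4]"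
  by (subst minus_R_pow_numeral)
    (simp add: minus_R_pow_12_7_1 vec_eq_iff forall_4 minus_R_components algebra_simps)

lemma minus_R_pow_12_7_3: "(minus_R 12 7 ^^ 3) x =
    vector [11 * x$1 - 12 * x$2 - 3 * x$3 + 4 * x$4, - 36 * x$1 + 31 * x$2 + 8 * x$3 - 12 * x$4,
      108 * x$1 - 96 * x$2 - 25 * x$3 + 36 * x$4, - 48 * x$1 + 48 * x$2 + 12 * x$3 - 17 * x$4]"
  by (subst minus_R_pow_numeral)
    (simp add: minus_R_pow_12_7_2 vec_eq_iff forall_4 minus_R_components algebra_simps)

lemma minus_R_pow_12_7_4: "(minus_R 12 7 ^^ 4) x =
    vector [25 * x$1 - 19 * x$2 - 5 * x$3 + 8 * x$4, - 60 * x$1 + 42 * x$2 + 11 * x$3 - 19 * x$4,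
      192 * x$1 - 132 * x$2 - 35 * x$3 + 60 * x$4, - 96 * x$1 + 73 * x$2 + 19 * x$3 - 31 * x$4]"
  by (subst minus_R_pow_numeral)
    (simp add: minus_R_pow_12_7_3 vec_eq_iff forall_4 minus_R_components algebra_simps)

lemma minus_R_pow_12_7_5: "(minus_R 12 7 ^^ 5) x =
    vector [35 * x$1 - 23 * x$2 - 6 * x$3 + 11 * x$4, - 72 * x$1 + 47 * x$2 + 12 * x$3 - 23 * x$4,
      228 * x$1 - 144 * x$2 - 37 * x$3 + 72 * x$4, - 132 * x$1 + 89 * x$2 + 23 * x$3 - 42 * x$4]"
  by (subst minus_R_pow_numeral)
    (simp add: minus_R_pow_12_7_4 vec_eq_iff forall_4 minus_R_components algebra_simps)

lemma minus_R_pow_12_7_6: "(minus_R 12 7 ^^ 6) x =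
    vector [37 * x$1 - 24 * x$2 - 6 * x$3 + 12 * x$4, - 72 * x$1 + 49 * x$2 + 12 * x$3 - 24 * x$4,
      216 * x$1 - 144 * x$2 - 35 * x$3 + 72 * x$4, - 144 * x$1 + 96 * x$2 + 24 * x$3 - 47 * x$4]"
  by (subst minus_R_pow_numeral)
    (simp add: minus_R_pow_12_7_5 vec_eq_iff forall_4 minus_R_components algebra_simps)

lemmas minus_R_pows_12_7 =
  minus_R_pow_12_7_1 minus_R_pow_12_7_2 minus_R_pow_12_7_3 minus_R_pow_12_7_4 minus_R_pow_12_7_5
  minus_R_pow_12_7_6

lemma minus_R_pow_cone_12_7:
  assumes "x \<in> {y, reflection 12 y}" "cone_K 12 7 y" "1 \<le> i"
  shows "cone_M 12 7 ((minus_R 12 7 ^^ i) x)"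
proof (rule cone_M_powers_of_quasi_unipotent[OF _ _ _ assms(3)])
  show "0 < (6 :: nat)" by simp
  have D: "increment 12 7 6 v =
      vector [36 * v$1 - 24 * v$2 - 6 * v$3 + 12 * v$4, - 72 * v$1 + 48 * v$2 + 12 * v$3 - 24 * v$4,
        216 * v$1 - 144 * v$2 - 36 * v$3 + 72 * v$4, - 144 * v$1 + 96 * v$2 + 24 * v$3 - 48 * v$4]" for v
    unfolding increment_def minus_R_pow_12_7_6 by (simp add: vec_eq_iff forall_4)
  show "increment 12 7 6 (increment 12 7 6 v) = 0" for v
    unfolding D by (simp add: vec_eq_iff forall_4)
  have x: "x$1 = y$1 \<and> x$2 = y$2 \<and> x$3 = y$3 \<and> x$4 = y$4 \<or>
      x$1 = - y$1 \<and> x$2 = y$2 - y$4 \<and> x$3 = y$3 - 12 * y$1 \<and> x$4 = - y$4"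
    using assms(1) by (auto simp: reflection_components)
  note cones = cone_K_def[of 12 7, simplified] cone_M_def[of 12 7, simplified]
    weak_cone_M_def[of 12 7, simplified]
  note K = assms(2)[unfolded cones]
  fix r :: nat assume "r \<in> {1..6}"
  then have "r \<in> {1, 2, 3, 4, 5, 6}" by auto
  then show "cone_M 12 7 ((minus_R 12 7 ^^ r) x)
      \<and> weak_cone_M 12 7 ((minus_R 12 7 ^^ r) (increment 12 7 6 x))"
    using x K unfolding cones D
    by - (elim insertE emptyE disjE conjE; intro conjI; simp only: minus_R_pows_12_7 vector_4_nth
      distrib_left right_diff_distrib mult_minus_right; linarith)
qed

lemma minus_R_pow_8_6_1: "(minus_R 8 6 ^^ 1) x =
    vector [- x$1 - x$2, 5 * x$2 + x$3 - x$4, - 8 * x$1 - 8 * x$2 - x$3, 6 * x$2 + x$3 - x$4]"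
  by (simp add: vec_eq_iff forall_4 minus_R_components algebra_simps)

lemma minus_R_pow_8_6_2: "(minus_R 8 6 ^^ 2) x =
    vector [x$1 - 4 * x$2 - x$3 + x$4, - 8 * x$1 + 11 * x$2 + 3 * x$3 - 4 * x$4,
      16 * x$1 - 24 * x$2 - 7 * x$3 + 8 * x$4, - 8 * x$1 + 16 * x$2 + 4 * x$3 - 5 * x$4]"
  by (subst minus_R_pow_numeral)
    (simp add: minus_R_pow_8_6_1 vec_eq_iff forall_4 minus_R_components algebra_simps)

lemma minus_R_pow_8_6_3: "(minus_R 8 6 ^^ 3) x =
    vector [7 * x$1 - 7 * x$2 - 2 * x$3 + 3 * x$4, - 16 * x$1 + 15 * x$2 + 4 * x$3 - 7 * x$4,
      40 * x$1 - 32 * x$2 - 9 * x$3 + 16 * x$4, - 24 * x$1 + 26 * x$2 + 7 * x$3 - 11 * x$4]"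
  by (subst minus_R_pow_numeral)
    (simp add: minus_R_pow_8_6_2 vec_eq_iff forall_4 minus_R_components algebra_simps)

lemma minus_R_pow_8_6_4: "(minus_R 8 6 ^^ 4) x =
    vector [9 * x$1 - 8 * x$2 - 2 * x$3 + 4 * x$4, - 16 * x$1 + 17 * x$2 + 4 * x$3 - 8 * x$4,
      32 * x$1 - 32 * x$2 - 7 * x$3 + 16 * x$4, - 32 * x$1 + 32 * x$2 + 8 * x$3 - 15 * x$4]"
  by (subst minus_R_pow_numeral)
    (simp add: minus_R_pow_8_6_3 vec_eq_iff forall_4 minus_R_components algebra_simps)

lemmas minus_R_pows_8_6 =
  minus_R_pow_8_6_1 minus_R_pow_8_6_2 minus_R_pow_8_6_3 minus_R_pow_8_6_4

lemma minus_R_pow_cone_8_6: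
  assumes "x \<in> {y, reflection 8 y}" "cone_K 8 6 y" "1 \<le> i"
  shows "cone_M 8 6 ((minus_R 8 6 ^^ i) x)"
proof (rule cone_M_powers_of_quasi_unipotent[OF _ _ _ assms(3)])
  show "0 < (4 :: nat)" by simp
  have D: "increment 8 6 4 v =
      vector [8 * v$1 - 8 * v$2 - 2 * v$3 + 4 * v$4, - 16 * v$1 + 16 * v$2 + 4 * v$3 - 8 * v$4,
        32 * v$1 - 32 * v$2 - 8 * v$3 + 16 * v$4, - 32 * v$1 + 32 * v$2 + 8 * v$3 - 16 * v$4]" for v
    unfolding increment_def minus_R_pow_8_6_4 by (simp add: vec_eq_iff forall_4)
  show "increment 8 6 4 (increment 8 6 4 v) = 0" for v
    unfolding D by (simp add: vec_eq_iff forall_4)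
  have x: "x$1 = y$1 \<and> x$2 = y$2 \<and> x$3 = y$3 \<and> x$4 = y$4 \<or>
      x$1 = - y$1 \<and> x$2 = y$2 - y$4 \<and> x$3 = y$3 - 8 * y$1 \<and> x$4 = - y$4"
    using assms(1) by (auto simp: reflection_components)
  note cones = cone_K_def[of 8 6, simplified] cone_M_def[of 8 6, simplified]
    weak_cone_M_def[of 8 6, simplified]
  note K = assms(2)[unfolded cones]
  fix r :: nat assume "r \<in> {1..4}"
  then have "r \<in> {1, 2, 3, 4}" by auto
  then show "cone_M 8 6 ((minus_R 8 6 ^^ r) x)
      \<and> weak_cone_M 8 6 ((minus_R 8 6 ^^ r) (increment 8 6 4 x))"
    using x K unfolding cones D
    by - (elim insertE emptyE disjE conjE; intro conjI; simp only: minus_R_pows_8_6 vector_4_nth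
      distrib_left right_diff_distrib mult_minus_right; linarith)
qed

lemma minus_R_pow_4_5_1: "(minus_R 4 5 ^^ 1) x =
    vector [- x$1 - x$2, 4 * x$2 + x$3 - x$4, - 4 * x$1 - 4 * x$2 - x$3, 5 * x$2 + x$3 - x$4]"
  by (simp add: vec_eq_iff forall_4 minus_R_components algebra_simps)

lemma minus_R_pow_4_5_2: "(minus_R 4 5 ^^ 2) x =
    vector [x$1 - 3 * x$2 - x$3 + x$4, - 4 * x$1 + 7 * x$2 + 2 * x$3 - 3 * x$4,
      8 * x$1 - 8 * x$2 - 3 * x$3 + 4 * x$4, - 4 * x$1 + 11 * x$2 + 3 * x$3 - 4 * x$4]"
  by (subst minus_R_pow_numeral)
    (simp add: minus_R_pow_4_5_1 vec_eq_iff forall_4 minus_R_components algebra_simps)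

lemma minus_R_pow_4_5_3: "(minus_R 4 5 ^^ 3) x =
    vector [3 * x$1 - 4 * x$2 - x$3 + 2 * x$4, - 4 * x$1 + 9 * x$2 + 2 * x$3 - 4 * x$4,
      4 * x$1 - 8 * x$2 - x$3 + 4 * x$4, - 8 * x$1 + 16 * x$2 + 4 * x$3 - 7 * x$4]"
  by (subst minus_R_pow_numeral)
    (simp add: minus_R_pow_4_5_2 vec_eq_iff forall_4 minus_R_components algebra_simps)

lemmas minus_R_pows_4_5 =
  minus_R_pow_4_5_1 minus_R_pow_4_5_2 minus_R_pow_4_5_3

lemma minus_R_pow_cone_4_5:
  assumes "x \<in> {y, reflection 4 y}" "cone_K 4 5 y" "1 \<le> i"
  shows "cone_M 4 5 ((minus_R 4 5 ^^ i) x)"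
proof (rule cone_M_powers_of_quasi_unipotent[OF _ _ _ assms(3)])
  show "0 < (3 :: nat)" by simp
  have D: "increment 4 5 3 v =
      vector [2 * v$1 - 4 * v$2 - v$3 + 2 * v$4, - 4 * v$1 + 8 * v$2 + 2 * v$3 - 4 * v$4,
        4 * v$1 - 8 * v$2 - 2 * v$3 + 4 * v$4, - 8 * v$1 + 16 * v$2 + 4 * v$3 - 8 * v$4]" for v
    unfolding increment_def minus_R_pow_4_5_3 by (simp add: vec_eq_iff forall_4)
  show "increment 4 5 3 (increment 4 5 3 v) = 0" for v
    unfolding D by (simp add: vec_eq_iff forall_4)
  have x: "x$1 = y$1 \<and> x$2 = y$2 \<and> x$3 = y$3 \<and> x$4 = y$4 \<or>
      x$1 = - y$1 \<and> x$2 = y$2 - y$4 \<and> x$3 = y$3 - 4 * y$1 \<and> x$4 = - y$4"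
    using assms(1) by (auto simp: reflection_components)
  note cones = cone_K_def[of 4 5, simplified] cone_M_def[of 4 5, simplified]
    weak_cone_M_def[of 4 5, simplified]
  note K = assms(2)[unfolded cones]
  fix r :: nat assume "r \<in> {1..3}"
  then have "r \<in> {1, 2, 3}" by auto
  then show "cone_M 4 5 ((minus_R 4 5 ^^ r) x)
      \<and> weak_cone_M 4 5 ((minus_R 4 5 ^^ r) (increment 4 5 3 x))"
    using x K unfolding cones D
    by - (elim insertE emptyE disjE conjE; intro conjI; simp only: minus_R_pows_4_5 vector_4_nth
      distrib_left right_diff_distrib mult_minus_right; linarith)
qed

text \<open>For \<open>(d, k) = (16, 8)\<close> the matrix \<open>- R\<close> is itself unipotent, with a single Jordan block of size four.\<close>
lemma minus_R_pow_16_8_1: "(minus_R 16 8 ^^ 1) x =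
    vector [- x$1 - x$2, 7 * x$2 + x$3 - x$4, - 16 * x$1 - 16 * x$2 - x$3, 8 * x$2 + x$3 - x$4]"
  by (simp add: vec_eq_iff forall_4 minus_R_components algebra_simps)

lemma minus_R_pow_cone_16_8:
  assumes "x \<in> {y, reflection 16 y}" "cone_K 16 8 y" "1 \<le> i"
  shows "cone_M 16 8 ((minus_R 16 8 ^^ i) x)"
proof (rule persistent_cone_M[OF _ _ assms(3)])
  show "0 < (1 :: nat)" by simp
  have x: "x$1 = y$1 \<and> x$2 = y$2 \<and> x$3 = y$3 \<and> x$4 = y$4 \<or>
      x$1 = - y$1 \<and> x$2 = y$2 - y$4 \<and> x$3 = y$3 - 16 * y$1 \<and> x$4 = - y$4"
    using assms(1) by (auto simp: reflection_components)
  note cones = cone_K_def[of 16 8, simplified] cone_M_def[of 16 8, simplified]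
    weak_cone_M_def[of 16 8, simplified]
  note K = assms(2)[unfolded cones]
  let ?D = "increment 16 8 1" and ?z = "(minus_R 16 8 ^^ 1) x"
  note z = minus_R_pow_16_8_1[of x]
  note step = increment_def minus_R_pow_16_8_1
  have D1: "?D ?z =
      vector [2 * x$1 - 5 * x$2 - x$3 + x$4, - 16 * x$1 + 18 * x$2 + 4 * x$3 - 5 * x$4,
      48 * x$1 - 64 * x$2 - 14 * x$3 + 16 * x$4, - 16 * x$1 + 24 * x$2 + 5 * x$3 - 6 * x$4]"
    unfolding z unfolding step by (simp add: vec_eq_iff forall_4 algebra_simps)
  have D2: "?D (?D ?z) = vector
      [12 * x$1 - 8 * x$2 - 2 * x$3 + 3 * x$4, - 32 * x$1 + 20 * x$2 + 5 * x$3 - 8 * x$4,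
       128 * x$1 - 80 * x$2 - 20 * x$3 + 32 * x$4, - 48 * x$1 + 32 * x$2 + 8 * x$3 - 12 * x$4]"
    unfolding D1 unfolding step by (simp add: vec_eq_iff forall_4 algebra_simps)
  \<comment> \<open>The cube of \<open>?D\<close> has rank one, so its values are multiples of a fixed vector by a linear form.\<close>
  define l where "l = 8 * x$1 - 4 * x$2 - x$3 + 2 * x$4"
  have D3: "?D (?D (?D ?z)) = vector [l, - 2 * l, 8 * l, - 4 * l]"
    unfolding D2 unfolding step by (simp add: vec_eq_iff forall_4 l_def algebra_simps)
  have D4: "?D (?D (?D (?D ?z))) = 0"
    unfolding D3 unfolding step by (simp add: vec_eq_iff forall_4)
  note distribs = vector_4_nth distrib_left right_diff_distrib mult_minus_right
  have "cone_M 16 8 ?z"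
    using x K unfolding z cones distribs by - (elim disjE conjE; intro conjI; linarith)
  moreover have "weak_cone_M 16 8 (?D ?z)"
    using x K unfolding D1 cones distribs by - (elim disjE conjE; intro conjI; linarith)
  moreover have "weak_cone_M 16 8 (?D (?D ?z))"
    using x K unfolding D2 cones distribs by - (elim disjE conjE; intro conjI; linarith)
  moreover have "l \<le> 0"
    using x K unfolding l_def by - (elim disjE conjE; linarith)
  then have "weak_cone_M 16 8 (?D (?D (?D ?z)))"
    unfolding D3 weak_cone_M_def by simp
  ultimately have P: "persistent 16 8 1 ?z" using D4 by (simp add: persistent_def)
  fix r :: nat assume "1 \<le> r" "r \<le> 1"
  then have "r = 1" by simp
  then show "persistent 16 8 1 ((minus_R 16 8 ^^ r) x)" using P by simp
qed

section \<open>The action of the group on cones\<close>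

interpretation Sp4Z: group Sp4Z
  by (rule group_Sp4Z)

lemma Sp4_simps:
  "x \<otimes>\<^bsub>Sp4\<^esub> y = x ** y" "\<one>\<^bsub>Sp4\<^esub> = mat 1"
  "x \<in> carrier Sp4 \<longleftrightarrow> transpose x ** J4 ** x = J4"
  by (simp_all add: Sp4_def)

lemma act_one [simp]: "\<one>\<^bsub>Sp4Z\<^esub> *v x = x"
  by (simp add: Sp4_simps)

lemma act_mult: "(g \<otimes>\<^bsub>Sp4Z\<^esub> h) *v x = g *v (h *v x)"
  by (simp add: Sp4_simps matrix_vector_mul_assoc)

lemma act_inv: "g \<in> carrier Sp4Z \<Longrightarrow> inv\<^bsub>Sp4Z\<^esub> g *v (g *v x) = x"
  "g \<in> carrier Sp4Z \<Longrightarrow> g *v (inv\<^bsub>Sp4Z\<^esub> g *v x) = x"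
  by (simp_all flip: act_mult add: act_one)

lemma int_matrix_eqI:
  fixes A B :: "int ^ 4 ^ 4"
  assumes "\<And>x. A *v x = B *v x"
  shows "A = B"
  using assms by (simp add: matrix_eq)

lemma minus_matrix_vector: "(- A) *v x = - (A *v (x :: int ^ 'n))"
  by (simp add: vec_eq_iff matrix_vector_mult_def sum_negf)

lemma matrix_vector_minus: "A *v (- x) = - (A *v (x :: int ^ 'n))"
  by (simp add: vec_eq_iff matrix_vector_mult_def sum_negf)

lemma minus_one_Sp4Z: "- mat 1 \<in> carrier Sp4Z"
  by (simp add: Sp4_simps vec_eq_iff forall_4 matrix_matrix_mult_def sum_4 mat_def transpose_def J4_def)

lemma T_mat_Sp4Z: "T_mat \<in> carrier Sp4Z"
  by (simp add: Sp4_simps vec_eq_iff forall_4 matrix_matrix_mult_def sum_4 T_mat_def transpose_def J4_def)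

lemma U_mat_Sp4Z: "U_mat d k \<in> carrier Sp4Z"
  by (simp add: Sp4_simps vec_eq_iff forall_4 matrix_matrix_mult_def sum_4 U_mat_def transpose_def J4_def)

lemma R_mat_Sp4Z: "R_mat d k \<in> carrier Sp4Z"
  using Sp4Z.m_closed[OF T_mat_Sp4Z U_mat_Sp4Z] by (simp add: R_mat_def Sp4_simps(1))

lemmas generators_Sp4Z [simp] = minus_one_Sp4Z T_mat_Sp4Z U_mat_Sp4Z R_mat_Sp4Z

subsection \<open>Powers of the generators\<close>

lemma T_pow_act: "(T_mat [^]\<^bsub>Sp4Z\<^esub> (n :: int)) *v x = x + vector [0, n * x$4, 0, 0]"
proof -
  have nat: "(T_mat [^]\<^bsub>Sp4Z\<^esub> (n :: nat)) *v x = x + vector [0, int n * x$4, 0, 0]" for n x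
    by (induction n arbitrary: x)
      (simp_all add: act_one act_mult vec_eq_iff forall_4 mult_T_components algebra_simps)
  show ?thesis
  proof (cases "n \<ge> 0")
    case True
    then show ?thesis using nat[of "nat n"] by (simp add: pow_nat)
  next
    case False
    define m where "m = nat (- n)"
    then have n: "n = - int m" using False by simp
    let ?g = "T_mat [^]\<^bsub>Sp4Z\<^esub> m"
    have "x = ?g *v (x + vector [0, n * x$4, 0, 0])"
      unfolding nat n by (simp add: vec_eq_iff forall_4)
    then have "inv\<^bsub>Sp4Z\<^esub> ?g *v x = x + vector [0, n * x$4, 0, 0]"
      using act_inv(1)[of ?g] by (metis Sp4Z.nat_pow_closed T_mat_Sp4Z)
    then show ?thesis by (simp add: n Sp4Z.int_pow_neg_int)
  qed
qed

lemma T_pow_components: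
  "((T_mat [^]\<^bsub>Sp4Z\<^esub> (n :: int)) *v x) $ 1 = x$1"
  "((T_mat [^]\<^bsub>Sp4Z\<^esub> (n :: int)) *v x) $ 2 = x$2 + n * x$4"
  "((T_mat [^]\<^bsub>Sp4Z\<^esub> (n :: int)) *v x) $ 3 = x$3"
  "((T_mat [^]\<^bsub>Sp4Z\<^esub> (n :: int)) *v x) $ 4 = x$4"
  by (simp_all add: T_pow_act)

lemma reflection_minus: "reflection d (- x) = - reflection d x"
  by (simp add: vec_eq_iff forall_4 reflection_components)

lemma reflection_reflection [simp]: "reflection d (reflection d x) = x"
  by (simp add: vec_eq_iff forall_4 reflection_components)

lemma minus_R_reflection: "minus_R d k (reflection d (minus_R d k (reflection d x))) = x"
  by (simp add: vec_eq_iff forall_4 reflection_components minus_R_components algebra_simps)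

lemma minus_R_pow_reflection: "(minus_R d k ^^ n) (reflection d ((minus_R d k ^^ n) (reflection d x))) = x"
proof (induction n arbitrary: x)
  case (Suc n)
  define z where "z = reflection d (minus_R d k (reflection d x))"
  have "(minus_R d k ^^ Suc n) (reflection d ((minus_R d k ^^ Suc n) (reflection d x)))
      = minus_R d k ((minus_R d k ^^ n) (reflection d ((minus_R d k ^^ n) (reflection d z))))"
    by (simp add: z_def funpow_swap1)
  then show ?case by (simp add: Suc.IH) (simp add: z_def minus_R_reflection)
qed simp

lemma minus_R_pow_minus: "(minus_R d k ^^ n) (- x) = - ((minus_R d k ^^ n) x)"
  by (induction n) (simp_all add: minus_R_def matrix_vector_minus)

lemma R_pow_act_nat: "(R_mat d k [^]\<^bsub>Sp4Z\<^esub> (n :: nat)) *v x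
    = (if even n then (minus_R d k ^^ n) x else - ((minus_R d k ^^ n) x))"
proof (induction n arbitrary: x)
  case (Suc n)
  have "R_mat d k *v x = - minus_R d k x" by (simp add: minus_R_def)
  then show ?case by (simp add: act_mult Suc.IH minus_R_pow_minus funpow_swap1)
qed (simp add: act_one)

lemma R_pow_act_neg: "(R_mat d k [^]\<^bsub>Sp4Z\<^esub> (- int n)) *v x
    = reflection d ((R_mat d k [^]\<^bsub>Sp4Z\<^esub> n) *v reflection d x)"
proof -
  let ?g = "R_mat d k [^]\<^bsub>Sp4Z\<^esub> n"
  have "?g *v (reflection d (?g *v reflection d x)) = x"
    using minus_R_pow_reflection[of n d k x] by (simp add: R_pow_act_nat reflection_minus minus_R_pow_minus)
  then have "inv\<^bsub>Sp4Z\<^esub> ?g *v x = reflection d (?g *v reflection d x)"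
    using act_inv(1)[of ?g] by (metis Sp4Z.nat_pow_closed R_mat_Sp4Z)
  then show ?thesis by (simp add: Sp4Z.int_pow_neg_int)
qed

subsection \<open>Cones under powers of \<open>T\<close>\<close>

text \<open>The hypothesis \<open>slope\<close> forces \<open>x$4 > 0\<close> on \<open>cone_K\<close>, and this is the sign that decides in which
direction \<open>T\<close> moves a point. The first two alternatives of \<open>minus_R_pow\<close> are the powers of \<open>R\<close> that
act as a sign.\<close>
locale ping_pong_cones =
  fixes d k :: int
  assumes slope: "0 \<le> 6 * k - d - 12"
    and minus_R_pow: "\<And>i. 1 \<le> i \<Longrightarrow>
      (\<forall>x. (minus_R d k ^^ i) x = x) \<or> (\<forall>x. (minus_R d k ^^ i) x = - x) \<or>
      (\<forall>x y. cone_K d k y \<longrightarrow> x \<in> {y, reflection d y} \<longrightarrow>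
        cone_M d k ((minus_R d k ^^ i) x) \<or> cone_M d k (- ((minus_R d k ^^ i) x)))"
begin

text \<open>The regions \<open>\<plusminus> K\<close> for \<open>s = True\<close> and \<open>\<plusminus> E K\<close> for \<open>s = False\<close>: the attracting regions of the
positive and of the negative powers of \<open>T\<close>. The sign is included since \<open>- 1\<close> may lie in the group.\<close>
definition attract :: "bool \<Rightarrow> (int ^ 4) set" where
  "attract s = {x. let y = (if s then x else reflection d x) in cone_K d k y \<or> cone_K d k (- y)}"

definition core :: "(int ^ 4) set" where
  "core = {x. cone_M d k x \<or> cone_M d k (- x)}"

lemma attract_minus [simp]: "- x \<in> attract s \<longleftrightarrow> x \<in> attract s"
  by (auto simp: attract_def Let_def reflection_minus)

lemma core_minus [simp]: "- x \<in> core \<longleftrightarrow> x \<in> core"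
  by (auto simp: core_def)

lemma attract_reflection: "reflection d x \<in> attract s \<longleftrightarrow> x \<in> attract (\<not> s)"
  by (simp add: attract_def)

lemma core_reflection [simp]: "reflection d x \<in> core \<longleftrightarrow> x \<in> core"
  by (auto simp: core_def cone_M_def reflection_components algebra_simps)

lemma cone_K_pos: "cone_K d k x \<Longrightarrow> 0 < x$4"
proof -
  assume K: "cone_K d k x"
  then have "(6 * k - d - 12) * x$1 \<le> 0"
    using slope by (simp add: cone_K_def mult_nonneg_nonpos)
  then show ?thesis using K unfolding cone_K_def by linarith
qed

lemma T_pow_reflection:
  "reflection d ((T_mat [^]\<^bsub>Sp4Z\<^esub> (n :: int)) *v x) = (T_mat [^]\<^bsub>Sp4Z\<^esub> (- n)) *v reflection d x"
  by (simp add: vec_eq_iff forall_4 reflection_components T_pow_components)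

text \<open>The map \<open>T\<close> adds \<open>x$4\<close> to the second coordinate. One step leads from \<open>cone_M\<close> into \<open>cone_K\<close>, and
further steps only increase a coordinate which is bounded from below there.\<close>
lemma cone_M_T_pow:
  assumes "cone_M d k x" "1 \<le> n"
  shows "cone_K d k ((T_mat [^]\<^bsub>Sp4Z\<^esub> (n :: int)) *v x)"
proof -
  define p where "p = n * x$4"
  have "x$4 \<le> p"
    using assms mult_right_mono[of 1 n "x$4"] by (auto simp: cone_M_def p_def)
  then show ?thesis
    using assms(1) by (auto simp: cone_M_def cone_K_def T_pow_components simp flip: p_def)
qed

lemma cone_K_T_pow:
  assumes "cone_K d k x" "1 \<le> n"
  shows "cone_K d k ((T_mat [^]\<^bsub>Sp4Z\<^esub> (n :: int)) *v x)"
proof -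
  define p where "p = n * x$4"
  have "0 < p"
    using assms cone_K_pos by (simp add: p_def)
  then show ?thesis
    using assms(1) by (auto simp: cone_K_def T_pow_components simp flip: p_def)
qed

lemma T_pow_core:
  assumes "n \<noteq> 0" "x \<in> core"
  shows "(T_mat [^]\<^bsub>Sp4Z\<^esub> (n :: int)) *v x \<in> attract (0 < n)"
proof -
  have pos: "(T_mat [^]\<^bsub>Sp4Z\<^esub> (n :: int)) *v x \<in> attract True" if "0 < n" "x \<in> core" for n x
    using that cone_M_T_pow[of x n] cone_M_T_pow[of "- x" n]
    by (auto simp: core_def attract_def matrix_vector_minus)
  show ?thesis
  proof (cases "0 < n")
    case True
    then show ?thesis using pos assms by simp
  next
    case False
    then have "(T_mat [^]\<^bsub>Sp4Z\<^esub> (- n)) *v reflection d x \<in> attract True"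
      using assms by (intro pos) auto
    then show ?thesis
      using False by (simp flip: T_pow_reflection add: attract_reflection)
  qed
qed

lemma T_pow_attract:
  assumes "n \<noteq> 0" "x \<in> attract (0 < n)"
  shows "(T_mat [^]\<^bsub>Sp4Z\<^esub> (n :: int)) *v x \<in> attract (0 < n)"
proof -
  have pos: "(T_mat [^]\<^bsub>Sp4Z\<^esub> (n :: int)) *v x \<in> attract True" if "0 < n" "x \<in> attract True" for n x
    using that cone_K_T_pow[of x n] cone_K_T_pow[of "- x" n]
    by (auto simp: attract_def matrix_vector_minus)
  show ?thesis
  proof (cases "0 < n")
    case True
    then show ?thesis using pos assms by simp
  next
    case False
    then have "(T_mat [^]\<^bsub>Sp4Z\<^esub> (- n)) *v reflection d x \<in> attract True"
      using assms by (intro pos) (auto simp: attract_reflection)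
    then show ?thesis
      using False by (simp flip: T_pow_reflection add: attract_reflection)
  qed
qed

lemma attract_disjoint: "attract True \<inter> attract False = {}"
proof -
  have "\<not> cone_K d k (reflection d x)" "\<not> cone_K d k (- reflection d x)" if "cone_K d k x" for x
    using that cone_K_pos[OF that] cone_K_pos[of "reflection d x"]
    by (auto simp: cone_K_def reflection_components)
  then show ?thesis
    unfolding attract_def Let_def using reflection_minus[of d]
    by (auto; metis minus_minus)
qed

lemma attract_core_disjoint: "attract s \<inter> core = {}"
proof -
  have M: "\<not> cone_K d k x" "\<not> cone_K d k (- x)" if "cone_M d k x" for x
    using that by (auto simp: cone_M_def cone_K_def)
  then have True: "x \<notin> attract True" if "x \<in> core" for x
    using that by (auto simp: core_def attract_def) (metis minus_minus)+
  have "x \<notin> attract s" if "x \<in> core" for x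
    using True[of x] True[of "reflection d x"] that by (cases s) (simp_all add: attract_reflection)
  then show ?thesis by auto
qed

lemma attract_nonempty: "attract s \<noteq> {}"
proof -
  let ?c = "6 * k - d - 12"
  \<comment> \<open>The first coordinate is fixed at \<open>- 1\<close>, the fourth exceeds \<open>?c\<close> to satisfy the last inequality,
    and the other two are large enough for the inequalities in between.\<close>
  have "vector [- 1, ?c + 2, \<bar>d\<bar>, ?c + 1] \<in> attract True"
    using slope by (auto simp: attract_def cone_K_def)
  moreover from this have "reflection d (vector [- 1, ?c + 2, \<bar>d\<bar>, ?c + 1]) \<in> attract False"
    by (simp add: attract_reflection)
  ultimately show ?thesis by (cases s) auto
qed

lemma core_nonempty: "core \<noteq> {}"
proof -
  \<comment> \<open>The first three coordinates satisfy the lower bounds, and the fourth only has to be large.\<close>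
  have "vector [- 1, 1, \<bar>d\<bar>, 2 * \<bar>d\<bar> + (6 * k - d - 12) + 2] \<in> core"
    using slope by (auto simp: core_def cone_M_def)
  then show ?thesis by auto
qed

subsection \<open>Cones under powers of \<open>R\<close>\<close>

lemma R_pow_attract_nat:
  fixes n :: nat
  assumes "1 \<le> n"
  shows "R_mat d k [^]\<^bsub>Sp4Z\<^esub> n \<in> {mat 1, - mat 1} \<or>
    (\<forall>s. \<forall>x\<in>attract s. (R_mat d k [^]\<^bsub>Sp4Z\<^esub> n) *v x \<in> core)"
proof -
  let ?g = "R_mat d k [^]\<^bsub>Sp4Z\<^esub> n"
  consider "\<And>x. (minus_R d k ^^ n) x = x" | "\<And>x. (minus_R d k ^^ n) x = - x"
    | "\<And>x y. cone_K d k y \<Longrightarrow> x = y \<or> x = reflection d y \<Longrightarrow> (minus_R d k ^^ n) x \<in> core"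
    using minus_R_pow[OF assms] by (auto simp: core_def)
  then show ?thesis
  proof cases
    case 1
    then have "(\<forall>x. ?g *v x = mat 1 *v x) \<or> (\<forall>x. ?g *v x = (- mat 1) *v x)"
      by (simp add: R_pow_act_nat minus_matrix_vector)
    then show ?thesis using int_matrix_eqI by blast
  next
    case 2
    then have "(\<forall>x. ?g *v x = mat 1 *v x) \<or> (\<forall>x. ?g *v x = (- mat 1) *v x)"
      by (simp add: R_pow_act_nat minus_matrix_vector)
    then show ?thesis using int_matrix_eqI by blast
  next
    case 3
    have "(minus_R d k ^^ n) x \<in> core" if x: "x \<in> attract s" for x s
    proof -
      obtain y where "cone_K d k y" "x = y \<or> x = reflection d y \<or> - x = y \<or> - x = reflection d y"
      proof -
        define y where "y = (if s then x else reflection d x)"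
        have "cone_K d k y \<or> cone_K d k (- y)" using x by (simp add: attract_def y_def Let_def)
        moreover have "x = y \<or> x = reflection d y" by (simp add: y_def)
        then have "- x = - y \<or> - x = reflection d (- y)" by (auto simp: reflection_minus)
        ultimately show thesis using that[of y] that[of "- y"] \<open>x = y \<or> x = reflection d y\<close> by blast
      qed
      then show ?thesis using 3[of y x] 3[of y "- x"] by (auto simp: minus_R_pow_minus)
    qed
    then show ?thesis by (auto simp: R_pow_act_nat)
  qed
qed

text \<open>A negative power of \<open>R\<close> is conjugate under \<open>reflection d\<close> to a positive one, and \<open>reflection d\<close>
preserves \<open>core\<close> and exchanges the two attracting regions.\<close>
lemma R_pow_attract:
  "R_mat d k [^]\<^bsub>Sp4Z\<^esub> (i :: int) \<in> {mat 1, - mat 1} \<or>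
    (\<forall>s. \<forall>x\<in>attract s. (R_mat d k [^]\<^bsub>Sp4Z\<^esub> i) *v x \<in> core)"
proof -
  consider "i = 0" | n where "i = int n" "1 \<le> n" | n where "i = - int n" "1 \<le> n"
    by (metis int_cases3 of_nat_0_less_iff less_one not_le zero_less_iff_neq_zero less_eq_nat.simps(1) Suc_leI One_nat_def)
  then show ?thesis
  proof cases
    case 1
    then show ?thesis by (simp add: Sp4_simps)
  next
    case 2
    then show ?thesis using R_pow_attract_nat[of n] by (simp add: int_pow_int)
  next
    case (3 n)
    let ?g = "R_mat d k [^]\<^bsub>Sp4Z\<^esub> n"
    from R_pow_attract_nat[OF 3(2)] show ?thesis
    proof
      assume g: "?g \<in> {mat 1, - mat 1}"
      have "(\<forall>x. (R_mat d k [^]\<^bsub>Sp4Z\<^esub> i) *v x = mat 1 *v x)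
          \<or> (\<forall>x. (R_mat d k [^]\<^bsub>Sp4Z\<^esub> i) *v x = (- mat 1) *v x)"
        using g by (auto simp: 3(1) R_pow_act_neg minus_matrix_vector reflection_minus)
      then show ?thesis using int_matrix_eqI by blast
    next
      assume *: "\<forall>s. \<forall>x\<in>attract s. ?g *v x \<in> core"
      have "?g *v reflection d x \<in> core" if "x \<in> attract s" for x s
        using * that attract_reflection[of x "\<not> s"] by auto
      then show ?thesis by (auto simp: 3(1) R_pow_act_neg)
    qed
  qed
qed

text \<open>The two possibilities for \<open>A\<close> and \<open>B\<close> in mind are cyclic groups \<open>\<langle>T\<rangle>\<close>, \<open>\<langle>R\<rangle>\<close> that meet trivially
and groups that share the centre \<open>{1, - 1}\<close>. In both, letters outside the other factor are nontrivial
powers up to sign, and signs do not change the regions.\<close>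
lemma alternating_nontrivial:
  assumes AB: "A \<subseteq> carrier Sp4Z" "B \<subseteq> carrier Sp4Z"
    and A: "\<And>a. a \<in> A - B \<Longrightarrow>
      \<exists>n. n \<noteq> 0 \<and> (a = T_mat [^]\<^bsub>Sp4Z\<^esub> (n :: int) \<or> a = - (T_mat [^]\<^bsub>Sp4Z\<^esub> n))"
    and B: "\<And>b. b \<in> B - A \<Longrightarrow> b \<notin> {mat 1, - mat 1} \<and> (\<exists>i. b = R_mat d k [^]\<^bsub>Sp4Z\<^esub> (i :: int))"
    and w: "alternating A B w" "2 \<le> length w"
  shows "word_eval Sp4Z id w \<noteq> \<one>\<^bsub>Sp4Z\<^esub>"
proof (rule Sp4Z.alternating_ping_pong[where act = "(*v)" and X = attract and Y = core, OF AB _ _ _ _ _ _ _ _ w])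
  show "\<exists>s. (*v) a ` core \<subseteq> attract s" if a: "a \<in> A - B" for a
  proof -
    obtain n where "n \<noteq> 0" "a = T_mat [^]\<^bsub>Sp4Z\<^esub> (n :: int) \<or> a = - (T_mat [^]\<^bsub>Sp4Z\<^esub> n)"
      using A[OF a] by blast
    then show ?thesis
      using T_pow_core[of n] by (intro exI[of _ "0 < n"]) (auto simp: minus_matrix_vector)
  qed
  show "(*v) b ` attract s \<subseteq> core" if "b \<in> B - A" for b s
    using B[OF that] R_pow_attract by blast
qed (simp_all add: act_one act_mult attract_disjoint attract_core_disjoint attract_nonempty core_nonempty)

end

section \<open>Cyclic subgroups\<close>

text \<open>Since \<open>integer_mod_group 0\<close> is the group of all integers, \<open>N = 0\<close> covers elements of infinite order.\<close>
lemma (in group) int_pow_mon: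
  assumes x: "x \<in> carrier G" and ord: "\<And>i :: int. x [^] i = \<one> \<longleftrightarrow> int N dvd i"
  shows "(\<lambda>i :: int. x [^] i) \<in> mon (integer_mod_group N) G"
    and "(\<lambda>i :: int. x [^] i) ` carrier (integer_mod_group N) = generate G {x}"
proof -
  have mod: "x [^] (i mod int N) = x [^] i" for i :: int
  proof -
    have "x [^] (i - i mod int N) = \<one>" by (simp add: ord minus_mod_eq_mult_div)
    then have "x [^] ((i - i mod int N) + i mod int N) = x [^] (i mod int N)"
      using x by (subst int_pow_mult) simp_all
    then show ?thesis by simp
  qed
  have "(\<lambda>i :: int. x [^] i) \<in> hom (integer_mod_group N) G"
    using x by (intro homI) (simp_all add: mod int_pow_mult)
  moreover have "i = j"
    if ij: "i \<in> carrier (integer_mod_group N)" "j \<in> carrier (integer_mod_group N)" "x [^] i = x [^] j"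
    for i j :: int
  proof -
    have "x [^] (i + - j) = \<one>"
      using ij(3) x by (subst int_pow_mult) (simp_all add: int_pow_neg)
    then have "int N dvd i - j" by (simp add: ord)
    then have "i mod int N = j mod int N" by (simp add: mod_eq_dvd_iff)
    then show ?thesis
      using ij(1,2) by (auto simp: carrier_integer_mod_group split: if_splits)
  qed
  ultimately show "(\<lambda>i :: int. x [^] i) \<in> mon (integer_mod_group N) G"
    by (auto simp: mon_def inj_on_def)
  show "(\<lambda>i :: int. x [^] i) ` carrier (integer_mod_group N) = generate G {x}"
  proof -
    have "x [^] i \<in> (\<lambda>i :: int. x [^] i) ` carrier (integer_mod_group N)" for i :: int
    proof (rule image_eqI[of _ _ "i mod int N"])
      show "x [^] i = x [^] (i mod int N)" by (simp add: mod)
      show "i mod int N \<in> carrier (integer_mod_group N)"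
        by (simp add: carrier_integer_mod_group)
    qed
    then show ?thesis using generate_pow[OF x] by auto
  qed
qed

lemma mon_image_is_iso:
  assumes "group A" "\<alpha> \<in> mon A G"
  shows "G\<lparr>carrier := \<alpha> ` carrier A\<rparr> \<cong> A"
proof (rule group.iso_sym[OF assms(1)])
  have "\<alpha> \<in> iso A (G\<lparr>carrier := \<alpha> ` carrier A\<rparr>)"
    using assms(2) by (auto simp: iso_def mon_def hom_def bij_betw_def)
  then show "A \<cong> G\<lparr>carrier := \<alpha> ` carrier A\<rparr>" by (auto simp: is_iso_def)
qed

lemma minus_matrix_mult: "(- A) ** B = - (A ** (B :: int ^ 'n ^ 'n))"
  by (simp add: vec_eq_iff matrix_matrix_mult_def sum_negf)

lemma matrix_mult_minus: "A ** (- B) = - (A ** (B :: int ^ 'n ^ 'n))"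
  by (simp add: vec_eq_iff matrix_matrix_mult_def sum_negf)

lemma T_pow_eq_sign:
  assumes "T_mat [^]\<^bsub>Sp4Z\<^esub> (n :: int) \<in> {mat 1, - mat 1}"
  shows "n = 0"
proof -
  have "(T_mat [^]\<^bsub>Sp4Z\<^esub> n) *v axis 4 1 = axis 4 1 \<or>
      (T_mat [^]\<^bsub>Sp4Z\<^esub> n) *v axis 4 1 = - axis 4 1"
    using assms by (auto simp: minus_matrix_vector)
  then show ?thesis by (auto simp: T_pow_act vec_eq_iff forall_4 axis_def)
qed

lemma T_pow_eq_one: "T_mat [^]\<^bsub>Sp4Z\<^esub> (n :: int) = \<one>\<^bsub>Sp4Z\<^esub> \<longleftrightarrow> int 0 dvd n"
  using T_pow_eq_sign[of n] by (auto simp: Sp4_simps)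

lemma minus_one_pow: "(- mat 1) [^]\<^bsub>Sp4Z\<^esub> (i :: int) = (if even i then mat 1 else - mat 1)"
proof -
  have nat: "(- mat 1) [^]\<^bsub>Sp4Z\<^esub> n = (if even n then mat 1 else - mat 1)" for n :: nat
    by (induction n) (auto simp: Sp4_simps minus_matrix_mult matrix_mult_minus)
  show ?thesis
  proof (cases "0 \<le> i")
    case True
    then show ?thesis using nat[of "nat i"] by (simp add: pow_nat even_nat_iff)
  next
    case False
    have "inv\<^bsub>Sp4Z\<^esub> (- mat 1) = - mat 1"
      by (rule Sp4Z.inv_equality) (simp_all add: Sp4_simps(1,2) minus_matrix_mult matrix_mult_minus)
    moreover have "inv\<^bsub>Sp4Z\<^esub> (mat 1) = mat 1"
      using Sp4Z.inv_one by (simp add: Sp4_simps)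
    ultimately show ?thesis
      using False nat[of "nat (- i)"] Sp4Z.int_pow_neg_int[of "- mat 1" "nat (- i)"]
      by (simp add: even_nat_iff)
  qed
qed

section \<open>Splittings\<close>

lemma hyp_group_simps:
  "carrier (hyp_group d k) = generate Sp4Z {R_mat d k, T_mat}"
  "(hyp_group d k)\<lparr>carrier := A\<rparr> = Sp4Z\<lparr>carrier := A\<rparr>"
  "x \<otimes>\<^bsub>hyp_group d k\<^esub> y = x ** y" "\<one>\<^bsub>hyp_group d k\<^esub> = mat 1"
  by (simp_all add: hyp_group_def Sp4_simps)

lemma word_eval_hyp_group: "word_eval (hyp_group d k) = word_eval Sp4Z"
  by (simp add: fun_eq_iff word_eval_def hyp_group_def)

lemma subgroup_hyp_group: "subgroup (generate Sp4Z {R_mat d k, T_mat}) Sp4Z"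
  by (intro Sp4Z.generate_is_subgroup) auto

lemma group_hyp_group: "group (hyp_group d k)"
  unfolding hyp_group_def by (rule Sp4Z.subgroup_imp_group[OF subgroup_hyp_group])

context ping_pong_cones begin

text \<open>A nontrivial power of \<open>T\<close> keeps its attracting region, while a power of \<open>R\<close> other than \<open>\<plusminus> 1\<close> moves
it into the disjoint set \<open>core\<close>.\<close>
lemma T_pow_eq_R_pow:
  assumes "R_mat d k [^]\<^bsub>Sp4Z\<^esub> (i :: int) = T_mat [^]\<^bsub>Sp4Z\<^esub> (n :: int) \<or>
    R_mat d k [^]\<^bsub>Sp4Z\<^esub> i = - (T_mat [^]\<^bsub>Sp4Z\<^esub> n)"
  shows "n = 0"
proof (rule ccontr)
  assume n: "n \<noteq> 0"
  have "R_mat d k [^]\<^bsub>Sp4Z\<^esub> i \<notin> {mat 1, - mat 1}"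
    using T_pow_eq_sign[of n] n assms by (auto simp: minus_equation_iff)
  then have core: "(R_mat d k [^]\<^bsub>Sp4Z\<^esub> i) *v x \<in> core" if "x \<in> attract (0 < n)" for x
    using R_pow_attract[of i] that by blast
  obtain x where x: "x \<in> attract (0 < n)" using attract_nonempty by blast
  have "(R_mat d k [^]\<^bsub>Sp4Z\<^esub> i) *v x \<in> attract (0 < n)"
    using assms T_pow_attract[OF n x] by (auto simp: minus_matrix_vector)
  then show False using core[OF x] attract_core_disjoint by blast
qed

text \<open>A common description of the pairs \<open>\<langle>T\<rangle>, \<langle>R\<rangle>\<close> and \<open>\<langle>- 1, T\<rangle>, \<langle>R\<rangle>\<close>. The last condition says that the
sign \<open>- 1\<close>, if it occurs, is shared, so that \<open>A - B\<close> and \<open>B - A\<close> contain no sign.\<close>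
definition splitting :: "(int ^ 4 ^ 4) set \<Rightarrow> (int ^ 4 ^ 4) set \<Rightarrow> bool" where
  "splitting A B \<longleftrightarrow> subgroup A Sp4Z \<and> subgroup B Sp4Z \<and> T_mat \<in> A \<and>
    generate Sp4Z (A \<union> B) = generate Sp4Z {R_mat d k, T_mat} \<and>
    (\<forall>a\<in>A. \<exists>n :: int. a = T_mat [^]\<^bsub>Sp4Z\<^esub> n \<or> a = - (T_mat [^]\<^bsub>Sp4Z\<^esub> n)) \<and>
    (\<forall>b\<in>B. \<exists>i :: int. b = R_mat d k [^]\<^bsub>Sp4Z\<^esub> i) \<and> (- mat 1 \<in> A \<longleftrightarrow> - mat 1 \<in> B)"

lemma splitting_nontrivial:
  assumes AB: "splitting A B" and w: "alternating A B w" "2 \<le> length w"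
  shows "word_eval Sp4Z id w \<noteq> \<one>\<^bsub>Sp4Z\<^esub>"
proof (rule alternating_nontrivial[OF _ _ _ _ w])
  have one: "mat 1 \<in> A" "mat 1 \<in> B"
    using AB subgroup.one_closed by (fastforce simp: splitting_def Sp4_simps)+
  show "A \<subseteq> carrier Sp4Z" "B \<subseteq> carrier Sp4Z"
    using AB by (auto simp: splitting_def dest: subgroup.subset)
  show "\<exists>n. n \<noteq> 0 \<and> (a = T_mat [^]\<^bsub>Sp4Z\<^esub> (n :: int) \<or> a = - (T_mat [^]\<^bsub>Sp4Z\<^esub> n))"
    if a: "a \<in> A - B" for a
  proof -
    obtain n where n: "a = T_mat [^]\<^bsub>Sp4Z\<^esub> (n :: int) \<or> a = - (T_mat [^]\<^bsub>Sp4Z\<^esub> n)"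
      using AB a unfolding splitting_def by blast
    have "n \<noteq> 0"
    proof
      assume "n = 0"
      then have "a = mat 1 \<or> a = - mat 1" using n by (simp add: Sp4_simps)
      then show False using a one AB by (auto simp: splitting_def)
    qed
    with n show ?thesis by blast
  qed
  show "b \<notin> {mat 1, - mat 1} \<and> (\<exists>i. b = R_mat d k [^]\<^bsub>Sp4Z\<^esub> (i :: int))" if "b \<in> B - A" for b
    using that AB one by (auto simp: splitting_def)
qed

lemma splitting_inter:
  assumes "splitting A B" "g \<in> A" "g \<in> B"
  shows "g \<in> {mat 1, - mat 1}"
proof -
  obtain n i :: int where "g = T_mat [^]\<^bsub>Sp4Z\<^esub> n \<or> g = - (T_mat [^]\<^bsub>Sp4Z\<^esub> n)"
    "g = R_mat d k [^]\<^bsub>Sp4Z\<^esub> i"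
    using assms unfolding splitting_def by metis
  then show ?thesis using T_pow_eq_R_pow[of i n] by (auto simp: Sp4_simps)
qed

text \<open>Stated for arbitrary models \<open>\<A>\<close>, \<open>\<B>\<close> of the factors: the inclusions of \<open>A\<close> and \<open>B\<close> give the internal
amalgam, integer models give the isomorphism type.\<close>
lemma splitting_iso:
  assumes AB: "splitting A B"
    and \<A>: "group \<A>" and \<B>: "group \<B>" and \<alpha>: "\<alpha> \<in> mon \<A> Sp4Z" and \<beta>: "\<beta> \<in> mon \<B> Sp4Z"
    and img: "\<alpha> ` carrier \<A> = A" "\<beta> ` carrier \<B> = B"
    and f: "f ` carrier H \<subseteq> carrier \<A>" and g: "g ` carrier H \<subseteq> carrier \<B>"
    and agree: "\<And>h. h \<in> carrier H \<Longrightarrow> \<alpha> (f h) = \<beta> (g h)"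
    and inter: "\<And>a b. a \<in> carrier \<A> \<Longrightarrow> b \<in> carrier \<B> \<Longrightarrow> \<alpha> a = \<beta> b \<Longrightarrow>
      \<exists>h\<in>carrier H. a = f h \<and> b = g h"
  shows "pres_lift (hyp_group d k) (case_sum \<alpha> \<beta>) \<in> iso (amalgam \<A> \<B> H f g) (hyp_group d k)"
proof (rule group.amalgam_iso[where \<alpha> = \<alpha> and \<beta> = \<beta> and f = f and g = g and H = H,
      OF group_hyp_group \<A> \<B> _ _ f g agree inter])
  let ?G = "generate Sp4Z {R_mat d k, T_mat}"
  have G: "generate Sp4Z (A \<union> B) = ?G" using AB by (simp add: splitting_def)
  then have sub: "A \<union> B \<subseteq> ?G" using generate.incl[of _ "A \<union> B" Sp4Z] by blast
  show "\<alpha> \<in> mon \<A> (hyp_group d k)" "\<beta> \<in> mon \<B> (hyp_group d k)"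
    using \<alpha> \<beta> sub img by (auto simp: mon_def hom_def hyp_group_def)
  show "carrier (hyp_group d k) = generate (hyp_group d k) (\<alpha> ` carrier \<A> \<union> \<beta> ` carrier \<B>)"
    unfolding hyp_group_def img using Sp4Z.generate_consistent[OF sub subgroup_hyp_group] G by simp
  show "word_eval (hyp_group d k) id w \<noteq> \<one>\<^bsub>hyp_group d k\<^esub>"
    if "alternating (\<alpha> ` carrier \<A>) (\<beta> ` carrier \<B>) w" "2 \<le> length w" for w
    using splitting_nontrivial[OF AB] that
    by (simp add: img word_eval_hyp_group hyp_group_simps Sp4_simps)
qed

lemma splitting_is_amalgam:
  assumes AB: "splitting A B"
  shows "is_amalgam (hyp_group d k) A B (A \<inter> B)"
proof -
  have sub: "subgroup A Sp4Z" "subgroup B Sp4Z" using AB by (auto simp: splitting_def)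
  have incl: "A \<union> B \<subseteq> generate Sp4Z {R_mat d k, T_mat}"
    using AB generate.incl[of _ "A \<union> B" Sp4Z] unfolding splitting_def by blast
  have gr: "group (Sp4Z\<lparr>carrier := A\<rparr>)" "group (Sp4Z\<lparr>carrier := B\<rparr>)"
    using sub by (simp_all add: Sp4Z.subgroup_imp_group)
  have mon: "id \<in> mon (Sp4Z\<lparr>carrier := A\<rparr>) Sp4Z" "id \<in> mon (Sp4Z\<lparr>carrier := B\<rparr>) Sp4Z"
    using subgroup.subset[OF sub(1)] subgroup.subset[OF sub(2)] by (auto simp: mon_def hom_def)
  have "pres_lift (hyp_group d k) (case_sum id id)
      \<in> iso (amalgam (Sp4Z\<lparr>carrier := A\<rparr>) (Sp4Z\<lparr>carrier := B\<rparr>) (Sp4Z\<lparr>carrier := A \<inter> B\<rparr>) id id)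
          (hyp_group d k)"
    by (rule splitting_iso[OF AB gr mon]) auto
  moreover have "subgroup A (hyp_group d k)" "subgroup B (hyp_group d k)"
    unfolding hyp_group_def using sub incl Sp4Z.subgroup_incl[OF _ subgroup_hyp_group]
    by simp_all
  ultimately show ?thesis
    unfolding is_amalgam_def hyp_group_simps by (simp add: group_hyp_group)
qed

subsection \<open>Infinite index\<close>

text \<open>The transvections along \<open>e\<^sub>1\<close>. They commute with \<open>T\<close>, which is a transvection along \<open>e\<^sub>2\<close>, because
\<open>e\<^sub>1\<close> and \<open>e\<^sub>2\<close> are orthogonal for the symplectic form.\<close>
definition shear :: "int \<Rightarrow> int ^ 4 ^ 4" where
  "shear n = vector [vector [1, 0, n, 0], vector [0, 1, 0, 0], vector [0, 0, 1, 0], vector [0, 0, 0, 1]]"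

lemma shear_Sp4Z: "shear n \<in> carrier Sp4Z"
  by (simp add: Sp4_simps vec_eq_iff forall_4 matrix_matrix_mult_def sum_4 shear_def transpose_def J4_def)

lemma shear_mult: "shear m ** shear n = shear (m + n)"
  by (simp add: vec_eq_iff forall_4 matrix_matrix_mult_def sum_4 shear_def)

text \<open>A subgroup of finite index contains \<open>shear q\<close> for some \<open>q \<noteq> 0\<close>. This element centralises \<open>T\<close> without
being a power of \<open>T\<close> up to sign, contrary to \<open>alternating_centralizer\<close>.\<close>
lemma splitting_infinite_index:
  assumes AB: "splitting A B"
  shows "\<not> finite_index Sp4Z (carrier (hyp_group d k))"
proof
  let ?G = "generate Sp4Z {R_mat d k, T_mat}"
  note sub = subgroup_hyp_group[of d k]
  assume "finite_index Sp4Z (carrier (hyp_group d k))"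
  then have "finite (rcosets\<^bsub>Sp4Z\<^esub> ?G)" by (simp add: finite_index_def hyp_group_simps)
  moreover have "range (\<lambda>n. ?G #>\<^bsub>Sp4Z\<^esub> shear (int n)) \<subseteq> rcosets\<^bsub>Sp4Z\<^esub> ?G"
    using shear_Sp4Z by (auto simp: RCOSETS_def)
  ultimately have "\<not> inj (\<lambda>n. ?G #>\<^bsub>Sp4Z\<^esub> shear (int n))"
    using finite_subset finite_imageD by blast
  then obtain m n where mn: "m < n" "?G #>\<^bsub>Sp4Z\<^esub> shear (int m) = ?G #>\<^bsub>Sp4Z\<^esub> shear (int n)"
  proof -
    assume "\<not> inj (\<lambda>n. ?G #>\<^bsub>Sp4Z\<^esub> shear (int n))"
    then obtain a b where ab: "a \<noteq> b" "?G #>\<^bsub>Sp4Z\<^esub> shear (int a) = ?G #>\<^bsub>Sp4Z\<^esub> shear (int b)"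
      unfolding inj_def by blast
    then show thesis using that[of a b] that[of b a] by (cases "a < b") simp_all
  qed
  then have "shear (int n) \<in> ?G #>\<^bsub>Sp4Z\<^esub> shear (int m)"
    using Sp4Z.rcos_self[OF shear_Sp4Z sub] by simp
  then obtain g where g: "g \<in> ?G" "shear (int n) = g ** shear (int m)"
    by (auto simp: r_coset_def Sp4_simps)
  define q where "q = int n - int m"
  have "shear (int n) ** shear (- int m) = g ** (shear (int m) ** shear (- int m))"
    by (simp add: g(2) matrix_mul_assoc)
  moreover have "shear 0 = mat 1"
    by (simp add: vec_eq_iff forall_4 shear_def mat_def)
  ultimately have gq: "g = shear q" by (simp add: shear_mult q_def)
  let ?H = "hyp_group d k"
  have AB': "subgroup A ?H" "subgroup B ?H"
    using splitting_is_amalgam[OF AB] by (simp_all add: is_amalgam_def)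
  have A_form: "\<exists>n :: int. a = T_mat [^]\<^bsub>Sp4Z\<^esub> n \<or> a = - (T_mat [^]\<^bsub>Sp4Z\<^esub> n)" if "a \<in> A" for a
    using AB that by (auto simp: splitting_def)
  have TB: "T_mat \<notin> B"
  proof
    assume "T_mat \<in> B"
    then obtain i where "T_mat = R_mat d k [^]\<^bsub>Sp4Z\<^esub> (i :: int)"
      using AB by (auto simp: splitting_def)
    then show False using T_pow_eq_R_pow[of i 1] by (simp add: Sp4Z.int_pow_1)
  qed
  have "g \<in> A"
  proof (rule group.alternating_centralizer[OF group_hyp_group AB', where t = T_mat])
    have "A \<union> B \<subseteq> ?G" using AB generate.incl[of _ "A \<union> B" Sp4Z] unfolding splitting_def by blast
    then show "carrier ?H = generate ?H (A \<union> B)"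
      using Sp4Z.generate_consistent[of "A \<union> B" ?G] sub AB by (simp add: splitting_def hyp_group_def)
    show "a \<otimes>\<^bsub>?H\<^esub> b = b \<otimes>\<^bsub>?H\<^esub> a" if ab: "a \<in> A" "b \<in> A" for a b
    proof -
      obtain i j :: int where "a = T_mat [^]\<^bsub>Sp4Z\<^esub> i \<or> a = - (T_mat [^]\<^bsub>Sp4Z\<^esub> i)"
        "b = T_mat [^]\<^bsub>Sp4Z\<^esub> j \<or> b = - (T_mat [^]\<^bsub>Sp4Z\<^esub> j)"
        using A_form ab by metis
      moreover have "T_mat [^]\<^bsub>Sp4Z\<^esub> i ** T_mat [^]\<^bsub>Sp4Z\<^esub> j = T_mat [^]\<^bsub>Sp4Z\<^esub> j ** T_mat [^]\<^bsub>Sp4Z\<^esub> i"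
        using Sp4Z.int_pow_mult[OF T_mat_Sp4Z, of i j] Sp4Z.int_pow_mult[OF T_mat_Sp4Z, of j i]
        by (simp add: Sp4_simps add.commute)
      ultimately show ?thesis
        by (auto simp: hyp_group_simps minus_matrix_mult matrix_mult_minus)
    qed
    show "word_eval ?H id w \<noteq> \<one>\<^bsub>?H\<^esub>" if "alternating A B w" "2 \<le> length w" for w
      using splitting_nontrivial[OF AB that]
      by (simp add: word_eval_hyp_group hyp_group_simps Sp4_simps)
    show "T_mat \<in> A - B" using AB TB by (simp add: splitting_def)
    show "g \<in> carrier ?H" using g(1) by (simp add: hyp_group_simps)
    show "g \<otimes>\<^bsub>?H\<^esub> T_mat = T_mat \<otimes>\<^bsub>?H\<^esub> g"
      by (simp add: hyp_group_simps gq vec_eq_iff forall_4 matrix_matrix_mult_def sum_4 shear_def T_mat_def)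
  qed
  then obtain j where "g = T_mat [^]\<^bsub>Sp4Z\<^esub> (j :: int) \<or> g = - (T_mat [^]\<^bsub>Sp4Z\<^esub> j)"
    using A_form by blast
  then have "(g *v axis 3 1) $ 1 = 0"
    by (auto simp: minus_matrix_vector T_pow_components axis_def)
  moreover have "(g *v axis 3 1) $ 1 = q"
    by (simp add: gq shear_def matrix_vector_mult_def sum_4 axis_def)
  ultimately show False using mn(1) by (simp add: q_def)
qed

end

subsection \<open>Reduction to a single period of \<open>R\<close>\<close>

lemma minus_R_pow_sign:
  assumes "\<And>x. (minus_R d k ^^ m) x = - x"
  shows "(minus_R d k ^^ (m * q)) x = (if even q then x else - x)"
  by (induction q) (simp_all add: funpow_add assms minus_R_pow_minus)

lemma ping_pong_cones_finite:
  assumes slope: "0 \<le> 6 * k - d - 12" and m: "1 \<le> m" and period: "\<And>x. (minus_R d k ^^ m) x = - x"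
    and incl: "\<And>i x y. i \<in> {1..<m} \<Longrightarrow> x \<in> {y, reflection d y} \<Longrightarrow> cone_K d k y \<Longrightarrow>
      cone_M d k ((minus_R d k ^^ i) x)"
  shows "ping_pong_cones d k"
proof
  show "0 \<le> 6 * k - d - 12" by fact
  fix i :: nat
  define q r where "q = i div m" and "r = i mod m"
  have i: "i = r + m * q" and r: "r < m" using m by (simp_all add: q_def r_def)
  have pow: "(minus_R d k ^^ i) x = (if even q then (minus_R d k ^^ r) x else - (minus_R d k ^^ r) x)" for x
    unfolding i funpow_add by (simp add: minus_R_pow_sign[OF period] minus_R_pow_minus)
  show "(\<forall>x. (minus_R d k ^^ i) x = x) \<or> (\<forall>x. (minus_R d k ^^ i) x = - x) \<or>
      (\<forall>x y. cone_K d k y \<longrightarrow> x \<in> {y, reflection d y} \<longrightarrow>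
        cone_M d k ((minus_R d k ^^ i) x) \<or> cone_M d k (- ((minus_R d k ^^ i) x)))"
  proof (cases "r = 0")
    case True
    then show ?thesis by (simp add: pow)
  next
    case False
    then have "r \<in> {1..<m}" using r by simp
    then show ?thesis using incl[of r] by (auto simp: pow)
  qed
qed

context ping_pong_cones begin

lemma R_pow_nontrivial:
  assumes "\<And>y. cone_K d k y \<Longrightarrow> cone_M d k ((minus_R d k ^^ n) y)"
  shows "R_mat d k [^]\<^bsub>Sp4Z\<^esub> n \<notin> {mat 1, - mat 1}"
proof
  assume "R_mat d k [^]\<^bsub>Sp4Z\<^esub> n \<in> {mat 1, - mat 1}"
  then have sign: "(R_mat d k [^]\<^bsub>Sp4Z\<^esub> n) *v x = x \<or> (R_mat d k [^]\<^bsub>Sp4Z\<^esub> n) *v x = - x" for x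
    by (auto simp: minus_matrix_vector)
  obtain x where x: "x \<in> attract True" using attract_nonempty by blast
  then have "(R_mat d k [^]\<^bsub>Sp4Z\<^esub> n) *v x \<in> core"
    using assms[of x] assms[of "- x"]
    by (auto simp: attract_def core_def R_pow_act_nat minus_R_pow_minus)
  then have "x \<in> core" using sign[of x] by auto
  then show False using x attract_core_disjoint by blast
qed

subsection \<open>A free subgroup of finite index\<close>

abbreviation Rp :: "int \<Rightarrow> int ^ 4 ^ 4" where "Rp i \<equiv> R_mat d k [^]\<^bsub>Sp4Z\<^esub> i"

lemma Rp_add: "Rp (i + j) = Rp i \<otimes>\<^bsub>Sp4Z\<^esub> Rp j"
  by (simp add: Sp4Z.int_pow_mult)

lemma Rp_act_add: "Rp i *v (Rp j *v x) = Rp (i + j) *v x"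
  by (simp only: Rp_add act_mult)

lemma Rp_minus_sign: "Rp (- i) \<in> {mat 1, - mat 1} \<Longrightarrow> Rp i \<in> {mat 1, - mat 1}"
proof -
  assume i: "Rp (- i) \<in> {mat 1, - mat 1}"
  have "x = Rp (- i) *v (Rp i *v x)" for x
    by (simp add: Rp_act_add)
  then have "(\<forall>x. Rp i *v x = mat 1 *v x) \<or> (\<forall>x. Rp i *v x = (- mat 1) *v x)"
    using i by (auto simp: minus_matrix_vector) (metis minus_minus)
  then show ?thesis using int_matrix_eqI by blast
qed

lemma Rp_core: "Rp i \<notin> {mat 1, - mat 1} \<Longrightarrow> x \<in> attract s \<Longrightarrow> Rp i *v x \<in> core"
  using R_pow_attract[of i] by blast

definition conj_T :: "int \<Rightarrow> int ^ 4 ^ 4" where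
  "conj_T i = Rp i \<otimes>\<^bsub>Sp4Z\<^esub> T_mat \<otimes>\<^bsub>Sp4Z\<^esub> Rp (- i)"

lemma conj_T_Sp4Z [simp]: "conj_T i \<in> carrier Sp4Z"
  by (simp add: conj_T_def)

lemma conj_T_act:
  "(if b then conj_T i else inv\<^bsub>Sp4Z\<^esub> conj_T i) *v x
    = Rp i *v ((T_mat [^]\<^bsub>Sp4Z\<^esub> (if b then 1 else - 1 :: int)) *v (Rp (- i) *v x))"
proof -
  have "inv\<^bsub>Sp4Z\<^esub> conj_T i = Rp i \<otimes>\<^bsub>Sp4Z\<^esub> inv\<^bsub>Sp4Z\<^esub> T_mat \<otimes>\<^bsub>Sp4Z\<^esub> Rp (- i)"
    by (simp add: conj_T_def Sp4Z.inv_mult_group Sp4Z.int_pow_neg Sp4Z.m_assoc)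
  moreover have "T_mat [^]\<^bsub>Sp4Z\<^esub> (1 :: int) = T_mat" "T_mat [^]\<^bsub>Sp4Z\<^esub> (- 1 :: int) = inv\<^bsub>Sp4Z\<^esub> T_mat"
    using Sp4Z.int_pow_neg[of T_mat 1] by (simp_all add: Sp4Z.int_pow_1)
  ultimately show ?thesis by (simp add: conj_T_def act_mult)
qed

lemma conj_T_conj: "Rp j \<otimes>\<^bsub>Sp4Z\<^esub> conj_T i \<otimes>\<^bsub>Sp4Z\<^esub> Rp (- j) = conj_T (j + i)"
proof -
  have "Rp (- (j + i)) = Rp (- i) \<otimes>\<^bsub>Sp4Z\<^esub> Rp (- j)"
    using Rp_add[of "- i" "- j"] by (simp add: algebra_simps)
  then show ?thesis by (simp add: conj_T_def Rp_add[of j i] Sp4Z.m_assoc)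
qed

text \<open>The conjugates \<open>R\<^sup>i T R\<^sup>-\<^sup>i\<close> with \<open>i < m\<close> play ping-pong on the regions \<open>R\<^sup>i\<close> \<open>attract b\<close>: seen from
the \<open>i\<close>-th conjugate, every other region \<open>R\<^sup>j\<close> \<open>attract c\<close> is moved into \<open>core\<close> by \<open>R\<^bsup>j - i\<^esup>\<close>, and from
\<open>core\<close> both \<open>T\<close> and its inverse reach their attracting regions. Since \<open>R\<^sup>m\<close> is central, conjugation
by \<open>R\<close> permutes these generators, hence they generate a normal subgroup, and every element is a
product of an element of it and a power of \<open>R\<close>.\<close>
lemma free_subgroup_finite_order:
  fixes m :: nat
  assumes m: "2 \<le> m" and period: "Rp (int m) \<in> {mat 1, - mat 1}"
    and small: "\<And>i :: nat. 1 \<le> i \<Longrightarrow> i < m \<Longrightarrow> Rp (int i) \<notin> {mat 1, - mat 1}"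
  shows "\<exists>F. subgroup F (hyp_group d k) \<and> is_free_group ((hyp_group d k)\<lparr>carrier := F\<rparr>)
    \<and> finite_index (hyp_group d k) F"
proof -
  let ?I = "{..<m}"
  let ?\<tau> = "\<lambda>i :: nat. conj_T (int i)"
  let ?G = "generate Sp4Z {R_mat d k, T_mat}"
  define F where "F = generate Sp4Z (?\<tau> ` ?I)"
  have F: "subgroup F Sp4Z"
    unfolding F_def by (intro Sp4Z.generate_is_subgroup) auto
  interpret F: subgroup F Sp4Z by fact
  interpret G: subgroup ?G Sp4Z by (rule subgroup_hyp_group)
  have Rp_G: "Rp i \<in> ?G" for i
    by (intro Sp4Z.subgroup_int_pow_closed[OF subgroup_hyp_group]) (simp add: generate.incl)
  have conj_T_G: "conj_T i \<in> ?G" for i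
    unfolding conj_T_def by (intro G.m_closed Rp_G) (simp add: generate.incl)
  have FG: "F \<subseteq> ?G"
    unfolding F_def using conj_T_G by (intro Sp4Z.generate_subgroup_incl[OF _ subgroup_hyp_group]) auto
  have sub: "subgroup F (hyp_group d k)"
    unfolding hyp_group_def using Sp4Z.subgroup_incl[OF F subgroup_hyp_group FG] .
  have distinct: "Rp (int j - int i) \<notin> {mat 1, - mat 1}" if "i < m" "j < m" "i \<noteq> j" for i j
  proof (cases "i < j")
    case True
    then show ?thesis using small[of "j - i"] that by (simp add: of_nat_diff)
  next
    case False
    then have "Rp (int i - int j) \<notin> {mat 1, - mat 1}"
      using small[of "i - j"] that by (simp add: of_nat_diff)
    then show ?thesis using Rp_minus_sign[of "int i - int j"] by auto
  qed
  let ?X = "\<lambda>(i :: nat) b. {y. Rp (- int i) *v y \<in> attract b}"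
  have change: "Rp (- int i) *v y = Rp (int j - int i) *v (Rp (- int j) *v y)" for i j y
    by (simp add: Rp_act_add)
  have "is_free_group (Sp4Z\<lparr>carrier := F\<rparr>)"
  proof (rule group.free_group_ping_pong[where act = "(*v)" and \<tau> = ?\<tau> and I = ?I and X = ?X])
    show "group (Sp4Z\<lparr>carrier := F\<rparr>)" by (rule Sp4Z.subgroup_imp_group[OF F])
    have in_F: "conj_T (int i) \<in> F" if "i \<in> ?I" for i
      using that by (auto simp: F_def intro: generate.incl)
    then show "conj_T (int i) \<in> carrier (Sp4Z\<lparr>carrier := F\<rparr>)" if "i \<in> ?I" for i
      using that by simp
    show "carrier (Sp4Z\<lparr>carrier := F\<rparr>) = generate (Sp4Z\<lparr>carrier := F\<rparr>) (?\<tau> ` ?I)"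
      using Sp4Z.generate_consistent[of "?\<tau> ` ?I" F] F in_F by (auto simp: F_def)
    show "\<one>\<^bsub>Sp4Z\<lparr>carrier := F\<rparr>\<^esub> *v x = x" for x by (simp add: act_one)
    show "(g \<otimes>\<^bsub>Sp4Z\<lparr>carrier := F\<rparr>\<^esub> h) *v x = g *v (h *v x)" for g h x by (simp add: act_mult)
    show "0 \<in> ?I" "1 \<in> ?I" "(0 :: nat) \<noteq> 1" using m by auto
    show "?X i b \<noteq> {}" for i b
    proof -
      obtain x where "x \<in> attract b" using attract_nonempty by blast
      then have "Rp (int i) *v x \<in> ?X i b" by (simp add: Rp_act_add)
      then show ?thesis by blast
    qed
    show "?X i b \<inter> ?X j c = {}" if ij: "i \<in> ?I" "j \<in> ?I" "(i, b) \<noteq> (j, c)" for i j b c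
    proof (cases "i = j")
      case True
      then show ?thesis using ij(3) attract_disjoint by (cases b; cases c) auto
    next
      case False
      have "Rp (- int i) *v y \<in> core" if "y \<in> ?X j c" for y
        using that distinct[of i j] False ij unfolding change[of i y j]
        by (intro Rp_core[of _ _ c]) auto
      then show ?thesis using attract_core_disjoint[of b] by blast
    qed
    show "(*v) (if b then conj_T (int i) else inv\<^bsub>Sp4Z\<lparr>carrier := F\<rparr>\<^esub> conj_T (int i)) ` ?X j c \<subseteq> ?X i b"
      if ij: "i \<in> ?I" "j \<in> ?I" "(j, c) \<noteq> (i, \<not> b)" for i j b c
    proof
      fix z assume "z \<in> (*v) (if b then conj_T (int i) else inv\<^bsub>Sp4Z\<lparr>carrier := F\<rparr>\<^esub> conj_T (int i)) ` ?X j c"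
      then obtain y where y: "Rp (- int j) *v y \<in> attract c"
        and z: "z = (if b then conj_T (int i) else inv\<^bsub>Sp4Z\<^esub> conj_T (int i)) *v y"
        using Sp4Z.m_inv_consistent[OF F in_F[OF ij(1)]] by auto
      let ?n = "if b then 1 else - 1 :: int"
      have Rz: "Rp (- int i) *v z = (T_mat [^]\<^bsub>Sp4Z\<^esub> ?n) *v (Rp (- int i) *v y)"
        unfolding z conj_T_act Rp_act_add by simp
      have "(T_mat [^]\<^bsub>Sp4Z\<^esub> ?n) *v (Rp (- int i) *v y) \<in> attract b"
      proof (cases "i = j")
        case True
        then have "c = b" using ij(3) by auto
        then have "Rp (- int i) *v y \<in> attract (0 < ?n)" using y True by (cases b) simp_all
        then show ?thesis using T_pow_attract[of ?n "Rp (- int i) *v y"] by (cases b) simp_all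
      next
        case False
        then have "Rp (- int i) *v y \<in> core"
          using distinct[of i j] ij y unfolding change[of i y j] by (intro Rp_core[of _ _ c]) auto
        then show ?thesis using T_pow_core[of ?n "Rp (- int i) *v y"] by (cases b) simp_all
      qed
      then show "z \<in> ?X i b" by (simp add: Rz)
    qed
  qed
  moreover have "finite_index (hyp_group d k) F"
  proof -
    have central: "Rp (int m * q) ** x = x ** Rp (int m * q)" for q :: int and x
    proof -
      have "Rp (int m * q) = Rp (int m) [^]\<^bsub>Sp4Z\<^esub> q" by (simp add: Sp4Z.int_pow_pow)
      moreover have "\<dots> \<in> {mat 1, - mat 1}"
        using period minus_one_pow[of q] Sp4Z.int_pow_one[of q] by (auto simp: Sp4_simps)
      ultimately show ?thesis by (auto simp: minus_matrix_mult matrix_mult_minus)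
    qed
    have conj_T_F: "conj_T i \<in> F" for i
    proof -
      define q r where "q = i div int m" and "r = i mod int m"
      have r: "0 \<le> r" "r < int m" and i: "i = int m * q + r"
        using m by (simp_all add: q_def r_def)
      have "conj_T i = Rp (int m * q) \<otimes>\<^bsub>Sp4Z\<^esub> conj_T r \<otimes>\<^bsub>Sp4Z\<^esub> Rp (- (int m * q))"
        by (simp add: conj_T_conj i)
      also have "\<dots> = conj_T r \<otimes>\<^bsub>Sp4Z\<^esub> (Rp (int m * q) \<otimes>\<^bsub>Sp4Z\<^esub> Rp (- (int m * q)))"
        using central[of q "conj_T r"] by (simp add: Sp4_simps matrix_mul_assoc)
      also have "\<dots> = conj_T r" by (simp flip: Rp_add)
      also have "\<dots> \<in> F"
        using r unfolding F_def by (intro generate.incl image_eqI[of _ _ "nat r"]) auto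
      finally show ?thesis .
    qed
    have normal: "Rp j \<otimes>\<^bsub>Sp4Z\<^esub> f \<otimes>\<^bsub>Sp4Z\<^esub> Rp (- j) \<in> F" if "f \<in> F" for f j
      using that unfolding F_def
    proof (induction f rule: generate.induct)
      case one
      have "Rp j \<otimes>\<^bsub>Sp4Z\<^esub> \<one>\<^bsub>Sp4Z\<^esub> \<otimes>\<^bsub>Sp4Z\<^esub> Rp (- j) = \<one>\<^bsub>Sp4Z\<^esub>"
        by (simp flip: Rp_add)
      then show ?case using F.one_closed by (simp add: F_def)
    next
      case (incl h)
      then show ?case using conj_T_F by (auto simp: conj_T_conj F_def)
    next
      case (inv h)
      then obtain i where h: "h = conj_T i" by auto
      have "Rp j \<otimes>\<^bsub>Sp4Z\<^esub> inv\<^bsub>Sp4Z\<^esub> h \<otimes>\<^bsub>Sp4Z\<^esub> Rp (- j)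
          = inv\<^bsub>Sp4Z\<^esub> (Rp j \<otimes>\<^bsub>Sp4Z\<^esub> h \<otimes>\<^bsub>Sp4Z\<^esub> Rp (- j))"
        by (simp add: h Sp4Z.inv_mult_group Sp4Z.int_pow_neg Sp4Z.m_assoc)
      then show ?case using conj_T_F F.m_inv_closed by (simp add: h conj_T_conj F_def)
    next
      case (eng h1 h2)
      have h: "h1 \<in> carrier Sp4Z" "h2 \<in> carrier Sp4Z"
        using eng F.subset by (auto simp: F_def)
      have "Rp j \<otimes>\<^bsub>Sp4Z\<^esub> (h1 \<otimes>\<^bsub>Sp4Z\<^esub> h2) \<otimes>\<^bsub>Sp4Z\<^esub> Rp (- j)
          = Rp j \<otimes>\<^bsub>Sp4Z\<^esub> h1 \<otimes>\<^bsub>Sp4Z\<^esub> (Rp (- j) \<otimes>\<^bsub>Sp4Z\<^esub> Rp j) \<otimes>\<^bsub>Sp4Z\<^esub> h2 \<otimes>\<^bsub>Sp4Z\<^esub> Rp (- j)"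
        using h by (simp add: Sp4Z.m_assoc flip: Rp_add)
      also have "\<dots> = (Rp j \<otimes>\<^bsub>Sp4Z\<^esub> h1 \<otimes>\<^bsub>Sp4Z\<^esub> Rp (- j)) \<otimes>\<^bsub>Sp4Z\<^esub> (Rp j \<otimes>\<^bsub>Sp4Z\<^esub> h2 \<otimes>\<^bsub>Sp4Z\<^esub> Rp (- j))"
        using h by (simp add: Sp4Z.m_assoc)
      finally show ?case using eng F.m_closed by (simp add: F_def)
    qed
    have decompose: "\<exists>f\<in>F. \<exists>j. g = f \<otimes>\<^bsub>Sp4Z\<^esub> Rp j" if "g \<in> ?G" for g
      using that
    proof (induction g rule: generate.induct)
      case one
      then show ?case by (intro bexI[of _ "\<one>\<^bsub>Sp4Z\<^esub>"] exI[of _ 0]) auto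
    next
      case (incl h)
      then consider "h = R_mat d k" | "h = T_mat" by auto
      then show ?case
      proof cases
        case 1
        then show ?thesis
          by (intro bexI[of _ "\<one>\<^bsub>Sp4Z\<^esub>"] exI[of _ 1]) (auto simp: Sp4Z.int_pow_1)
      next
        case 2
        then show ?thesis
          using conj_T_F[of 0] by (intro bexI[of _ "conj_T 0"] exI[of _ 0]) (auto simp: conj_T_def)
      qed
    next
      case (inv h)
      then consider "h = R_mat d k" | "h = T_mat" by auto
      then show ?case
      proof cases
        case 1
        then show ?thesis
          using Sp4Z.int_pow_neg[of "R_mat d k" 1]
          by (intro bexI[of _ "\<one>\<^bsub>Sp4Z\<^esub>"] exI[of _ "- 1"]) (auto simp: Sp4Z.int_pow_1)
      next
        case 2
        then show ?thesis
          using F.m_inv_closed[OF conj_T_F[of 0]]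
          by (intro bexI[of _ "inv\<^bsub>Sp4Z\<^esub> conj_T 0"] exI[of _ 0]) (auto simp: conj_T_def)
      qed
    next
      case (eng h1 h2)
      then obtain f1 j1 f2 j2 where h: "f1 \<in> F" "f2 \<in> F"
        "h1 = f1 \<otimes>\<^bsub>Sp4Z\<^esub> Rp j1" "h2 = f2 \<otimes>\<^bsub>Sp4Z\<^esub> Rp j2" by blast
      have "h1 \<otimes>\<^bsub>Sp4Z\<^esub> h2 = f1 \<otimes>\<^bsub>Sp4Z\<^esub> Rp j1 \<otimes>\<^bsub>Sp4Z\<^esub> f2 \<otimes>\<^bsub>Sp4Z\<^esub> (Rp (- j1) \<otimes>\<^bsub>Sp4Z\<^esub> Rp (j1 + j2))"
        using h by (simp add: Sp4Z.m_assoc flip: Rp_add)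
      also have "\<dots> = (f1 \<otimes>\<^bsub>Sp4Z\<^esub> (Rp j1 \<otimes>\<^bsub>Sp4Z\<^esub> f2 \<otimes>\<^bsub>Sp4Z\<^esub> Rp (- j1))) \<otimes>\<^bsub>Sp4Z\<^esub> Rp (j1 + j2)"
        using h by (simp add: Sp4Z.m_assoc del: Sp4Z.int_pow_mult)
      finally show ?case
        using h normal[OF h(2), of j1] F.m_closed by blast
    qed
    \<comment> \<open>\<open>R\<^sup>m\<close> may be \<open>- 1\<close>, but \<open>R\<^bsup>2 m\<^esup> = 1\<close> in any case.\<close>
    have "rcosets\<^bsub>hyp_group d k\<^esub> F \<subseteq> (\<lambda>j. F #>\<^bsub>Sp4Z\<^esub> Rp j) ` {0..<2 * int m}"
    proof
      fix c assume "c \<in> rcosets\<^bsub>hyp_group d k\<^esub> F"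
      then obtain g where g: "g \<in> ?G" "c = F #>\<^bsub>Sp4Z\<^esub> g"
        by (auto simp: RCOSETS_def r_coset_def hyp_group_def)
      obtain f j where fj: "f \<in> F" "g = f \<otimes>\<^bsub>Sp4Z\<^esub> Rp j" using decompose[OF g(1)] by blast
      have "c = F #>\<^bsub>Sp4Z\<^esub> Rp j"
        unfolding g(2) by (intro Sp4Z.repr_independence[OF _ _ F, symmetric])
          (auto simp: r_coset_def fj)
      moreover have "Rp j = Rp (j mod (2 * int m))"
      proof -
        have "Rp (2 * int m) = \<one>\<^bsub>Sp4Z\<^esub>"
          using period Rp_add[of "int m" "int m"]
          by (auto simp: Sp4_simps minus_matrix_mult matrix_mult_minus)
        then have "Rp (2 * int m * q) = \<one>\<^bsub>Sp4Z\<^esub>" for q :: int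
          using Sp4Z.int_pow_pow[of "R_mat d k" "2 * int m" q] by simp
        moreover have "Rp j = Rp (2 * int m * (j div (2 * int m))) \<otimes>\<^bsub>Sp4Z\<^esub> Rp (j mod (2 * int m))"
          unfolding Rp_add[symmetric] by simp
        ultimately show ?thesis by simp
      qed
      ultimately show "c \<in> (\<lambda>j. F #>\<^bsub>Sp4Z\<^esub> Rp j) ` {0..<2 * int m}"
        using m by (intro image_eqI[of _ _ "j mod (2 * int m)"]) auto
    qed
    then show ?thesis
      unfolding finite_index_def by (rule finite_subset) simp
  qed
  ultimately show ?thesis using sub by (auto simp: hyp_group_simps)
qed

text \<open>Here \<open>T\<close> and \<open>R\<close> themselves are free generators. The regions of \<open>R\<close> are the unions of the images of
the attracting regions under its positive and under its negative powers. Both lie in \<open>core\<close>, and they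
are disjoint since otherwise a positive power of \<open>R\<close> would map a point of an attracting region into an attracting region.\<close>
lemma free_subgroup_infinite_order:
  assumes inf: "\<And>i :: int. i \<noteq> 0 \<Longrightarrow> Rp i \<notin> {mat 1, - mat 1}"
  shows "\<exists>F. subgroup F (hyp_group d k) \<and> is_free_group ((hyp_group d k)\<lparr>carrier := F\<rparr>)
    \<and> finite_index (hyp_group d k) F"
proof -
  let ?H = "hyp_group d k"
  let ?\<tau> = "\<lambda>t :: bool. if t then T_mat else R_mat d k"
  define X where "X t b = (if t then attract b else
    {y. \<exists>i x s. 0 < i \<and> x \<in> attract s \<and> y = Rp (if b then i else - i) *v x})" for t b
  have core: "y \<in> core" if y: "y \<in> X False b" for y b
  proof -
    obtain i x s where "0 < i" "x \<in> attract s" "y = Rp (if b then i else - i) *v x"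
      using y by (auto simp: X_def)
    then show ?thesis using inf by (auto intro!: Rp_core)
  qed
  have gens: "T_mat \<in> carrier ?H" "R_mat d k \<in> carrier ?H"
    by (auto simp: hyp_group_simps intro: generate.incl)
  have inv: "inv\<^bsub>?H\<^esub> g = inv\<^bsub>Sp4Z\<^esub> g" if "g \<in> carrier ?H" for g
    using that Sp4Z.m_inv_consistent[OF subgroup_hyp_group] by (simp add: hyp_group_def)
  have "is_free_group ?H"
  proof (rule group.free_group_ping_pong[OF group_hyp_group,
      where act = "(*v)" and \<tau> = ?\<tau> and I = UNIV and X = X])
    show "?\<tau> t \<in> carrier ?H" for t using gens by simp
    have "range ?\<tau> = {R_mat d k, T_mat}" by auto
    then show "carrier ?H = generate ?H (range ?\<tau>)"
      using Sp4Z.generate_consistent[OF _ subgroup_hyp_group, of "{R_mat d k, T_mat}" d k] gens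
      by (simp add: hyp_group_def)
    show "\<one>\<^bsub>?H\<^esub> *v x = x" for x by (simp add: hyp_group_simps)
    show "(g \<otimes>\<^bsub>?H\<^esub> h) *v x = g *v (h *v x)" for g h x
      by (simp add: hyp_group_simps matrix_vector_mul_assoc)
    show "True \<in> UNIV" "False \<in> UNIV" "True \<noteq> False" by auto
    show "X t b \<noteq> {}" for t b
    proof (cases t)
      case True
      then show ?thesis using attract_nonempty by (simp add: X_def)
    next
      case False
      obtain x where "x \<in> attract True" using attract_nonempty by blast
      then have "Rp (if b then 1 else - 1) *v x \<in> X t b"
        using False by (auto simp: X_def intro!: exI[of _ 1] exI[of _ x])
      then show ?thesis by blast
    qed
    show "X t b \<inter> X u c = {}" if "(t, b) \<noteq> (u, c)" for t u b c
    proof -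
      have R: "X False True \<inter> X False False = {}"
      proof (rule ccontr)
        assume "X False True \<inter> X False False \<noteq> {}"
        then obtain i j x y s s' where xy: "0 < i" "0 < j" "x \<in> attract s" "y \<in> attract s'"
          "Rp i *v x = Rp (- j) *v y" by (auto simp: X_def)
        have "Rp (j + i) *v x = Rp j *v (Rp (- j) *v y)"
          by (simp flip: xy(5) add: Rp_act_add)
        then have "Rp (j + i) *v x = y" by (simp add: Rp_act_add)
        moreover have "Rp (j + i) *v x \<in> core" using inf xy by (intro Rp_core[of _ _ s]) auto
        ultimately show False using xy(4) attract_core_disjoint by blast
      qed
      have TR: "X True b' \<inter> X False c' = {}" for b' c'
      proof -
        have "X True b' = attract b'" by (simp add: X_def)
        then show ?thesis using core attract_core_disjoint[of b'] by blast
      qed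
      have TT: "X True True \<inter> X True False = {}" using attract_disjoint by (simp add: X_def)
      show ?thesis using that R TR TT by (cases t; cases u; cases b; cases c) (auto simp: Int_commute)
    qed
    show "(*v) (if b then ?\<tau> t else inv\<^bsub>?H\<^esub> ?\<tau> t) ` X u c \<subseteq> X t b"
      if ne: "(u, c) \<noteq> (t, \<not> b)" for t u b c
    proof
      fix z assume "z \<in> (*v) (if b then ?\<tau> t else inv\<^bsub>?H\<^esub> ?\<tau> t) ` X u c"
      then obtain y where y: "y \<in> X u c" and z: "z = (if b then ?\<tau> t else inv\<^bsub>?H\<^esub> ?\<tau> t) *v y"
        by blast
      let ?n = "if b then 1 else - 1 :: int"
      have z: "z = (?\<tau> t [^]\<^bsub>Sp4Z\<^esub> ?n) *v y"
        using z inv[OF gens(1)] inv[OF gens(2)] Sp4Z.int_pow_neg[of "?\<tau> t" 1]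
        by (auto simp: Sp4Z.int_pow_1)
      show "z \<in> X t b"
      proof (cases t)
        case True
        then have z: "z = (T_mat [^]\<^bsub>Sp4Z\<^esub> ?n) *v y" using z by simp
        have "y \<in> core \<or> y \<in> attract b"
          using y ne True core[of y c] by (cases u; cases b; cases c) (auto simp: X_def)
        then have "z \<in> attract (0 < ?n)"
          using T_pow_core[of ?n y] T_pow_attract[of ?n y] unfolding z by (cases b) auto
        then show ?thesis using True by (cases b) (auto simp: X_def)
      next
        case False
        then have z: "z = Rp ?n *v y" using z by simp
        show ?thesis
        proof (cases u)
          case True
          then show ?thesis using y z False by (auto simp: X_def intro!: exI[of _ 1] exI[of _ y])
        next
          case u: False
          then have "c = b" using ne False by auto
          then obtain i x s where x: "0 < i" "x \<in> attract s" "y = Rp (if b then i else - i) *v x"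
            using y u by (auto simp: X_def)
          have "z = Rp (if b then i + 1 else - (i + 1)) *v x"
            unfolding z x(3) Rp_act_add by (simp add: add.commute)
          moreover have "0 < i + 1" using x(1) by simp
          ultimately have "\<exists>i x s. 0 < i \<and> x \<in> attract s \<and> z = Rp (if b then i else - i) *v x"
            using x(2) by blast
          then show ?thesis using False by (simp add: X_def)
        qed
      qed
    qed
  qed
  moreover have "subgroup (carrier ?H) ?H"
    by (rule group.subgroup_self[OF group_hyp_group])
  moreover have "rcosets\<^bsub>?H\<^esub> (carrier ?H) \<subseteq> {carrier ?H}"
    using group.coset_join2[OF group_hyp_group] group.subgroup_self[OF group_hyp_group]
    by (auto simp: RCOSETS_def)
  then have "finite_index ?H (carrier ?H)"
    unfolding finite_index_def using finite_subset by blast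
  ultimately show ?thesis by (intro exI[of _ "carrier ?H"]) simp
qed

subsection \<open>The order of \<open>R\<close> modulo the centre\<close>

lemma Rp_sign_iff:
  fixes m :: nat
  assumes m: "1 \<le> m" and period: "Rp (int m) \<in> {mat 1, - mat 1}"
    and small: "\<And>i :: nat. 1 \<le> i \<Longrightarrow> i < m \<Longrightarrow> Rp (int i) \<notin> {mat 1, - mat 1}"
  shows "Rp i \<in> {mat 1, - mat 1} \<longleftrightarrow> int m dvd i"
    and "Rp (int m * q) = (Rp (int m)) [^]\<^bsub>Sp4Z\<^esub> q"
proof -
  show pow: "Rp (int m * q) = (Rp (int m)) [^]\<^bsub>Sp4Z\<^esub> q" for q :: int
    by (simp add: Sp4Z.int_pow_pow)
  define q r where "q = i div int m" and "r = nat (i mod int m)"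
  have r: "r < m" and i: "i = int m * q + int r"
    using m by (simp_all add: q_def r_def nat_less_iff)
  have "Rp (int m * q) \<in> {mat 1, - mat 1}"
    using period minus_one_pow[of q] Sp4Z.int_pow_one[of q] by (auto simp: pow Sp4_simps)
  then have "Rp i \<in> {mat 1, - mat 1} \<longleftrightarrow> Rp (int r) \<in> {mat 1, - mat 1}"
    unfolding i Rp_add by (auto simp: Sp4_simps minus_matrix_mult minus_equation_iff)
  also have "\<dots> \<longleftrightarrow> r = 0"
    using small[of r] r by (cases "r = 0") (auto simp: Sp4_simps)
  also have "\<dots> \<longleftrightarrow> int m dvd i"
    using m by (simp add: r_def dvd_eq_mod_eq_0 nat_eq_iff)
  finally show "Rp i \<in> {mat 1, - mat 1} \<longleftrightarrow> int m dvd i" .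
qed

lemma generate_R: "generate Sp4Z {R_mat d k} = range Rp"
  using Sp4Z.generate_pow[OF R_mat_Sp4Z] by auto

lemma generate_T: "generate Sp4Z {T_mat} = range (\<lambda>n :: int. T_mat [^]\<^bsub>Sp4Z\<^esub> n)"
  using Sp4Z.generate_pow[OF T_mat_Sp4Z] by auto

lemma generate_of_subgroups:
  assumes "subgroup A Sp4Z" "A \<subseteq> generate Sp4Z {R_mat d k, T_mat}" "T_mat \<in> A"
  shows "generate Sp4Z (A \<union> generate Sp4Z {R_mat d k}) = generate Sp4Z {R_mat d k, T_mat}"
proof
  have "generate Sp4Z {R_mat d k} \<subseteq> generate Sp4Z {R_mat d k, T_mat}"
    by (intro Sp4Z.mono_generate) simp
  then show "generate Sp4Z (A \<union> generate Sp4Z {R_mat d k}) \<subseteq> generate Sp4Z {R_mat d k, T_mat}"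
    using assms by (intro Sp4Z.generate_subgroup_incl[OF _ subgroup_hyp_group]) auto
  show "generate Sp4Z {R_mat d k, T_mat} \<subseteq> generate Sp4Z (A \<union> generate Sp4Z {R_mat d k})"
    using assms(3) generate.incl[of "R_mat d k" "{R_mat d k}" Sp4Z] by (intro Sp4Z.mono_generate) auto
qed

subsection \<open>Splittings as free products\<close>

text \<open>No power of \<open>R\<close> is \<open>- 1\<close>; hence \<open>\<langle>R\<rangle>\<close> and \<open>\<langle>T\<rangle>\<close> meet trivially.\<close>
lemma splitting_free:
  assumes "- mat 1 \<notin> range Rp"
  shows "splitting (generate Sp4Z {T_mat}) (generate Sp4Z {R_mat d k})"
proof -
  have "subgroup (generate Sp4Z {T_mat}) Sp4Z" "subgroup (generate Sp4Z {R_mat d k}) Sp4Z"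
    by (auto intro: Sp4Z.generate_is_subgroup)
  moreover have "generate Sp4Z {T_mat} \<subseteq> generate Sp4Z {R_mat d k, T_mat}"
    by (intro Sp4Z.mono_generate) simp
  moreover have "T_mat \<in> generate Sp4Z {T_mat}" by (simp add: generate.incl)
  moreover have "- mat 1 \<notin> generate Sp4Z {T_mat}"
  proof
    assume "- mat 1 \<in> generate Sp4Z {T_mat}"
    then obtain n where n: "- mat 1 = T_mat [^]\<^bsub>Sp4Z\<^esub> (n :: int)" by (auto simp: generate_T)
    then have "n = 0" by (intro T_pow_eq_sign) (simp flip: n)
    with n have "(- mat 1 :: int ^ 4 ^ 4) = mat 1" by (simp add: Sp4_simps)
    then show False by (auto simp: vec_eq_iff mat_def forall_4)
  qed
  ultimately show ?thesis
    using assms generate_of_subgroups unfolding splitting_def by (auto simp: generate_R generate_T)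
qed

lemma is_free_product_hyp_group:
  assumes "- mat 1 \<notin> range Rp"
  shows "is_free_product (hyp_group d k) (generate Sp4Z {T_mat}) (generate Sp4Z {R_mat d k})"
proof -
  note AB = splitting_free[OF assms]
  have "generate Sp4Z {T_mat} \<inter> generate Sp4Z {R_mat d k} = {mat 1}"
  proof
    show "generate Sp4Z {T_mat} \<inter> generate Sp4Z {R_mat d k} \<subseteq> {mat 1}"
    proof
      fix g assume "g \<in> generate Sp4Z {T_mat} \<inter> generate Sp4Z {R_mat d k}"
      then have "g \<in> {mat 1, - mat 1}" and "g \<in> range Rp"
        using splitting_inter[OF AB, of g] by (simp_all add: generate_R)
      then show "g \<in> {mat 1}" using assms by (cases "g = - mat 1") simp_all
    qed
    show "{mat 1} \<subseteq> generate Sp4Z {T_mat} \<inter> generate Sp4Z {R_mat d k}"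
      using generate.one[of Sp4Z] by (auto simp: Sp4_simps)
  qed
  then show ?thesis
    using splitting_is_amalgam[OF AB] by (simp add: is_free_product_def hyp_group_simps)
qed

lemma generate_T_iso: "Sp4Z\<lparr>carrier := generate Sp4Z {T_mat}\<rparr> \<cong> integer_group"
  using mon_image_is_iso[OF _ Sp4Z.int_pow_mon(1)[OF T_mat_Sp4Z T_pow_eq_one]]
    Sp4Z.int_pow_mon(2)[OF T_mat_Sp4Z T_pow_eq_one]
  by (simp add: integer_mod_group_def)

lemma generate_R_iso:
  assumes "\<And>i. Rp i = \<one>\<^bsub>Sp4Z\<^esub> \<longleftrightarrow> int N dvd i"
  shows "Sp4Z\<lparr>carrier := generate Sp4Z {R_mat d k}\<rparr> \<cong> integer_mod_group N"
  using mon_image_is_iso[OF _ Sp4Z.int_pow_mon(1)[OF R_mat_Sp4Z assms]]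
    Sp4Z.int_pow_mon(2)[OF R_mat_Sp4Z assms]
  by simp

text \<open>A free product is the amalgam over the trivial group, and \<open>N = 0\<close> gives an infinite cyclic factor.\<close>
lemma hyp_group_iso_free_product:
  assumes ord: "\<And>i. Rp i = \<one>\<^bsub>Sp4Z\<^esub> \<longleftrightarrow> int N dvd i" and sign: "- mat 1 \<notin> range Rp"
  shows "hyp_group d k \<cong> free_product integer_group (integer_mod_group N)"
proof -
  note AB = splitting_free[OF sign]
  let ?\<alpha> = "\<lambda>n :: int. T_mat [^]\<^bsub>Sp4Z\<^esub> n"
  have \<alpha>: "?\<alpha> \<in> mon integer_group Sp4Z" "?\<alpha> ` carrier integer_group = generate Sp4Z {T_mat}"
    using Sp4Z.int_pow_mon[OF T_mat_Sp4Z T_pow_eq_one] by (simp_all add: integer_mod_group_def)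
  note \<beta> = Sp4Z.int_pow_mon[OF R_mat_Sp4Z ord]
  have "pres_lift (hyp_group d k) (case_sum ?\<alpha> Rp)
      \<in> iso (free_product integer_group (integer_mod_group N)) (hyp_group d k)"
    unfolding free_product_def
  proof (rule splitting_iso[OF AB _ _ \<alpha>(1) \<beta>(1) \<alpha>(2) \<beta>(2)])
    fix a b :: int
    assume b: "b \<in> carrier (integer_mod_group N)" and ab: "?\<alpha> a = Rp b"
    have "a = 0" using T_pow_eq_R_pow[of b a] ab by simp
    then have "Rp b = Rp 0" using ab by simp
    then have "b = 0" using b \<beta>(1) by (auto simp: mon_def inj_on_def)
    then show "\<exists>h\<in>carrier (singleton_group ()). a = \<one>\<^bsub>integer_group\<^esub> \<and> b = \<one>\<^bsub>integer_mod_group N\<^esub>"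
      using \<open>a = 0\<close> by (simp add: singleton_group_def)
  qed auto
  then have "free_product integer_group (integer_mod_group N) \<cong> hyp_group d k"
    by (auto simp: is_iso_def)
  moreover have "group (free_product integer_group (integer_mod_group N))"
    unfolding free_product_def by (intro group_amalgam) simp_all
  ultimately show ?thesis by (rule group.iso_sym[rotated])
qed

subsection \<open>Splittings amalgamated over the centre\<close>

text \<open>On \<open>\<int> \<times> \<int>/2\<close> this is an isomorphism onto \<open>\<langle>- 1, T\<rangle>\<close>.\<close>
definition signed_T :: "int \<times> int \<Rightarrow> int ^ 4 ^ 4" where
  "signed_T = (\<lambda>(n, h). T_mat [^]\<^bsub>Sp4Z\<^esub> n \<otimes>\<^bsub>Sp4Z\<^esub> (- mat 1) [^]\<^bsub>Sp4Z\<^esub> h)"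

lemma signed_T_simps:
  "signed_T (n, h) = (if even h then T_mat [^]\<^bsub>Sp4Z\<^esub> n else - (T_mat [^]\<^bsub>Sp4Z\<^esub> n))"
  by (simp add: signed_T_def minus_one_pow Sp4_simps matrix_mult_minus)

lemma mat_neq_minus: "(mat 1 :: int ^ 4 ^ 4) \<noteq> - mat 1"
  by (auto simp: vec_eq_iff mat_def forall_4)

lemma signed_T_mon: "signed_T \<in> mon (integer_group \<times>\<times> integer_mod_group 2) Sp4Z"
proof -
  have "signed_T \<in> hom (integer_group \<times>\<times> integer_mod_group 2) Sp4Z"
  proof (rule homI)
    fix x y :: "int \<times> int"
    show "signed_T x \<in> carrier Sp4Z"
      by (cases x) (simp add: signed_T_def)
    have even: "even ((h + h') mod 2) \<longleftrightarrow> even (h + h')" for h h' :: int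
      by (metis dvd_mod_iff dvd_refl)
    obtain n h n' h' where xy: "x = (n, h)" "y = (n', h')" by (cases x, cases y)
    have "signed_T (n, h) ** signed_T (n', h') = (if even (h + h')
        then T_mat [^]\<^bsub>Sp4Z\<^esub> n ** T_mat [^]\<^bsub>Sp4Z\<^esub> n' else - (T_mat [^]\<^bsub>Sp4Z\<^esub> n ** T_mat [^]\<^bsub>Sp4Z\<^esub> n'))"
      by (auto simp: signed_T_simps minus_matrix_mult matrix_mult_minus)
    moreover have "T_mat [^]\<^bsub>Sp4Z\<^esub> n ** T_mat [^]\<^bsub>Sp4Z\<^esub> n' = T_mat [^]\<^bsub>Sp4Z\<^esub> (n + n')"
      using Sp4Z.int_pow_mult[OF T_mat_Sp4Z, of n n'] by (simp add: Sp4_simps)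
    ultimately show "signed_T (x \<otimes>\<^bsub>integer_group \<times>\<times> integer_mod_group 2\<^esub> y) = signed_T x \<otimes>\<^bsub>Sp4Z\<^esub> signed_T y"
      unfolding xy by (simp add: Sp4_simps(1) signed_T_simps even)
  qed
  moreover have "x = y"
    if x: "x \<in> carrier (integer_group \<times>\<times> integer_mod_group 2)"
      and y: "y \<in> carrier (integer_group \<times>\<times> integer_mod_group 2)" and eq: "signed_T x = signed_T y" for x y
  proof -
    obtain n h n' h' where xy: "x = (n, h)" "y = (n', h')" by (cases x, cases y)
    have h: "h \<in> {0..<2}" "h' \<in> {0..<2}"
      using x y by (auto simp: xy carrier_integer_mod_group)
    have "T_mat [^]\<^bsub>Sp4Z\<^esub> n = T_mat [^]\<^bsub>Sp4Z\<^esub> n' \<or> T_mat [^]\<^bsub>Sp4Z\<^esub> n = - (T_mat [^]\<^bsub>Sp4Z\<^esub> n')"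
      using eq by (auto simp: xy signed_T_simps minus_equation_iff split: if_splits)
    then have "T_mat [^]\<^bsub>Sp4Z\<^esub> (n + - n') \<in> {mat 1, - mat 1}"
      using Sp4Z.int_pow_mult[OF T_mat_Sp4Z, of n "- n'"] Sp4Z.int_pow_mult[OF T_mat_Sp4Z, of n' "- n'"]
      by (auto simp: Sp4_simps minus_matrix_mult)
    then have n: "n = n'" using T_pow_eq_sign[of "n + - n'"] by simp
    have "T_mat [^]\<^bsub>Sp4Z\<^esub> n \<noteq> - (T_mat [^]\<^bsub>Sp4Z\<^esub> n)"
    proof
      assume "T_mat [^]\<^bsub>Sp4Z\<^esub> n = - (T_mat [^]\<^bsub>Sp4Z\<^esub> n)"
      then have "T_mat [^]\<^bsub>Sp4Z\<^esub> n ** T_mat [^]\<^bsub>Sp4Z\<^esub> (- n) = - (T_mat [^]\<^bsub>Sp4Z\<^esub> n ** T_mat [^]\<^bsub>Sp4Z\<^esub> (- n))"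
        by (metis minus_matrix_mult)
      then show False
        using Sp4Z.int_pow_mult[OF T_mat_Sp4Z, of n "- n"] mat_neq_minus by (simp add: Sp4_simps)
    qed
    then have "even h \<longleftrightarrow> even h'"
      using eq by (auto simp: xy n signed_T_simps split: if_splits)
    moreover have "h = 0 \<or> h = 1" "h' = 0 \<or> h' = 1" using h by auto
    ultimately show ?thesis using n by (auto simp: xy)
  qed
  ultimately show ?thesis by (auto simp: mon_def inj_on_def)
qed

lemma signed_T_image: "signed_T ` carrier (integer_group \<times>\<times> integer_mod_group 2) = generate Sp4Z {- mat 1, T_mat}"
proof
  have "T_mat [^]\<^bsub>Sp4Z\<^esub> n \<in> generate Sp4Z {- mat 1, T_mat}"
    "(- mat 1) [^]\<^bsub>Sp4Z\<^esub> h \<in> generate Sp4Z {- mat 1, T_mat}" for n h :: int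
    by (auto intro!: Sp4Z.subgroup_int_pow_closed Sp4Z.generate_is_subgroup intro: generate.incl)
  then show "signed_T ` carrier (integer_group \<times>\<times> integer_mod_group 2) \<subseteq> generate Sp4Z {- mat 1, T_mat}"
    by (auto simp: signed_T_def intro: generate.eng)
  interpret h: group_hom "integer_group \<times>\<times> integer_mod_group 2" Sp4Z signed_T
    using signed_T_mon by (intro group_hom.intro group_hom_axioms.intro DirProd_group)
      (auto simp: mon_def intro: Sp4Z.is_group)
  show "generate Sp4Z {- mat 1, T_mat} \<subseteq> signed_T ` carrier (integer_group \<times>\<times> integer_mod_group 2)"
  proof (rule Sp4Z.generate_subgroup_incl[OF _ h.img_is_subgroup])
    have "- mat 1 = signed_T (0, 1)" "T_mat = signed_T (1, 0)"
      by (simp_all add: signed_T_simps Sp4_simps(2) Sp4Z.int_pow_1)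
    moreover have "(0, 1) \<in> carrier (integer_group \<times>\<times> integer_mod_group 2)"
      "(1, 0) \<in> carrier (integer_group \<times>\<times> integer_mod_group 2)"
      by (simp_all add: carrier_integer_mod_group)
    ultimately show "{- mat 1, T_mat} \<subseteq> signed_T ` carrier (integer_group \<times>\<times> integer_mod_group 2)"
      by blast
  qed
qed

context
  fixes m :: nat
  assumes m: "1 \<le> m" and period: "Rp (int m) = - mat 1"
    and small: "\<And>i :: nat. 1 \<le> i \<Longrightarrow> i < m \<Longrightarrow> Rp (int i) \<notin> {mat 1, - mat 1}"
begin

lemma Rp_order: "Rp i = \<one>\<^bsub>Sp4Z\<^esub> \<longleftrightarrow> int (2 * m) dvd i"
proof -
  have sign: "Rp i \<in> {mat 1, - mat 1} \<longleftrightarrow> int m dvd i"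
    using Rp_sign_iff(1)[OF m _ small] period by simp
  have pow: "Rp (int m * q) = (if even q then mat 1 else - mat 1)" for q
    using Rp_sign_iff(2)[OF m _ small, of q] period by (simp add: minus_one_pow)
  show ?thesis
  proof (cases "int m dvd i")
    case True
    then obtain q where q: "i = int m * q" by (elim dvdE)
    have "int (2 * m) dvd i \<longleftrightarrow> even q"
      using m by (simp add: q mult.commute[of 2])
    then show ?thesis using mat_neq_minus by (simp add: q pow Sp4_simps)
  next
    case False
    then have "\<not> int (2 * m) dvd i"
      by (metis dvd_mult_left of_nat_mult mult.commute)
    then show ?thesis using False sign by (simp add: Sp4_simps)
  qed
qed

lemma splitting_signed: "splitting (generate Sp4Z {- mat 1, T_mat}) (generate Sp4Z {R_mat d k})"
proof -
  have sub: "subgroup (generate Sp4Z {- mat 1, T_mat}) Sp4Z" "subgroup (generate Sp4Z {R_mat d k}) Sp4Z"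
    by (auto intro: Sp4Z.generate_is_subgroup)
  have R: "- mat 1 \<in> generate Sp4Z {R_mat d k}"
    unfolding generate_R using period by (metis rangeI)
  moreover have "generate Sp4Z {R_mat d k} \<subseteq> generate Sp4Z {R_mat d k, T_mat}"
    by (intro Sp4Z.mono_generate) simp
  ultimately have "generate Sp4Z {- mat 1, T_mat} \<subseteq> generate Sp4Z {R_mat d k, T_mat}"
    by (intro Sp4Z.generate_subgroup_incl[OF _ subgroup_hyp_group]) (auto intro: generate.incl)
  moreover have T: "T_mat \<in> generate Sp4Z {- mat 1, T_mat}" "- mat 1 \<in> generate Sp4Z {- mat 1, T_mat}"
    by (simp_all add: generate.incl)
  moreover have "\<exists>n :: int. a = T_mat [^]\<^bsub>Sp4Z\<^esub> n \<or> a = - (T_mat [^]\<^bsub>Sp4Z\<^esub> n)"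
    if "a \<in> generate Sp4Z {- mat 1, T_mat}" for a
    using that unfolding signed_T_image[symmetric] by (auto simp: signed_T_simps)
  ultimately show ?thesis
    using sub R generate_of_subgroups unfolding splitting_def by (auto simp: generate_R)
qed

lemma is_amalgam_hyp_group:
  "is_amalgam (hyp_group d k) (generate Sp4Z {- mat 1, T_mat}) (generate Sp4Z {R_mat d k})
    (generate Sp4Z {- mat 1})"
proof -
  note AB = splitting_signed
  have gen: "generate Sp4Z {- mat 1} = {mat 1, - mat 1}"
  proof -
    have "generate Sp4Z {- mat 1} = range (\<lambda>i :: int. (- mat 1) [^]\<^bsub>Sp4Z\<^esub> i)"
      using Sp4Z.generate_pow[OF minus_one_Sp4Z] by auto
    also have "\<dots> = {mat 1, - mat 1}"
    proof
      show "range (\<lambda>i :: int. (- mat 1) [^]\<^bsub>Sp4Z\<^esub> i) \<subseteq> {mat 1, - mat 1}"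
        by (auto simp: minus_one_pow)
      have "mat 1 = (- mat 1) [^]\<^bsub>Sp4Z\<^esub> (0 :: int)" "- mat 1 = (- mat 1) [^]\<^bsub>Sp4Z\<^esub> (1 :: int)"
        by (simp_all add: minus_one_pow del: Sp4Z.int_pow_1 int_pow_0)
      then show "{mat 1, - mat 1} \<subseteq> range (\<lambda>i :: int. (- mat 1) [^]\<^bsub>Sp4Z\<^esub> i)"
        by blast
    qed
    finally show ?thesis .
  qed
  have "generate Sp4Z {- mat 1, T_mat} \<inter> generate Sp4Z {R_mat d k} = generate Sp4Z {- mat 1}"
  proof
    show "generate Sp4Z {- mat 1, T_mat} \<inter> generate Sp4Z {R_mat d k} \<subseteq> generate Sp4Z {- mat 1}"
      using splitting_inter[OF AB] by (auto simp: gen)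
    show "generate Sp4Z {- mat 1} \<subseteq> generate Sp4Z {- mat 1, T_mat} \<inter> generate Sp4Z {R_mat d k}"
    proof (rule Sp4Z.generate_subgroup_incl)
      show "subgroup (generate Sp4Z {- mat 1, T_mat} \<inter> generate Sp4Z {R_mat d k}) Sp4Z"
        using AB by (intro Sp4Z.subgroups_Inter_pair) (auto simp: splitting_def)
      show "{- mat 1} \<subseteq> generate Sp4Z {- mat 1, T_mat} \<inter> generate Sp4Z {R_mat d k}"
        using AB by (auto simp: splitting_def generate.incl)
    qed
  qed
  then show ?thesis using splitting_is_amalgam[OF AB] by simp
qed

text \<open>The amalgamated \<open>\<int>/2\<close> is \<open>{1, - 1}\<close>: its generator is \<open>(0, 1)\<close> in \<open>\<int> \<times> \<int>/2\<close>, and it is \<open>m\<close> in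
\<open>\<int>/2m\<close> because \<open>R\<^sup>m = - 1\<close>.\<close>
lemma hyp_group_iso_amalgam:
  "hyp_group d k \<cong> amalgam (integer_group \<times>\<times> integer_mod_group 2) (integer_mod_group (2 * m))
    (integer_mod_group 2) (\<lambda>h. (0, h)) (\<lambda>h. int m * h)"
proof -
  let ?A = "integer_group \<times>\<times> integer_mod_group 2" and ?B = "integer_mod_group (2 * m)"
  note \<beta> = Sp4Z.int_pow_mon[OF R_mat_Sp4Z Rp_order]
  have A: "group ?A" by (intro DirProd_group) simp_all
  have two: "h \<in> carrier (integer_mod_group 2) \<longleftrightarrow> h = 0 \<or> h = 1" for h
    by (auto simp: carrier_integer_mod_group)
  have Rp_m: "Rp (int m * h) = (if even h then mat 1 else - mat 1)" for h
    using Rp_sign_iff(2)[OF m _ small, of h] period by (simp add: minus_one_pow)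
  have m_mem: "int m * h \<in> carrier ?B" if "h = 0 \<or> h = 1" for h
    using that m by (auto simp: carrier_integer_mod_group)
  have "pres_lift (hyp_group d k) (case_sum signed_T Rp)
      \<in> iso (amalgam ?A ?B (integer_mod_group 2) (\<lambda>h. (0, h)) (\<lambda>h. int m * h)) (hyp_group d k)"
  proof (rule splitting_iso[OF splitting_signed A _ signed_T_mon \<beta>(1) signed_T_image \<beta>(2)])
    show "(\<lambda>h. (0, h)) ` carrier (integer_mod_group 2) \<subseteq> carrier ?A" by auto
    show "(\<lambda>h. int m * h) ` carrier (integer_mod_group 2) \<subseteq> carrier ?B"
      using m_mem by (auto simp: two)
    show "signed_T (0, h) = Rp (int m * h)" for h
      by (simp add: signed_T_simps Rp_m Sp4_simps)
    fix a b assume a: "a \<in> carrier ?A" and b: "b \<in> carrier ?B" and ab: "signed_T a = Rp b"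
    obtain n h where nh: "a = (n, h)" "h = 0 \<or> h = 1" using a by (cases a) (auto simp: two)
    have n: "n = 0"
      using T_pow_eq_R_pow[of b n] ab by (auto simp: nh(1) signed_T_simps split: if_splits)
    then have "Rp b = Rp (int m * h)"
      unfolding ab[symmetric] by (simp add: nh(1) signed_T_simps Rp_m Sp4_simps(2))
    then have "b = int m * h"
      using \<beta>(1) b m_mem[OF nh(2)] by (auto simp: mon_def inj_on_def)
    then show "\<exists>h\<in>carrier (integer_mod_group 2). a = (0, h) \<and> b = int m * h"
      using n nh by (auto simp: two)
  qed simp
  then have "amalgam ?A ?B (integer_mod_group 2) (\<lambda>h. (0, h)) (\<lambda>h. int m * h) \<cong> hyp_group d k"
    by (auto simp: is_iso_def)
  moreover have "group (amalgam ?A ?B (integer_mod_group 2) (\<lambda>h. (0, h)) (\<lambda>h. int m * h))"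
    by (intro group_amalgam A) simp
  ultimately show ?thesis by (rule group.iso_sym[rotated])
qed

end

lemma generate_minus_one_iso: "Sp4Z\<lparr>carrier := generate Sp4Z {- mat 1}\<rparr> \<cong> integer_mod_group 2"
proof -
  have ord: "(- mat 1) [^]\<^bsub>Sp4Z\<^esub> i = \<one>\<^bsub>Sp4Z\<^esub> \<longleftrightarrow> int 2 dvd i" for i :: int
    using mat_neq_minus by (auto simp: minus_one_pow Sp4_simps)
  show ?thesis
    using mon_image_is_iso[OF _ Sp4Z.int_pow_mon(1)[OF minus_one_Sp4Z ord]]
      Sp4Z.int_pow_mon(2)[OF minus_one_Sp4Z ord] by simp
qed

lemma generate_signed_T_iso:
  "Sp4Z\<lparr>carrier := generate Sp4Z {- mat 1, T_mat}\<rparr> \<cong> integer_group \<times>\<times> integer_mod_group 2"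
  using mon_image_is_iso[OF DirProd_group[OF group_integer_group group_integer_mod_group] signed_T_mon]
  unfolding signed_T_image .

end

section \<open>Zariski density\<close>

definition zclosure :: "(real ^ 'n ^ 'n) set \<Rightarrow> (real ^ 'n ^ 'n) set" where
  "zclosure S = {A. \<forall>p. real_polynomial_function p \<longrightarrow> (\<forall>s\<in>S. p s = 0) \<longrightarrow> p A = 0}"

lemma zclosure_subset: "S \<subseteq> zclosure S"
  by (auto simp: zclosure_def)

lemma zclosureD: "A \<in> zclosure S \<Longrightarrow> real_polynomial_function p \<Longrightarrow> (\<And>s. s \<in> S \<Longrightarrow> p s = 0) \<Longrightarrow> p A = 0"
  by (auto simp: zclosure_def)

lemma zariski_dense_in_zclosure:
  assumes "S \<subseteq> X" "X \<subseteq> zclosure S"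
  shows "zariski_dense_in S X"
  using assms unfolding zariski_dense_in_def zariski_closed_def zclosure_def by blast

lemma real_polynomial_function_linear_subst:
  assumes "real_polynomial_function p" "bounded_linear f"
  shows "real_polynomial_function (\<lambda>x. p (f x))"
  using assms(1)
proof induction
  case (linear g)
  then show ?case
    using bounded_linear_compose[OF linear assms(2)] by (intro real_polynomial_function.intros(1))
qed auto

lemma bounded_linear_matrix_left: "bounded_linear (\<lambda>A :: real ^ 'n ^ 'n. B ** A)"
  by (intro linear_conv_bounded_linear[THEN iffD1] linearI)
    (simp_all add: vec_eq_iff matrix_matrix_mult_def sum.distrib sum_distrib_left algebra_simps)

lemma bounded_linear_matrix_right: "bounded_linear (\<lambda>A :: real ^ 'n ^ 'n. A ** B)"
  by (intro linear_conv_bounded_linear[THEN iffD1] linearI)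
    (simp_all add: vec_eq_iff matrix_matrix_mult_def sum.distrib sum_distrib_left algebra_simps)

text \<open>The classical two-step argument: left multiplication by \<open>s \<in> S\<close> preserves the closure, so for fixed
\<open>h\<close> in the closure the polynomial conditions on \<open>g h\<close> hold for \<open>g \<in> S\<close> and therefore on the closure.\<close>
lemma zclosure_mult:
  assumes S: "\<And>g h. g \<in> S \<Longrightarrow> h \<in> S \<Longrightarrow> g ** h \<in> S"
    and g: "g \<in> zclosure S" and h: "h \<in> zclosure S"
  shows "g ** h \<in> zclosure S"
proof -
  have left: "s ** h \<in> zclosure S" if "s \<in> S" for s
    unfolding zclosure_def
  proof (clarify)
    fix p :: "real ^ 'a ^ 'a \<Rightarrow> real" assume p: "real_polynomial_function p" "\<forall>s\<in>S. p s = 0"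
    have "real_polynomial_function (\<lambda>A. p (s ** A))"
      by (rule real_polynomial_function_linear_subst[OF p(1) bounded_linear_matrix_left])
    then show "p (s ** h) = 0" using zclosureD[OF h] p(2) S that by blast
  qed
  show ?thesis
    unfolding zclosure_def
  proof (clarify)
    fix p :: "real ^ 'a ^ 'a \<Rightarrow> real" assume p: "real_polynomial_function p" "\<forall>s\<in>S. p s = 0"
    have "real_polynomial_function (\<lambda>A. p (A ** h))"
      by (rule real_polynomial_function_linear_subst[OF p(1) bounded_linear_matrix_right])
    moreover have "p (s ** h) = 0" if "s \<in> S" for s using zclosureD[OF left[OF that] p(1)] p(2) by blast
    ultimately show "p (g ** h) = 0" using zclosureD[OF g] by blast
  qed
qed

lemma real_polynomial_function_eq_0:
  fixes f :: "real \<Rightarrow> real"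
  assumes "real_polynomial_function f" "infinite {t. f t = 0}"
  shows "f t = 0"
proof -
  obtain a n where f: "f = (\<lambda>x. \<Sum>i\<le>n. a i * x ^ i)"
    using assms(1) by (auto simp: real_polynomial_function_iff_sum)
  have "\<forall>i\<le>n. a i = 0"
    using assms(2) polyfun_finite_roots[of a n] unfolding f by auto
  then show ?thesis by (simp add: f)
qed

text \<open>Curves of degree two are all that is needed: a one-parameter group of transvections is affine in its
parameter, and \<open>transvection (a + t q) s\<close> is quadratic in \<open>t\<close>.\<close>
lemma zclosure_curve:
  fixes A B C :: "real ^ 'n ^ 'n"
  assumes "infinite {t :: real. A + t *\<^sub>R B + t\<^sup>2 *\<^sub>R C \<in> zclosure S}"
  shows "A + t *\<^sub>R B + t\<^sup>2 *\<^sub>R C \<in> zclosure S"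
  unfolding zclosure_def
proof (clarify)
  fix p :: "real ^ 'n ^ 'n \<Rightarrow> real" assume p: "real_polynomial_function p" "\<forall>s\<in>S. p s = 0"
  let ?f = "\<lambda>t :: real. p (A + t *\<^sub>R B + t\<^sup>2 *\<^sub>R C)"
  have "real_polynomial_function ?f"
    using p(1)
  proof induction
    case (linear g)
    then have "g (A + t *\<^sub>R B + t\<^sup>2 *\<^sub>R C) = g A + t * g B + t\<^sup>2 * g C" for t
      by (simp add: linear_simps)
    moreover have "real_polynomial_function (\<lambda>t. g A + t * g B + t\<^sup>2 * g C)"
      by (intro real_polynomial_function.intros(2-4) real_polynomial_function_power
          real_polynomial_function.intros(1) bounded_linear_ident)
    ultimately show ?case by simp
  qed auto
  moreover have "{t :: real. A + t *\<^sub>R B + t\<^sup>2 *\<^sub>R C \<in> zclosure S} \<subseteq> {t. ?f t = 0}"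
    using p by (auto intro: zclosureD)
  then have "infinite {t. ?f t = 0}"
    using assms finite_subset by blast
  ultimately show "?f t = 0" by (rule real_polynomial_function_eq_0)
qed

subsection \<open>Transvections\<close>

text \<open>The alternating form with matrix \<open>J4\<close>.\<close>
definition omega :: "real ^ 4 \<Rightarrow> real ^ 4 \<Rightarrow> real" where
  "omega x y = x$1 * y$3 + x$2 * y$4 - x$3 * y$1 - x$4 * y$2"

definition transvection :: "real ^ 4 \<Rightarrow> real \<Rightarrow> real ^ 4 ^ 4" where
  "transvection v s = mat 1 + s *\<^sub>R (\<chi> i j. v$i * omega v (axis j 1))"

lemma omega_linear:
  "omega (x + y) z = omega x z + omega y z" "omega z (x + y) = omega z x + omega z y"
  "omega (c *\<^sub>R x) z = c * omega x z" "omega z (c *\<^sub>R x) = c * omega z x"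
  "omega (x - y) z = omega x z - omega y z" "omega z (x - y) = omega z x - omega z y"
  by (simp_all add: omega_def algebra_simps)

lemma omega_self [simp]: "omega x x = 0"
  by (simp add: omega_def)

lemma omega_swap: "omega x y = - omega y x"
  by (simp add: omega_def)

lemma transvection_act: "transvection v s *v x = x + (s * omega v x) *\<^sub>R v"
  by (simp add: transvection_def vec_eq_iff forall_4 matrix_vector_mult_def sum_4 omega_def axis_def mat_def
      algebra_simps)

definition preserves_omega :: "real ^ 4 ^ 4 \<Rightarrow> bool" where
  "preserves_omega g \<longleftrightarrow> (\<forall>x y. omega (g *v x) (g *v y) = omega x y)"

lemma Sp4R_preserves_omega:
  assumes "g \<in> carrier Sp4R"
  shows "preserves_omega g"
proof -
  have inner: "omega x y = x \<bullet> (J4 *v y)" for x y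
    by (simp add: omega_def inner_vec_def sum_4 J4_def matrix_vector_mult_def algebra_simps)
  have adjoint: "(g *v x) \<bullet> z = x \<bullet> (transpose g *v z)" for x z
    by (metis dot_lmul_matrix inner_commute transpose_matrix_vector)
  then have "omega (g *v x) (g *v y) = x \<bullet> ((transpose g ** J4 ** g) *v y)" for x y
    by (simp only: inner adjoint matrix_vector_mul_assoc matrix_mul_assoc)
  then show ?thesis
    using assms by (simp add: preserves_omega_def inner Sp4_simps(3))
qed

lemma transvection_preserves_omega: "preserves_omega (transvection v s)"
  by (simp add: preserves_omega_def transvection_act omega_linear omega_swap[of _ v])

lemma preserves_omega_mult: "preserves_omega g \<Longrightarrow> preserves_omega h \<Longrightarrow> preserves_omega (g ** h)"
  by (simp add: preserves_omega_def flip: matrix_vector_mul_assoc)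

lemma transvection_add: "transvection v s ** transvection v t = transvection v (s + t)"
  by (simp add: matrix_eq transvection_act omega_linear algebra_simps flip: matrix_vector_mul_assoc)

lemma transvection_0 [simp]: "transvection v 0 = mat 1" "transvection 0 s = mat 1"
  by (simp_all add: matrix_eq transvection_act)

text \<open>A symplectic map conjugates the transvection along \<open>v\<close> to the one along its image. This produces new
transvections in the Zariski closure.\<close>
lemma transvection_conj:
  assumes "preserves_omega g"
  shows "g ** transvection v s = transvection (g *v v) s ** g"
  using assms by (simp add: matrix_eq transvection_act preserves_omega_def matrix_vector_right_distrib
      matrix_vector_mult_scaleR flip: matrix_vector_mul_assoc)

text \<open>Vectors that are not orthogonal for the form are moved into each other by one transvection.\<close>
lemma transvection_to:
  assumes "omega x y \<noteq> 0"
  shows "transvection (y - x) (- inverse (omega x y)) *v x = y"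
  using assms omega_swap[of y x] by (simp add: transvection_act omega_linear)

lemma axis_nth_real: "axis i (1 :: real) $ j = (if j = i then 1 else 0)"
  by (simp add: axis_def)

text \<open>Transvections generate the symplectic group, and they do so as a monoid because the inverse of a
transvection is a transvection.\<close>
locale transvection_monoid =
  fixes Z :: "(real ^ 4 ^ 4) set"
  assumes mult: "g \<in> Z \<Longrightarrow> h \<in> Z \<Longrightarrow> g ** h \<in> Z"
    and transvection: "transvection v s \<in> Z"
begin

lemma cancel:
  assumes "transvection v s ** g \<in> Z"
  shows "g \<in> Z"
proof -
  have "transvection v (- s) ** (transvection v s ** g) \<in> Z"
    by (intro mult transvection assms)
  then show ?thesis by (simp add: matrix_mul_assoc transvection_add)
qed

abbreviation e :: "4 \<Rightarrow> real ^ 4" where "e i \<equiv> axis i 1"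

lemma omega_axis:
  "omega (e 1) x = x$3" "omega (e 2) x = x$4" "omega (e 3) x = - x$1" "omega (e 4) x = - x$2"
  "omega x (e 1) = - x$3" "omega x (e 2) = - x$4" "omega x (e 3) = x$1" "omega x (e 4) = x$2"
  by (simp_all add: omega_def axis_nth_real)

lemma vec4_eqI: "x$1 = y$1 \<Longrightarrow> x$2 = y$2 \<Longrightarrow> x$3 = y$3 \<Longrightarrow> x$4 = y$4 \<Longrightarrow> (x :: real ^ 4) = y"
  by (simp add: vec_eq_iff forall_4)

text \<open>Multiplying \<open>g\<close> by the transvection that takes \<open>x\<close> to \<open>y\<close> reduces the claim for \<open>g\<close> to maps \<open>h\<close> with
\<open>h u = y\<close>. The vectors \<open>w\<close> fixed so far stay fixed if they pair equally with \<open>x\<close> and \<open>y\<close>.\<close>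
lemma move:
  assumes g: "preserves_omega g" and x: "g *v u = x" and xy: "omega x y \<noteq> 0"
    and fix_: "\<And>w. w \<in> F \<Longrightarrow> g *v w = w \<and> omega x w = omega y w"
    and rec: "\<And>h. preserves_omega h \<Longrightarrow> h *v u = y \<Longrightarrow> (\<And>w. w \<in> F \<Longrightarrow> h *v w = w) \<Longrightarrow> h \<in> Z"
  shows "g \<in> Z"
proof (rule cancel, rule rec)
  let ?t = "transvection (y - x) (- inverse (omega x y))"
  show "preserves_omega (?t ** g)" by (intro preserves_omega_mult transvection_preserves_omega g)
  show "(?t ** g) *v u = y" by (simp add: x transvection_to[OF xy] flip: matrix_vector_mul_assoc)
  show "(?t ** g) *v w = w" if "w \<in> F" for w
    using fix_[OF that] by (simp add: transvection_act omega_linear flip: matrix_vector_mul_assoc)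
qed

text \<open>The form determines three coordinates of \<open>g e\<^sub>4\<close>, which leaves a transvection along \<open>e\<^sub>2\<close>. The following
lemmas reduce to this case by straightening the images of \<open>e\<^sub>2\<close>, \<open>e\<^sub>3\<close> and \<open>e\<^sub>1\<close>. Each of them moves an
image back to its basis vector, via an intermediate vector when the two are orthogonal.\<close>
lemma fixes_e123:
  assumes g: "preserves_omega g" and fix_: "g *v e 1 = e 1" "g *v e 3 = e 3" "g *v e 2 = e 2"
  shows "g \<in> Z"
proof -
  define y where "y = g *v e 4"
  have omega: "omega (g *v a) (g *v b) = omega a b" for a b
    using g by (simp add: preserves_omega_def)
  have y: "y$1 = 0" "y$3 = 0" "y$4 = 1"
    using omega[of "e 3" "e 4"] omega[of "e 1" "e 4"] omega[of "e 2" "e 4"]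
    by (simp_all add: fix_ omega_axis axis_nth_real flip: y_def)
  have "g = transvection (e 2) (y$2)"
  proof -
    have "g *v x = transvection (e 2) (y$2) *v x" for x
    proof -
      let ?x = "x$1 *\<^sub>R e 1 + x$2 *\<^sub>R e 2 + x$3 *\<^sub>R e 3 + x$4 *\<^sub>R e 4"
      have "x = ?x"
        by (intro vec4_eqI) (simp_all add: axis_nth_real)
      then have "g *v x = g *v ?x" by (rule arg_cong)
      also have "\<dots> = x$1 *\<^sub>R e 1 + x$2 *\<^sub>R e 2 + x$3 *\<^sub>R e 3 + x$4 *\<^sub>R y"
        by (simp only: matrix_vector_right_distrib matrix_vector_mult_scaleR fix_ y_def)
      also have "\<dots> = transvection (e 2) (y$2) *v x"
        by (intro vec4_eqI) (simp_all add: transvection_act omega_axis y, simp_all add: axis_nth_real)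
      finally show ?thesis .
    qed
    then show ?thesis by (simp add: matrix_eq)
  qed
  then show ?thesis using transvection by simp
qed

lemma fixes_e13:
  assumes g: "preserves_omega g" and fix_: "g *v e 1 = e 1" "g *v e 3 = e 3"
  shows "g \<in> Z"
proof -
  have step: "g \<in> Z" if g: "preserves_omega g" "g *v e 1 = e 1" "g *v e 3 = e 3" "(g *v e 2)$4 \<noteq> 0" for g
  proof (rule move[where F = "{e 1, e 3}" and u = "e 2" and y = "e 2"])
    have omega: "omega (g *v a) (g *v b) = omega a b" for a b
      using g by (simp add: preserves_omega_def)
    show "omega (g *v e 2) (e 2) \<noteq> 0" using g(4) by (simp add: omega_axis)
    show "g *v w = w \<and> omega (g *v e 2) w = omega (e 2) w" if "w \<in> {e 1, e 3}" for w
      using that g(2,3) omega[of "e 2" w] by auto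
    show "h \<in> Z" if "preserves_omega h" "h *v e 2 = e 2" "\<And>w. w \<in> {e 1, e 3} \<Longrightarrow> h *v w = w" for h
      using that by (intro fixes_e123) auto
  qed (use g in auto)
  have omega: "omega (g *v a) (g *v b) = omega a b" for a b
    using g by (simp add: preserves_omega_def)
  show ?thesis
  proof (cases "(g *v e 2)$4 = 0")
    case False
    then show ?thesis using step assms by blast
  next
    case True
    show ?thesis
    proof (rule move[where F = "{e 1, e 3}" and u = "e 2" and y = "e 4"])
      have "(g *v e 2)$1 = 0" "(g *v e 2)$3 = 0"
        using omega[of "e 1" "e 2"] omega[of "e 3" "e 2"] by (simp_all add: fix_ omega_axis axis_nth_real)
      moreover have "g *v e 2 \<noteq> 0"
        using omega[of "e 2" "e 4"] by (auto simp: omega_def axis_nth_real)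
      ultimately have "(g *v e 2)$2 \<noteq> 0" using True vec4_eqI[of "g *v e 2" 0] by auto
      then show "omega (g *v e 2) (e 4) \<noteq> 0" by (simp add: omega_axis)
      show "g *v w = w \<and> omega (g *v e 2) w = omega (e 4) w" if "w \<in> {e 1, e 3}" for w
        using that fix_ omega[of "e 2" w] by (auto simp: omega_axis axis_nth_real)
      show "h \<in> Z" if "preserves_omega h" "h *v e 2 = e 4" "\<And>w. w \<in> {e 1, e 3} \<Longrightarrow> h *v w = w" for h
        using that by (intro step) (auto simp: axis_nth_real)
    qed (use g in auto)
  qed
qed

lemma fixes_e1:
  assumes g: "preserves_omega g" and fix_: "g *v e 1 = e 1"
  shows "g \<in> Z"
proof -
  have step: "g \<in> Z" if g: "preserves_omega g" "g *v e 1 = e 1" "(g *v e 3)$1 \<noteq> 0" for g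
  proof (rule move[where F = "{e 1}" and u = "e 3" and y = "e 3"])
    have omega: "omega (g *v a) (g *v b) = omega a b" for a b
      using g by (simp add: preserves_omega_def)
    show "omega (g *v e 3) (e 3) \<noteq> 0" using g(3) by (simp add: omega_axis)
    show "g *v w = w \<and> omega (g *v e 3) w = omega (e 3) w" if "w \<in> {e 1}" for w
      using that g(2) omega[of "e 3" w] by auto
    show "h \<in> Z" if "preserves_omega h" "h *v e 3 = e 3" "\<And>w. w \<in> {e 1} \<Longrightarrow> h *v w = w" for h
      using that by (intro fixes_e13) auto
  qed (use g in auto)
  have omega: "omega (g *v a) (g *v b) = omega a b" for a b
    using g by (simp add: preserves_omega_def)
  show ?thesis
  proof (cases "(g *v e 3)$1 = 0")
    case False
    then show ?thesis using step assms by blast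
  next
    case True
    show ?thesis
    proof (rule move[where F = "{e 1}" and u = "e 3" and y = "g *v e 3 + e 1"])
      have e13: "(g *v e 3)$3 = 1"
        using omega[of "e 1" "e 3"] by (simp add: fix_ omega_axis axis_nth_real)
      then show "omega (g *v e 3) (g *v e 3 + e 1) \<noteq> 0" by (simp add: omega_linear omega_axis)
      show "g *v w = w \<and> omega (g *v e 3) w = omega (g *v e 3 + e 1) w" if "w \<in> {e 1}" for w
        using that fix_ by (auto simp: omega_linear)
      show "h \<in> Z" if "preserves_omega h" "h *v e 3 = g *v e 3 + e 1" "\<And>w. w \<in> {e 1} \<Longrightarrow> h *v w = w" for h
        using that True by (intro step) (auto simp: axis_nth_real)
    qed (use g in auto)
  qed
qed

lemma preserves_omega_in_Z:
  assumes g: "preserves_omega g"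
  shows "g \<in> Z"
proof -
  have step: "g \<in> Z" if g: "preserves_omega g" "(g *v e 1)$3 \<noteq> 0" for g
  proof (rule move[where F = "{}" and u = "e 1" and y = "e 1"])
    show "omega (g *v e 1) (e 1) \<noteq> 0" using g(2) by (simp add: omega_axis)
    show "h \<in> Z" if "preserves_omega h" "h *v e 1 = e 1" for h
      using that by (rule fixes_e1)
  qed (use g in auto)
  define x where "x = g *v e 1"
  have "omega (g *v e 1) (g *v e 3) = omega (e 1) (e 3)"
    using g by (simp add: preserves_omega_def)
  then have "x \<noteq> 0" by (auto simp: x_def omega_def axis_nth_real)
  show ?thesis
  proof (cases "x$3 = 0")
    case False
    then show ?thesis using step assms by (simp add: x_def)
  next
    case True
    obtain y where y: "omega x y \<noteq> 0" "y$3 \<noteq> 0"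
    proof -
      consider "x$1 \<noteq> 0" | "x$1 = 0" "x$2 \<noteq> 0" | "x$1 = 0" "x$4 \<noteq> 0"
        using \<open>x \<noteq> 0\<close> True vec4_eqI[of x 0] by auto
      then show thesis
      proof cases
        case 1
        then show ?thesis using that[of "e 3"] by (simp add: omega_axis axis_nth_real)
      next
        case 2
        then show ?thesis using that[of "e 3 + e 4"] by (simp add: omega_linear omega_axis axis_nth_real)
      next
        case 3
        then show ?thesis using that[of "e 3 + e 2"] by (simp add: omega_linear omega_axis axis_nth_real)
      qed
    qed
    show ?thesis
    proof (rule move[where F = "{}" and u = "e 1" and y = y])
      show "omega (g *v e 1) y \<noteq> 0" using y(1) by (simp add: x_def)
      show "h \<in> Z" if "preserves_omega h" "h *v e 1 = y" for h
        using that y(2) by (intro step) auto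
    qed (use g in auto)
  qed
qed

end

subsection \<open>The closure of a hypergeometric group\<close>

lemma U_mat_in_hyp_group: "U_mat d k \<in> generate Sp4Z {R_mat d k, T_mat}"
proof -
  have "R_mat d k = T_mat \<otimes>\<^bsub>Sp4Z\<^esub> U_mat d k" by (simp add: R_mat_def Sp4_simps(1))
  then have "U_mat d k = inv\<^bsub>Sp4Z\<^esub> T_mat \<otimes>\<^bsub>Sp4Z\<^esub> R_mat d k"
    by (simp flip: Sp4Z.m_assoc)
  then show ?thesis by (auto intro!: generate.eng intro: generate.intros)
qed

lemma generate_R_T_U: "generate Sp4Z {R_mat d k, T_mat} = generate Sp4Z {R_mat d k, T_mat, U_mat d k}"
proof
  show "generate Sp4Z {R_mat d k, T_mat} \<subseteq> generate Sp4Z {R_mat d k, T_mat, U_mat d k}"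
    by (rule Sp4Z.mono_generate) auto
  show "generate Sp4Z {R_mat d k, T_mat, U_mat d k} \<subseteq> generate Sp4Z {R_mat d k, T_mat}"
    by (intro Sp4Z.generate_subgroup_incl[OF _ subgroup_hyp_group])
      (auto intro: generate.incl simp: U_mat_in_hyp_group)
qed

abbreviation to_real :: "int ^ 'n ^ 'n \<Rightarrow> real ^ 'n ^ 'n" where
  "to_real \<equiv> map_matrix of_int"

lemma to_real_mult: "to_real (A ** B) = to_real A ** to_real B"
  by (simp add: vec_eq_iff matrix_matrix_mult_def)

lemma to_real_one: "to_real (mat 1) = mat 1"
  by (simp add: vec_eq_iff mat_def)

lemma to_real_Sp4R:
  assumes "g \<in> carrier Sp4Z"
  shows "to_real g \<in> carrier Sp4R"
proof -
  have "to_real (transpose g ** J4 ** g) = to_real J4" using assms by (simp add: Sp4_simps)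
  moreover have "to_real (transpose g) = transpose (to_real g)" by (simp add: vec_eq_iff transpose_def)
  moreover have "to_real J4 = J4" by (simp add: vec_eq_iff forall_4 J4_def)
  ultimately show ?thesis by (simp add: Sp4_simps to_real_mult)
qed

text \<open>Let \<open>W\<close> be the set of directions all of whose transvections lie in the closure. If \<open>p\<close> is not
orthogonal to \<open>c\<close>, conjugating by transvections along \<open>c\<close> moves \<open>p\<close> to all points of \<open>p + \<real> c\<close>. If it
is orthogonal to \<open>c\<close>, then \<open>p + t c\<close> is a limit of directions \<open>p + s q + t c\<close> with \<open>s \<noteq> 0\<close>, and the closure
contains the transvections along such a line as soon as it contains infinitely many of them.\<close>
lemma transvection_in_zclosure_span:
  fixes S :: "(real ^ 4 ^ 4) set" and B :: "(real ^ 4) set"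
  defines "W \<equiv> {v. \<forall>s. transvection v s \<in> zclosure S}"
  assumes S: "\<And>g h. g \<in> S \<Longrightarrow> h \<in> S \<Longrightarrow> g ** h \<in> S"
    and B: "span B \<subseteq> W" and q: "q \<in> span B" and c: "c \<in> W" and qc: "omega q c \<noteq> 0"
  shows "span (insert c B) \<subseteq> W"
proof -
  have generic: "p + t *\<^sub>R c \<in> W" if p: "p \<in> span B" "omega p c \<noteq> 0" for p t
  proof -
    define r where "r = t / omega c p"
    have cp: "omega c p \<noteq> 0" using p(2) omega_swap[of c p] by simp
    have pt: "transvection c r *v p = p + t *\<^sub>R c"
      using cp by (simp add: transvection_act r_def)
    have "transvection (p + t *\<^sub>R c) s \<in> zclosure S" for s
    proof -
      have "transvection (p + t *\<^sub>R c) s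
          = transvection c r ** transvection p s ** transvection c (- r)"
        using transvection_conj[OF transvection_preserves_omega, of c r p s]
        by (simp add: pt transvection_add flip: matrix_mul_assoc)
      moreover have "transvection p s \<in> zclosure S" "transvection c r \<in> zclosure S"
        "transvection c (- r) \<in> zclosure S"
        using B c p by (auto simp: W_def)
      ultimately show ?thesis by (simp add: zclosure_mult[OF S])
    qed
    then show ?thesis by (simp add: W_def)
  qed
  have all: "p + t *\<^sub>R c \<in> W" if p: "p \<in> span B" for p t
  proof (cases "omega p c = 0")
    case True
    have line: "p + t *\<^sub>R c + s *\<^sub>R q \<in> W" if "s \<noteq> 0" for s
    proof -
      have "(p + s *\<^sub>R q) + t *\<^sub>R c \<in> W"
        using that p q qc True by (intro generic span_add span_scale) (simp_all add: omega_linear)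
      then show ?thesis by (simp add: add_ac)
    qed
    let ?a = "p + t *\<^sub>R c"
    let ?o = "\<lambda>u v :: real ^ 4. (\<chi> i j. u$i * omega v (axis j 1)) :: real ^ 4 ^ 4"
    have "transvection ?a r \<in> zclosure S" for r
    proof -
      let ?A = "mat 1 + r *\<^sub>R ?o ?a ?a" and ?B = "r *\<^sub>R (?o ?a q + ?o q ?a)" and ?C = "r *\<^sub>R ?o q q"
      have curve: "?A + s *\<^sub>R ?B + s\<^sup>2 *\<^sub>R ?C = transvection (?a + s *\<^sub>R q) r" for s
        by (simp add: transvection_def vec_eq_iff omega_linear power2_eq_square algebra_simps)
      have "- {0} \<subseteq> {s. ?A + s *\<^sub>R ?B + s\<^sup>2 *\<^sub>R ?C \<in> zclosure S}"
        using line unfolding curve by (auto simp: W_def)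
      moreover have "infinite (- {0 :: real})"
        by (simp add: infinite_UNIV_char_0 Compl_eq_Diff_UNIV)
      ultimately have "infinite {s. ?A + s *\<^sub>R ?B + s\<^sup>2 *\<^sub>R ?C \<in> zclosure S}"
        using infinite_super by blast
      then have "?A + 0 *\<^sub>R ?B + 0\<^sup>2 *\<^sub>R ?C \<in> zclosure S" by (rule zclosure_curve)
      then show ?thesis unfolding curve by simp
    qed
    then show ?thesis by (simp add: W_def)
  next
    case False
    then show ?thesis using generic p by blast
  qed
  show ?thesis
  proof
    fix x assume "x \<in> span (insert c B)"
    then obtain t where "x - t *\<^sub>R c \<in> span B" by (auto simp: span_breakdown_eq)
    then show "x \<in> W" using all[of "x - t *\<^sub>R c" t] by simp
  qed
qed

text \<open>\<open>T\<close> is the transvection along \<open>e\<^sub>2\<close>, and its powers are infinitely many points on the line of these.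
The vector \<open>e\<^sub>2\<close> is cyclic for the unipotent \<open>U\<close>, so \<open>e\<^sub>2\<close> and its first three images under \<open>U\<close>
span \<open>\<real>\<^sup>4\<close>. None of these images is orthogonal to \<open>e\<^sub>2\<close> when \<open>d\<close> and \<open>k\<close> are positive.\<close>
lemma zariski_dense_hyp_group:
  assumes d: "0 < d" and k: "0 < k"
  shows "zariski_dense_in (to_real ` carrier (hyp_group d k)) (carrier Sp4R)"
proof (rule zariski_dense_in_zclosure)
  let ?G = "generate Sp4Z {R_mat d k, T_mat}"
  define S where "S = to_real ` carrier (hyp_group d k)"
  interpret G: subgroup ?G Sp4Z by (rule subgroup_hyp_group)
  have S_eq: "S = to_real ` ?G" by (simp add: S_def hyp_group_simps)
  show "to_real ` carrier (hyp_group d k) \<subseteq> carrier Sp4R"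
    using G.subset to_real_Sp4R by (auto simp: hyp_group_simps)
  have S_mult: "g ** h \<in> S" if "g \<in> S" "h \<in> S" for g h
    using that G.m_closed unfolding S_eq by (auto simp: Sp4_simps(1) simp flip: to_real_mult)
  define W where "W = {v. \<forall>s. transvection v s \<in> zclosure S}"
  have conj: "to_real g *v v \<in> W" if g: "g \<in> ?G" and v: "v \<in> W" for g v
  proof -
    let ?h = "to_real (inv\<^bsub>Sp4Z\<^esub> g)"
    have gC: "g \<in> carrier Sp4Z" using g G.subset by blast
    then have "g ** inv\<^bsub>Sp4Z\<^esub> g = mat 1" using Sp4Z.r_inv by (simp add: Sp4_simps(1,2))
    then have one: "to_real g ** ?h = mat 1" by (simp add: to_real_one flip: to_real_mult)
    have "transvection (to_real g *v v) s \<in> zclosure S" for s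
    proof -
      have "transvection (to_real g *v v) s = to_real g ** transvection v s ** ?h"
        using transvection_conj[OF Sp4R_preserves_omega[OF to_real_Sp4R[OF gC]], of v s] one
        by (simp flip: matrix_mul_assoc)
      moreover have "to_real g \<in> zclosure S" "?h \<in> zclosure S"
        using g G.m_inv_closed zclosure_subset[of S] by (auto simp: S_eq)
      ultimately show ?thesis using v by (simp add: W_def zclosure_mult[OF S_mult])
    qed
    then show ?thesis by (simp add: W_def)
  qed
  let ?e2 = "axis 2 1 :: real ^ 4"
  have e2: "?e2 \<in> W"
  proof -
    let ?N = "\<chi> i j. ?e2$i * omega ?e2 (axis j 1)"
    have "transvection ?e2 (real n) \<in> S" for n :: nat
    proof -
      have "T_mat [^]\<^bsub>Sp4Z\<^esub> n \<in> ?G"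
        using Sp4Z.subgroup_int_pow_closed[OF subgroup_hyp_group, of T_mat d k "int n"]
        by (simp add: generate.incl int_pow_int)
      moreover have "to_real (T_mat [^]\<^bsub>Sp4Z\<^esub> n) = transvection ?e2 (real n)"
      proof (induction n)
        case 0
        then show ?case by (simp add: Sp4_simps(2) to_real_one)
      next
        case (Suc n)
        have "to_real T_mat = transvection ?e2 1"
          by (simp add: vec_eq_iff forall_4 T_mat_def transvection_def omega_def axis_def mat_def)
        then show ?case
          using Suc by (simp add: Sp4_simps(1) to_real_mult transvection_add add.commute)
      qed
      ultimately show ?thesis unfolding S_eq by (metis imageI)
    qed
    then have "range real \<subseteq> {t. mat 1 + t *\<^sub>R ?N + t\<^sup>2 *\<^sub>R 0 \<in> zclosure S}"
      using zclosure_subset[of S] by (auto simp: transvection_def)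
    moreover have "infinite (range real)" by (rule range_inj_infinite[OF inj_of_nat])
    ultimately have "infinite {t. mat 1 + t *\<^sub>R ?N + t\<^sup>2 *\<^sub>R 0 \<in> zclosure S}"
      using infinite_super by blast
    then have "mat 1 + t *\<^sub>R ?N + t\<^sup>2 *\<^sub>R 0 \<in> zclosure S" for t by (rule zclosure_curve)
    then show ?thesis by (simp add: W_def transvection_def)
  qed
  have U: "to_real (U_mat d k) *v v \<in> W" if "v \<in> W" for v
    by (rule conj[OF U_mat_in_hyp_group that])
  define c1 c2 c3 :: "real ^ 4" where "c1 = vector [1, 1, d, - k]"
    and "c2 = vector [2, 1, 3 * d, - 2 * k - d]" and "c3 = vector [3, 1, 6 * d, - 3 * k - 4 * d]"
  note c_defs = c1_def c2_def c3_def
  have "c1 = to_real (U_mat d k) *v ?e2" "c2 = to_real (U_mat d k) *v c1"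
    "c3 = to_real (U_mat d k) *v c2"
    by (simp_all add: c_defs vec_eq_iff forall_4 matrix_vector_mult_def sum_4 U_mat_def axis_def)
  then have c: "c1 \<in> W" "c2 \<in> W" "c3 \<in> W" using U e2 by simp_all
  have dk: "0 < real_of_int d" "0 < real_of_int k" using d k by simp_all
  have om: "omega ?e2 c1 \<noteq> 0" "omega ?e2 c2 \<noteq> 0" "omega ?e2 c3 \<noteq> 0"
    using dk by (simp_all add: omega_def axis_def c_defs)
  have "span {?e2} \<subseteq> W"
  proof
    fix x assume "x \<in> span {?e2}"
    then obtain t where x: "x = t *\<^sub>R ?e2" by (auto simp: span_singleton)
    have "transvection x s = transvection ?e2 (t\<^sup>2 * s)" for s
      by (simp add: x matrix_eq transvection_act omega_linear power2_eq_square)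
    then show "x \<in> W" using e2 by (simp add: W_def)
  qed
  note extend = transvection_in_zclosure_span[where S = S and q = ?e2, folded W_def]
  have e2_span: "?e2 \<in> span (insert a (insert b {?e2}))" "?e2 \<in> span (insert a {?e2})" "?e2 \<in> span {?e2}" for a b
    by (auto intro: span_base)
  have span1: "span {c1, ?e2} \<subseteq> W"
    by (rule extend) (fact S_mult \<open>span {?e2} \<subseteq> W\<close> e2_span c om)+
  have span2: "span {c2, c1, ?e2} \<subseteq> W"
    by (rule extend) (fact S_mult span1 e2_span c om)+
  have "span {c3, c2, c1, ?e2} \<subseteq> W"
    by (rule extend) (fact S_mult span2 e2_span c om)+
  moreover have "x \<in> span {c3, c2, c1, ?e2}" for x
  proof -
    \<comment> \<open>The coefficients solve a triangular system: \<open>x$3 / d - x$1 = b2 + 3 * b3\<close> and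
      \<open>- (x$4 + k * x$1) / d = b2 + 4 * b3\<close>.\<close>
    define b3 where "b3 = - (x$4 + k * x$1) / d - (x$3 / d - x$1)"
    define b2 where "b2 = (x$3 / d - x$1) - 3 * b3"
    define b1 where "b1 = x$1 - 2 * b2 - 3 * b3"
    define b0 where "b0 = x$2 - b1 - b2 - b3"
    have "x = b3 *\<^sub>R c3 + (b2 *\<^sub>R c2 + (b1 *\<^sub>R c1 + b0 *\<^sub>R ?e2))"
      using dk by (simp add: vec_eq_iff forall_4 c_defs axis_def b0_def b1_def b2_def b3_def field_simps)
    also have "\<dots> \<in> span {c3, c2, c1, ?e2}"
      by (intro span_add span_scale) (auto intro: span_base)
    finally show ?thesis .
  qed
  ultimately have W: "W = UNIV" by auto
  interpret transvection_monoid "zclosure S"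
    using W by unfold_locales (auto simp: W_def intro: zclosure_mult[OF S_mult])
  show "carrier Sp4R \<subseteq> zclosure (to_real ` carrier (hyp_group d k))"
    using preserves_omega_in_Z Sp4R_preserves_omega by (auto simp flip: S_def)
qed

section \<open>The real rank\<close>

definition exp_diag :: "real ^ 4 \<Rightarrow> real ^ 4 ^ 4" where
  "exp_diag v = (\<chi> i j. if i = j then exp (v $ i) else 0)"

lemma exp_diag_sandwich: "(transpose (exp_diag v) ** B ** exp_diag v) $ i $ j = exp (v $ i + v $ j) * B $ i $ j"
proof -
  have "(exp_diag v ** B) $ i $ j = exp (v $ i) * B $ i $ j" for B :: "real ^ 4 ^ 4" and i j
    by (simp add: exp_diag_def matrix_matrix_mult_def if_distrib[of "\<lambda>x. x * _"] cong: if_cong)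
  moreover have "(B ** exp_diag v) $ i $ j = B $ i $ j * exp (v $ j)" for B :: "real ^ 4 ^ 4" and i j
    by (simp add: exp_diag_def matrix_matrix_mult_def if_distrib cong: if_cong)
  moreover have "transpose (exp_diag v) = exp_diag v"
    by (simp add: exp_diag_def transpose_def vec_eq_iff)
  ultimately show ?thesis by (simp add: exp_add)
qed

lemma matrix_inv_mult:
  assumes "invertible A"
  shows "A ** matrix_inv A = mat 1" "matrix_inv A ** A = mat 1"
  using someI_ex[OF assms[unfolded invertible_def]] unfolding matrix_inv_def by simp_all

text \<open>In a basis of common eigenvectors the form has a matrix \<open>B\<close> with \<open>v\<^sub>i + v\<^sub>j = 0\<close> on \<open>V\<close> whenever
\<open>B\<^sub>i\<^sub>j \<noteq> 0\<close>. As \<open>B\<close> is alternating and invertible its Pfaffian does not vanish, so one of its three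
terms gives a perfect matching of the four indices, and each of the two pairs imposes one
relation.\<close>
lemma torus_dim_le:
  fixes V :: "(real ^ 4) set"
  assumes P: "invertible P"
    and V: "\<And>v. v \<in> V \<Longrightarrow> P ** exp_diag v ** matrix_inv P \<in> carrier Sp4R"
  shows "dim V \<le> 2"
proof -
  have PQ: "matrix_inv P ** P = mat 1" "P ** matrix_inv P = mat 1"
    using P by (simp_all add: matrix_inv_mult)
  define B where "B = transpose P ** J4 ** P"
  have invariant: "exp (v $ i + v $ j) * B $ i $ j = B $ i $ j" if "v \<in> V" for v i j
  proof -
    let ?g = "P ** exp_diag v ** matrix_inv P"
    have gP: "?g ** P = P ** exp_diag v" using PQ by (simp flip: matrix_mul_assoc)
    have "transpose (exp_diag v) ** B ** exp_diag v
        = transpose (P ** exp_diag v) ** J4 ** (P ** exp_diag v)"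
      by (simp add: B_def matrix_transpose_mul matrix_mul_assoc)
    also have "\<dots> = transpose (?g ** P) ** J4 ** (?g ** P)" by (simp only: gP)
    also have "\<dots> = transpose P ** (transpose ?g ** J4 ** ?g) ** P"
      by (simp only: matrix_transpose_mul matrix_mul_assoc)
    also have "\<dots> = B" using V[OF that] by (simp add: B_def Sp4_simps(3))
    finally show ?thesis by (simp flip: exp_diag_sandwich)
  qed
  then have opposite: "v $ i = - v $ j" if "v \<in> V" "B $ i $ j \<noteq> 0" for v i j
    using that by (metis exp_eq_one_iff mult_cancel_right1 eq_neg_iff_add_eq_0)
  have tB: "transpose B = - B"
  proof -
    have "transpose J4 = (- J4 :: real ^ 4 ^ 4)"
      by (simp add: vec_eq_iff forall_4 transpose_def J4_def)
    moreover have "(- A) ** C = - (A ** C)" "A ** (- C) = - (A ** C)" for A C :: "real ^ 4 ^ 4"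
      by (simp_all add: vec_eq_iff matrix_matrix_mult_def sum_negf)
    moreover have "transpose B = transpose P ** transpose J4 ** P"
      by (simp only: B_def matrix_transpose_mul transpose_transpose matrix_mul_assoc)
    ultimately show ?thesis by (simp add: B_def)
  qed
  have anti: "B $ j $ i = - B $ i $ j" for i j
  proof -
    have "B $ j $ i = transpose B $ i $ j" by (simp add: transpose_def)
    then show ?thesis by (simp add: tB)
  qed
  \<comment> \<open>The Pfaffian of \<open>B\<close>, and the matrix with \<open>B ** C = - pf\<close> made of the complementary entries of \<open>B\<close>.\<close>
  define pf where "pf = B$1$2 * B$3$4 - B$1$3 * B$2$4 + B$1$4 * B$2$3"
  define C :: "real ^ 4 ^ 4" where "C = vector
    [vector [0, B$3$4, - B$2$4, B$2$3], vector [- B$3$4, 0, B$1$4, - B$1$3],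
     vector [B$2$4, - B$1$4, 0, B$1$2], vector [- B$2$3, B$1$3, - B$1$2, 0]]"
  have diag: "B $ i $ i = 0" for i using anti[of i i] by simp
  have BC: "B ** C = - pf *\<^sub>R mat 1"
    using anti[of 1 2] anti[of 1 3] anti[of 1 4] anti[of 2 3] anti[of 2 4] anti[of 3 4]
    by (simp add: vec_eq_iff forall_4 matrix_matrix_mult_def sum_4 C_def pf_def diag mat_def algebra_simps)
  have "pf \<noteq> 0"
  proof
    assume "pf = 0"
    then have BC0: "B ** C = 0" using BC by simp
    have "invertible B"
    proof -
      have "invertible (J4 :: real ^ 4 ^ 4)"
        unfolding invertible_def
        by (intro exI[of _ "- J4"]) (simp add: vec_eq_iff forall_4 matrix_matrix_mult_def sum_4 J4_def mat_def)
      then show ?thesis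
        using P unfolding B_def by (intro invertible_mult) (simp_all add: transpose_invertible)
    qed
    then have "C = matrix_inv B ** (B ** C)" by (simp add: matrix_mul_assoc matrix_inv_mult)
    then have "C = 0" by (simp add: BC0)
    then have "C $ i $ j = 0" for i j by simp
    from this[of 1 2] this[of 1 3] this[of 1 4] this[of 2 3] this[of 2 4] this[of 3 4]
    have "B = 0"
      using anti[of 1 2] anti[of 1 3] anti[of 1 4] anti[of 2 3] anti[of 2 4] anti[of 3 4]
      by (simp add: vec_eq_iff forall_4 C_def diag)
    moreover have "(B ** matrix_inv B) $ 1 $ 1 = 1"
      using matrix_inv_mult(1)[OF \<open>invertible B\<close>] by (simp add: mat_def)
    ultimately show False by (simp add: matrix_matrix_mult_def)
  qed
  have bound: "dim V \<le> 2" if "\<And>v. v \<in> V \<Longrightarrow> v \<in> span {a, b}" for a b :: "real ^ 4"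
  proof -
    have "dim V \<le> card {a, b}" using that by (intro dim_le_card) auto
    also have "\<dots> \<le> 2" by (rule card_insert_le_m1) auto
    finally show ?thesis .
  qed
  have span: "v \<in> span {a, b}" if "v = s *\<^sub>R a + t *\<^sub>R b" for v a b :: "real ^ 4" and s t
    unfolding that by (intro span_add span_scale) (auto intro: span_base)
  let ?e = "\<lambda>i. axis i 1 :: real ^ 4"
  from \<open>pf \<noteq> 0\<close> consider "B$1$2 \<noteq> 0" "B$3$4 \<noteq> 0" | "B$1$3 \<noteq> 0" "B$2$4 \<noteq> 0" | "B$1$4 \<noteq> 0" "B$2$3 \<noteq> 0"
    unfolding pf_def by fastforce
  then show ?thesis
  proof cases
    case 1
    have "v = v$1 *\<^sub>R (?e 1 - ?e 2) + v$3 *\<^sub>R (?e 3 - ?e 4)" if "v \<in> V" for v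
      using opposite[OF that 1(1)] opposite[OF that 1(2)] by (simp add: vec_eq_iff forall_4 axis_def)
    then show ?thesis using span by (intro bound[of "?e 1 - ?e 2" "?e 3 - ?e 4"]) blast
  next
    case 2
    have "v = v$1 *\<^sub>R (?e 1 - ?e 3) + v$2 *\<^sub>R (?e 2 - ?e 4)" if "v \<in> V" for v
      using opposite[OF that 2(1)] opposite[OF that 2(2)] by (simp add: vec_eq_iff forall_4 axis_def)
    then show ?thesis using span by (intro bound[of "?e 1 - ?e 3" "?e 2 - ?e 4"]) blast
  next
    case 3
    have "v = v$1 *\<^sub>R (?e 1 - ?e 4) + v$2 *\<^sub>R (?e 2 - ?e 3)" if "v \<in> V" for v
      using opposite[OF that 3(1)] opposite[OF that 3(2)] by (simp add: vec_eq_iff forall_4 axis_def)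
    then show ?thesis using span by (intro bound[of "?e 1 - ?e 4" "?e 2 - ?e 3"]) blast
  qed
qed

text \<open>The bound of \<open>torus_dim_le\<close> is attained by the diagonal matrices in \<open>Sp(4, \<real>)\<close>.\<close>
lemma real_rank_Sp4R: "real_rank (carrier Sp4R) = 2"
  unfolding real_rank_def
proof (rule Greatest_equality)
  let ?V = "{v :: real ^ 4. v $ 3 = - v $ 1 \<and> v $ 4 = - v $ 2}"
  let ?a = "axis 1 1 - axis 3 1 :: real ^ 4" and ?b = "axis 2 1 - axis 4 1 :: real ^ 4"
  have "subspace ?V" by (auto simp: subspace_def)
  moreover have "dim ?V = 2"
  proof (rule dim_unique)
    show "{?a, ?b} \<subseteq> ?V" by (auto simp: axis_def)
    show "?V \<subseteq> span {?a, ?b}"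
    proof
      fix v :: "real ^ 4" assume "v \<in> ?V"
      then have "v = v$1 *\<^sub>R ?a + v$2 *\<^sub>R ?b" by (simp add: vec_eq_iff forall_4 axis_def)
      also have "\<dots> \<in> span {?a, ?b}" by (intro span_add span_scale) (auto intro: span_base)
      finally show "v \<in> span {?a, ?b}" .
    qed
    have ne: "?a \<noteq> t *\<^sub>R ?b" "?b \<noteq> 0" for t by (auto simp: vec_eq_iff forall_4 axis_def)
    then show "independent {?a, ?b}" using ne(1)[of 1] by (auto simp: independent_insert span_singleton)
    show "card {?a, ?b} = 2" using ne(1)[of 1] by simp
  qed
  moreover have "invertible (mat 1 :: real ^ 4 ^ 4)" by (auto simp: invertible_def intro: exI[of _ "mat 1"])
  moreover from this have "matrix_inv (mat 1) = (mat 1 :: real ^ 4 ^ 4)"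
    using matrix_inv_mult(1)[of "mat 1 :: real ^ 4 ^ 4"] by simp
  then have "mat 1 ** (\<chi> i j. if i = j then exp (v $ i) else 0) ** matrix_inv (mat 1) \<in> carrier Sp4R"
    if "v \<in> ?V" for v
  proof -
    have "exp (v$1) * exp (v$3) = 1" "exp (v$2) * exp (v$4) = 1"
      using that by (simp_all add: exp_minus)
    then have "exp_diag v \<in> carrier Sp4R"
      by (simp add: Sp4_simps(3) vec_eq_iff forall_4 exp_diag_sandwich J4_def exp_add mult.commute)
    then show ?thesis using \<open>matrix_inv (mat 1) = _\<close> by (simp add: exp_diag_def)
  qed
  ultimately show "\<exists>(V :: (real ^ 4) set) P. subspace V \<and> dim V = 2 \<and> invertible P \<and>
    (\<forall>v\<in>V. P ** (\<chi> i j. if i = j then exp (v $ i) else 0) ** matrix_inv P \<in> carrier Sp4R)"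
    by blast
next
  fix r
  assume "\<exists>(V :: (real ^ 4) set) P. subspace V \<and> dim V = r \<and> invertible P \<and>
    (\<forall>v\<in>V. P ** (\<chi> i j. if i = j then exp (v $ i) else 0) ** matrix_inv P \<in> carrier Sp4R)"
  then obtain V :: "(real ^ 4) set" and P where "dim V = r" "invertible P"
    "\<And>v. v \<in> V \<Longrightarrow> P ** exp_diag v ** matrix_inv P \<in> carrier Sp4R"
    by (auto simp: exp_diag_def)
  then show "r \<le> 2" using torus_dim_le by blast
qed

section \<open>Hypergeometric triples\<close>

text \<open>Laplace expansion along the first row.\<close>
lemma det_4:
  "det (A :: 'a::comm_ring_1 ^ 4 ^ 4) =
      A$1$1 * (A$2$2 * (A$3$3 * A$4$4 - A$3$4 * A$4$3) - A$2$3 * (A$3$2 * A$4$4 - A$3$4 * A$4$2)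
        + A$2$4 * (A$3$2 * A$4$3 - A$3$3 * A$4$2))
    - A$1$2 * (A$2$1 * (A$3$3 * A$4$4 - A$3$4 * A$4$3) - A$2$3 * (A$3$1 * A$4$4 - A$3$4 * A$4$1)
        + A$2$4 * (A$3$1 * A$4$3 - A$3$3 * A$4$1))
    + A$1$3 * (A$2$1 * (A$3$2 * A$4$4 - A$3$4 * A$4$2) - A$2$2 * (A$3$1 * A$4$4 - A$3$4 * A$4$1)
        + A$2$4 * (A$3$1 * A$4$2 - A$3$2 * A$4$1))
    - A$1$4 * (A$2$1 * (A$3$2 * A$4$3 - A$3$3 * A$4$2) - A$2$2 * (A$3$1 * A$4$3 - A$3$3 * A$4$1)
        + A$2$3 * (A$3$1 * A$4$2 - A$3$2 * A$4$1))"
proof -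
  have f1234: "finite {2::4, 3, 4}" "1 \<notin> {2::4, 3, 4}"
    and f234: "finite {3::4, 4}" "2 \<notin> {3::4, 4}"
    and f34: "finite {4::4}" "3 \<notin> {4::4}"
    by auto
  show ?thesis
    unfolding det_def UNIV_4
    unfolding sum_over_permutations_insert[OF f1234]
    unfolding sum_over_permutations_insert[OF f234]
    unfolding sum_over_permutations_insert[OF f34]
    unfolding permutes_sing
    by (simp add: sign_swap_id permutation_swap_id permutation_compose sign_compose sign_id swap_id_eq
        algebra_simps)
qed

lemma to_complex_mult: "to_complex (A ** B) = to_complex A ** to_complex B"
  by (simp add: vec_eq_iff matrix_matrix_mult_def)

lemma to_complex_T: "to_complex T_mat = vector [vector [1, 0, 0, 0], vector [0, 1, 0, 1],
    vector [0, 0, 1, 0], vector [0, 0, 0, 1]]"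
  by (simp add: vec_eq_iff forall_4 T_mat_def)

lemma to_complex_U: "to_complex (U_mat d k) = vector [vector [1, 1, 0, 0], vector [0, 1, 0, 0],
    vector [of_int d, of_int d, 1, 0], vector [0, - of_int k, - 1, 1]]"
  by (simp add: vec_eq_iff forall_4 U_mat_def)

lemma to_complex_R: "to_complex (R_mat d k) = vector [vector [1, 1, 0, 0],
    vector [0, 1 - of_int k, - 1, 1], vector [of_int d, of_int d, 1, 0], vector [0, - of_int k, - 1, 1]]"
  by (simp add: vec_eq_iff forall_4 R_mat_def T_mat_def U_mat_def matrix_matrix_mult_def sum_4)

lemma det_char_R:
  "det (mat x - to_complex (R_mat d k))
    = x ^ 4 + (of_int k - 4) * x ^ 3 + (6 - 2 * of_int k + of_int d) * x ^ 2 + (of_int k - 4) * x + 1"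
  unfolding to_complex_R by (simp add: det_4 mat_def power4_eq_xxxx power3_eq_cube power2_eq_square algebra_simps)

lemma det_char_U: "det (mat x - to_complex (U_mat d k)) = (x - 1) ^ 4"
  unfolding to_complex_U by (simp add: det_4 mat_def power4_eq_xxxx algebra_simps)

lemma det_T: "det (to_complex T_mat) = 1" and det_U: "det (to_complex (U_mat d k)) = 1"
  by (simp_all add: to_complex_T to_complex_U det_4)

lemma det_char_eigenvalue:
  fixes A :: "complex ^ 'n ^ 'n"
  assumes "is_eigenvalue A c"
  shows "det (mat c - A) = 0"
proof (rule ccontr)
  assume "det (mat c - A) \<noteq> 0"
  then have inv: "invertible (mat c - A)" by (simp add: invertible_det_nz)
  obtain v where v: "v \<noteq> 0" "A *v v = c *s v" using assms by (auto simp: is_eigenvalue_def)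
  have "mat c *v v = c *s v"
    by (simp add: vec_eq_iff matrix_vector_mult_def mat_def if_distrib[of "\<lambda>x. x * _"] cong: if_cong)
  then have "(mat c - A) *v v = 0" using v by (simp add: matrix_vector_mult_diff_rdistrib)
  then have "matrix_inv (mat c - A) *v ((mat c - A) *v v) = 0" by simp
  then have "v = 0" by (simp add: matrix_vector_mul_assoc matrix_inv_mult[OF inv])
  with v show False by simp
qed

lemma rank_T: "rank (to_complex T_mat - mat 1) = 1"
proof -
  let ?e = "axis 4 1 :: complex ^ 4"
  have "rows (to_complex T_mat - mat 1) = {0, ?e}"
  proof -
    have "row i (to_complex T_mat - mat 1) = (if i = 2 then ?e else 0)" for i
      using exhaust_4[of i] by (auto simp: to_complex_T row_def vec_eq_iff forall_4 mat_def axis_def)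
    then show ?thesis
      unfolding rows_def by (auto intro: exI[of _ 1] exI[of _ 2])
  qed
  moreover have "vec.dim {0, ?e} = 1"
  proof (rule vec.dim_unique[of "{?e}"])
    show "{0, ?e} \<subseteq> vec.span {?e}" by (auto intro: vec.span_base vec.span_zero)
    show "\<not> vec.dependent {?e}" by (simp add: vec.dependent_single vec_eq_iff axis_def)
  qed auto
  ultimately show ?thesis by (simp add: row_rank_def_gen)
qed

text \<open>The only eigenvalue of \<open>U\<close> is \<open>1\<close>, and the characteristic polynomial of \<open>R\<close> takes the value
\<open>d \<noteq> 0\<close> at \<open>1\<close>.\<close>
lemma hypergeometric_R_T_U:
  assumes d: "d \<noteq> 0"
  shows "hypergeometric (to_complex (R_mat d k)) (to_complex T_mat) (to_complex (U_mat d k))"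
proof -
  let ?R = "to_complex (R_mat d k)"
  have R: "?R = to_complex T_mat ** to_complex (U_mat d k)"
    by (simp add: R_mat_def to_complex_mult)
  have inv: "invertible ?R" "invertible (to_complex T_mat)" "invertible (to_complex (U_mat d k))"
    by (simp_all add: invertible_det_nz R det_mul det_T det_U)
  have "\<not> (is_eigenvalue (matrix_inv ?R) c \<and> is_eigenvalue (to_complex (U_mat d k)) c)" for c
  proof
    assume c: "is_eigenvalue (matrix_inv ?R) c \<and> is_eigenvalue (to_complex (U_mat d k)) c"
    then have "c = 1"
      using det_char_eigenvalue[of "to_complex (U_mat d k)" c] by (simp add: det_char_U)
    then obtain v where v: "v \<noteq> 0" "matrix_inv ?R *v v = v" using c by (auto simp: is_eigenvalue_def)
    have "?R *v v = ?R *v (matrix_inv ?R *v v)" by (simp add: v)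
    then have "?R *v v = v" by (simp add: matrix_vector_mul_assoc matrix_inv_mult[OF inv(1)])
    then have "is_eigenvalue ?R 1" using v by (auto simp: is_eigenvalue_def)
    then have "det (mat 1 - ?R) = 0" by (rule det_char_eigenvalue)
    then show False using d by (simp add: det_char_R)
  qed
  then show ?thesis
    unfolding hypergeometric_def using inv R rank_T by simp
qed

lemma maximally_unipotent_U:
  assumes d: "d \<noteq> 0"
  shows "maximally_unipotent (to_complex (U_mat d k))"
proof -
  \<comment> \<open>The columns are \<open>N\<^sup>3 e\<^sub>2, N\<^sup>2 e\<^sub>2, N e\<^sub>2, e\<^sub>2\<close> for \<open>N = U - 1\<close>, a Jordan basis.\<close>
  define P :: "complex ^ 4 ^ 4" where "P = vector [vector [0, 0, 1, 0], vector [0, 0, 0, 1],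
    vector [0, of_int d, of_int d, 0], vector [- of_int d, - of_int d, - of_int k, 0]]"
  let ?J = "vector [vector [1, 1, 0, 0], vector [0, 1, 1, 0], vector [0, 0, 1, 1],
    vector [0, 0, 0, 1]] :: complex ^ 4 ^ 4"
  have inv: "invertible P" using d by (simp add: invertible_det_nz det_4 P_def)
  have "to_complex (U_mat d k) ** P = P ** ?J"
    by (simp add: to_complex_U P_def vec_eq_iff forall_4 matrix_matrix_mult_def sum_4)
  then have "to_complex (U_mat d k) ** (P ** matrix_inv P) = P ** ?J ** matrix_inv P"
    by (simp add: matrix_mul_assoc)
  then show ?thesis
    unfolding maximally_unipotent_def using inv by (auto simp: matrix_inv_mult)
qed

subsection \<open>Parameters\<close>

definition root_of :: "rat \<Rightarrow> complex" where
  "root_of a = exp (2 * of_real pi * \<i> * of_rat a)"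

lemma root_of_power: "root_of a ^ n = root_of (of_nat n * a)"
  by (simp add: root_of_def of_rat_mult flip: exp_of_nat_mult) (simp add: mult_ac)

lemma root_of_half: "root_of (1 / 2) = - 1"
  by (simp add: root_of_def of_rat_divide)

lemma root_of_1 [simp]: "root_of 1 = 1"
  using root_of_power[of "1 / 2" 2] by (simp add: root_of_half)

lemma root_of_sixth: "root_of (1 / 6) ^ 2 = root_of (1 / 6) - 1"
proof -
  have "root_of (1 / 6) = cis (pi / 3)"
    by (simp add: root_of_def of_rat_divide cis_conv_exp mult_ac)
  also have "\<dots> = Complex (1 / 2) (sqrt 3 / 2)"
    by (simp add: complex_eq_iff cos_60 sin_60)
  finally have w: "root_of (1 / 6) = Complex (1 / 2) (sqrt 3 / 2)" .
  show ?thesis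
    unfolding w by (simp add: complex_eq_iff power2_eq_square)
qed

lemma has_parametersI:
  assumes "\<And>x :: complex. x ^ 4 + (of_int k - 4) * x ^ 3 + (6 - 2 * of_int k + of_int d) * x ^ 2
      + (of_int k - 4) * x + 1 = (\<Prod>a\<leftarrow>as. x - root_of a)"
  shows "has_parameters (to_complex (R_mat d k)) as"
  using assms by (simp add: has_parameters_def det_char_R root_of_def)

lemma hyp_caseI:
  assumes "d \<noteq> 0" "has_parameters (to_complex (R_mat d k)) as"
  shows "hyp_case d k as"
  using assms hypergeometric_R_T_U maximally_unipotent_U by (simp add: hyp_case_def)

text \<open>The conjugate pairs \<open>z, z\<^sup>4\<close> and \<open>z\<^sup>2, z\<^sup>3\<close> of primitive fifth roots of unity have product \<open>1\<close> and sums
\<open>a\<close> and \<open>- 1 - a\<close>, where \<open>a\<^sup>2 = 1 - a\<close>.\<close>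
lemma hyp_case_5_5: "hyp_case 5 5 [1/5, 2/5, 3/5, 4/5]"
proof (intro hyp_caseI has_parametersI)
  fix x :: complex
  define z where "z = root_of (1 / 5)"
  have z: "root_of (2 / 5) = z ^ 2" "root_of (3 / 5) = z ^ 3" "root_of (4 / 5) = z ^ 4" "z ^ 5 = 1"
    by (simp_all add: z_def root_of_power)
  have "z \<noteq> 1"
  proof
    assume "z = 1"
    then obtain n :: int where "pi * 2 / 5 = real_of_int (2 * n) * pi"
      by (auto simp: z_def root_of_def of_rat_divide exp_eq_1)
    then have "1 / 5 = real_of_int n" by simp
    then have "real_of_int (5 * n) = 1" by simp
    then have "5 * n = 1" by (simp only: of_int_eq_1_iff)
    then show False by presburger
  qed
  moreover have "(z - 1) * (1 + z + z ^ 2 + z ^ 3 + z ^ 4) = z ^ 5 - 1"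
    by (simp add: algebra_simps power2_eq_square power3_eq_cube power4_eq_xxxx eval_nat_numeral)
  ultimately have s: "1 + z + z ^ 2 + z ^ 3 + z ^ 4 = 0" using z(4) by simp
  have "(x - z) * (x - z ^ 4) = x ^ 2 - (z + z ^ 4) * x + z ^ 5"
    "(x - z ^ 2) * (x - z ^ 3) = x ^ 2 - (z ^ 2 + z ^ 3) * x + z ^ 5"
    by (simp_all add: algebra_simps eval_nat_numeral)
  moreover define a where "a = z + z ^ 4"
  moreover have "z ^ 2 + z ^ 3 = - 1 - a" using s by (simp add: a_def algebra_simps add_eq_0_iff)
  ultimately have prod: "(x - z) * (x - z ^ 4) * ((x - z ^ 2) * (x - z ^ 3))
      = (x ^ 2 - a * x + 1) * (x ^ 2 - (- 1 - a) * x + 1)" using z(4) by simp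
  have "a * (- 1 - a) = (z + z ^ 4) * (z ^ 2 + z ^ 3)"
    using \<open>z ^ 2 + z ^ 3 = - 1 - a\<close> by (simp add: a_def)
  also have "\<dots> = z ^ 3 + z ^ 4 + z ^ 5 * (z + z ^ 2)"
    by (simp add: algebra_simps eval_nat_numeral)
  also have "\<dots> = - 1" using s z(4) by (simp add: algebra_simps add_eq_0_iff)
  finally have a: "a ^ 2 = 1 - a" by (simp add: algebra_simps power2_eq_square)
  have "(x ^ 2 - a * x + 1) * (x ^ 2 - (- 1 - a) * x + 1)
      = x ^ 4 + x ^ 3 + (2 - a - a ^ 2) * x ^ 2 + x + 1"
    by (simp add: algebra_simps eval_nat_numeral)
  also have "\<dots> = x ^ 4 + x ^ 3 + x ^ 2 + x + 1" by (simp add: a)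
  finally show "x ^ 4 + (of_int 5 - 4) * x ^ 3 + (6 - 2 * of_int 5 + of_int 5) * x ^ 2
      + (of_int 5 - 4) * x + 1 = (\<Prod>a\<leftarrow>[1/5, 2/5, 3/5, 4/5]. x - root_of a)"
    using prod by (simp add: z flip: z_def) (simp add: mult_ac)
qed simp

text \<open>In this case and the next one the four roots are \<open>\<plusminus> z\<close> and \<open>\<plusminus> z\<^sup>j\<close>, so the polynomial is one in
\<open>x\<^sup>2\<close>.\<close>
lemma hyp_case_2_4: "hyp_case 2 4 [1/8, 3/8, 5/8, 7/8]"
proof (intro hyp_caseI has_parametersI)
  fix x :: complex
  define z where "z = root_of (1 / 8)"
  have z: "root_of (3 / 8) = z ^ 3" "root_of (5 / 8) = z ^ 5" "root_of (7 / 8) = z ^ 7"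
    by (simp_all add: z_def root_of_power)
  have z4: "z ^ 4 = - 1" using root_of_half by (simp add: z_def root_of_power)
  then have "z ^ 5 = - z" "z ^ 7 = - (z ^ 3)"
    using power_add[of z 4 1] power_add[of z 4 3] by simp_all
  moreover have "(x - z) * (x + z) * ((x - z ^ 3) * (x + z ^ 3))
      = x ^ 4 - (z ^ 2 + z ^ 4 * z ^ 2) * x ^ 2 + z ^ 4 * z ^ 4"
    by (simp add: algebra_simps eval_nat_numeral)
  ultimately show "x ^ 4 + (of_int 4 - 4) * x ^ 3 + (6 - 2 * of_int 4 + of_int 2) * x ^ 2
      + (of_int 4 - 4) * x + 1 = (\<Prod>a\<leftarrow>[1/8, 3/8, 5/8, 7/8]. x - root_of a)"
    by (simp add: z z4 flip: z_def) (simp add: mult_ac)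
qed simp

lemma hyp_case_1_4: "hyp_case 1 4 [1/12, 5/12, 7/12, 11/12]"
proof (intro hyp_caseI has_parametersI)
  fix x :: complex
  define z where "z = root_of (1 / 12)"
  have z: "root_of (5 / 12) = z ^ 5" "root_of (7 / 12) = z ^ 7" "root_of (11 / 12) = z ^ 11"
    by (simp_all add: z_def root_of_power)
  have z6: "z ^ 6 = - 1" using root_of_half by (simp add: z_def root_of_power)
  then have "z ^ 7 = - z" "z ^ 11 = - (z ^ 5)"
    using power_add[of z 6 1] power_add[of z 6 5] by simp_all
  moreover have z4: "z ^ 4 = z ^ 2 - 1"
    using root_of_sixth by (simp add: z_def root_of_power flip: power_mult)
  moreover have "(x - z) * (x + z) * ((x - z ^ 5) * (x + z ^ 5))
      = x ^ 4 - (z ^ 2 + z ^ 6 * z ^ 4) * x ^ 2 + z ^ 6 * z ^ 6"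
    by (simp add: algebra_simps eval_nat_numeral)
  ultimately show "x ^ 4 + (of_int 4 - 4) * x ^ 3 + (6 - 2 * of_int 4 + of_int 1) * x ^ 2
      + (of_int 4 - 4) * x + 1 = (\<Prod>a\<leftarrow>[1/12, 5/12, 7/12, 11/12]. x - root_of a)"
    by (simp add: z z6 flip: z_def) (simp add: mult_ac)
qed simp

lemma hyp_case_16_8: "hyp_case 16 8 [1/2, 1/2, 1/2, 1/2]"
proof (intro hyp_caseI has_parametersI)
  fix x :: complex
  show "x ^ 4 + (of_int 8 - 4) * x ^ 3 + (6 - 2 * of_int 8 + of_int 16) * x ^ 2
      + (of_int 8 - 4) * x + 1 = (\<Prod>a\<leftarrow>[1/2, 1/2, 1/2, 1/2]. x - root_of a)"
    by (simp add: root_of_half algebra_simps eval_nat_numeral)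
qed simp

text \<open>In the last three cases the factor \<open>(x + 1)\<^sup>2\<close> splits off and leaves the quadratic polynomial of a
conjugate pair of roots of unity.\<close>
lemma hyp_case_12_7: "hyp_case 12 7 [1/3, 1/2, 1/2, 2/3]"
proof (intro hyp_caseI has_parametersI)
  fix x :: complex
  define w where "w = root_of (1 / 6)"
  have w2: "w ^ 2 = w - 1" using root_of_sixth by (simp add: w_def)
  have "w ^ 4 = (w - 1) ^ 2" using w2 by (simp flip: w2 power_mult)
  also have "\<dots> = w ^ 2 - 2 * w + 1" by (simp add: power2_eq_square algebra_simps)
  finally have w4: "w ^ 4 = - w" by (simp add: w2)
  have r: "root_of (1 / 3) = w - 1" "root_of (2 / 3) = - w"
    unfolding w2[symmetric] w4[symmetric] by (simp_all add: w_def root_of_power)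
  have "(x - (w - 1)) * (x + w) = x ^ 2 + x - (w ^ 2 - w)"
    by (simp add: algebra_simps eval_nat_numeral)
  then have "(x - (w - 1)) * (x + w) = x ^ 2 + x + 1" by (simp add: w2)
  then have quadratic: "(x - (w - 1)) * (x + w) * ((x + 1) * (x + 1)) = (x ^ 2 + x + 1) * ((x + 1) * (x + 1))" by simp
  have "(\<Prod>a\<leftarrow>[1/3, 1/2, 1/2, 2/3]. x - root_of a) = (x - (w - 1)) * ((x + 1) * ((x + 1) * (x + w)))"
    by (simp add: r root_of_half)
  also have "\<dots> = (x - (w - 1)) * (x + w) * ((x + 1) * (x + 1))" by (simp only: ac_simps)
  also have "\<dots> = x ^ 4 + (of_int 7 - 4) * x ^ 3 + (6 - 2 * of_int 7 + of_int 12) * x ^ 2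
      + (of_int 7 - 4) * x + 1"
    unfolding quadratic by (simp add: algebra_simps eval_nat_numeral)
  finally show "x ^ 4 + (of_int 7 - 4) * x ^ 3 + (6 - 2 * of_int 7 + of_int 12) * x ^ 2
      + (of_int 7 - 4) * x + 1 = (\<Prod>a\<leftarrow>[1/3, 1/2, 1/2, 2/3]. x - root_of a)" by simp
qed simp

lemma hyp_case_8_6: "hyp_case 8 6 [1/4, 1/2, 1/2, 3/4]"
proof (intro hyp_caseI has_parametersI)
  fix x :: complex
  define z where "z = root_of (1 / 4)"
  have z2: "z ^ 2 = - 1" using root_of_half by (simp add: z_def root_of_power)
  have "root_of (3 / 4) = z ^ 3" by (simp add: z_def root_of_power)
  also have "\<dots> = - z" using z2 power_add[of z 2 1] by simp
  finally have r: "root_of (3 / 4) = - z" .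
  have "(x - z) * (x + z) = x ^ 2 + 1" using z2 by (simp add: algebra_simps power2_eq_square)
  then have quadratic: "(x - z) * (x + z) * ((x + 1) * (x + 1)) = (x ^ 2 + 1) * ((x + 1) * (x + 1))" by simp
  have "(\<Prod>a\<leftarrow>[1/4, 1/2, 1/2, 3/4]. x - root_of a) = (x - z) * ((x + 1) * ((x + 1) * (x + z)))"
    by (simp add: r root_of_half flip: z_def)
  also have "\<dots> = (x - z) * (x + z) * ((x + 1) * (x + 1))" by (simp only: ac_simps)
  also have "\<dots> = x ^ 4 + (of_int 6 - 4) * x ^ 3 + (6 - 2 * of_int 6 + of_int 8) * x ^ 2
      + (of_int 6 - 4) * x + 1"
    unfolding quadratic by (simp add: algebra_simps eval_nat_numeral)
  finally show "x ^ 4 + (of_int 6 - 4) * x ^ 3 + (6 - 2 * of_int 6 + of_int 8) * x ^ 2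
      + (of_int 6 - 4) * x + 1 = (\<Prod>a\<leftarrow>[1/4, 1/2, 1/2, 3/4]. x - root_of a)" by simp
qed simp

lemma hyp_case_4_5: "hyp_case 4 5 [1/6, 1/2, 1/2, 5/6]"
proof (intro hyp_caseI has_parametersI)
  fix x :: complex
  define w where "w = root_of (1 / 6)"
  have w2: "w ^ 2 = w - 1" using root_of_sixth by (simp add: w_def)
  have "w ^ 3 = - 1" using root_of_half by (simp add: w_def root_of_power)
  then have "w ^ 5 = 1 - w" using power_add[of w 3 2] w2 by simp
  then have r: "root_of (5 / 6) = 1 - w" by (simp add: w_def root_of_power)
  have "(x - w) * (x - (1 - w)) = x ^ 2 - x - (w ^ 2 - w)"
    by (simp add: algebra_simps power2_eq_square)
  then have "(x - w) * (x - (1 - w)) = x ^ 2 - x + 1" by (simp add: w2)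
  then have quadratic: "(x - w) * (x - (1 - w)) * ((x + 1) * (x + 1)) = (x ^ 2 - x + 1) * ((x + 1) * (x + 1))" by simp
  have "(\<Prod>a\<leftarrow>[1/6, 1/2, 1/2, 5/6]. x - root_of a) = (x - w) * ((x + 1) * ((x + 1) * (x - (1 - w))))"
    by (simp add: r root_of_half flip: w_def)
  also have "\<dots> = (x - w) * (x - (1 - w)) * ((x + 1) * (x + 1))" by (simp only: ac_simps)
  also have "\<dots> = x ^ 4 + (of_int 5 - 4) * x ^ 3 + (6 - 2 * of_int 5 + of_int 4) * x ^ 2
      + (of_int 5 - 4) * x + 1"
    unfolding quadratic by (simp add: algebra_simps eval_nat_numeral)
  finally show "x ^ 4 + (of_int 5 - 4) * x ^ 3 + (6 - 2 * of_int 5 + of_int 4) * x ^ 2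
      + (of_int 5 - 4) * x + 1 = (\<Prod>a\<leftarrow>[1/6, 1/2, 1/2, 5/6]. x - root_of a)" by simp
qed simp

section \<open>The seven groups\<close>

lemma R_pow_half_period:
  assumes "\<And>x. (minus_R d k ^^ m) x = - x"
  shows "R_mat d k [^]\<^bsub>Sp4Z\<^esub> m = (if even m then - mat 1 else mat 1)"
  by (rule int_matrix_eqI) (simp add: R_pow_act_nat assms minus_matrix_vector)

context ping_pong_cones begin

lemma Rp_odd_period:
  fixes m :: nat
  assumes m: "1 \<le> m" and period: "Rp (int m) = mat 1"
    and small: "\<And>i :: nat. 1 \<le> i \<Longrightarrow> i < m \<Longrightarrow> Rp (int i) \<notin> {mat 1, - mat 1}"
  shows "Rp i = \<one>\<^bsub>Sp4Z\<^esub> \<longleftrightarrow> int m dvd i" and "- mat 1 \<notin> range Rp"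
proof -
  have sign: "Rp i \<in> {mat 1, - mat 1} \<longleftrightarrow> int m dvd i" for i
    using Rp_sign_iff(1)[OF m _ small] period by simp
  have one: "Rp i = mat 1" if i: "int m dvd i" for i
  proof -
    obtain q where "i = int m * q" using i by (rule dvdE)
    then show ?thesis
      using Rp_sign_iff(2)[OF m _ small, of q] period Sp4Z.int_pow_one[of q] by (simp add: Sp4_simps(2))
  qed
  show "Rp i = \<one>\<^bsub>Sp4Z\<^esub> \<longleftrightarrow> int m dvd i"
    using sign[of i] one[of i] by (auto simp: Sp4_simps(2))
  show "- mat 1 \<notin> range Rp"
  proof
    assume "- mat 1 \<in> range Rp"
    then obtain i where "Rp i = - mat 1" by auto
    then show False using sign[of i] one[of i] mat_neq_minus by simp
  qed
qed

lemma Rp_infinite_order: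
  assumes "\<And>n :: nat. 1 \<le> n \<Longrightarrow> Rp (int n) \<notin> {mat 1, - mat 1}"
  shows "i \<noteq> 0 \<Longrightarrow> Rp i \<notin> {mat 1, - mat 1}"
    and "Rp i = \<one>\<^bsub>Sp4Z\<^esub> \<longleftrightarrow> int 0 dvd i" and "- mat 1 \<notin> range Rp"
proof -
  have nz: "Rp i \<notin> {mat 1, - mat 1}" if "i \<noteq> 0" for i
  proof (cases "0 < i")
    case True
    then show ?thesis using assms[of "nat i"] by simp
  next
    case False
    then show ?thesis using assms[of "nat (- i)"] that Rp_minus_sign[of "- i"] by auto
  qed
  then show "i \<noteq> 0 \<Longrightarrow> Rp i \<notin> {mat 1, - mat 1}" .
  show "Rp i = \<one>\<^bsub>Sp4Z\<^esub> \<longleftrightarrow> int 0 dvd i"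
    using nz[of i] by (auto simp: Sp4_simps(2))
  show "- mat 1 \<notin> range Rp"
  proof
    assume "- mat 1 \<in> range Rp"
    then obtain i where "Rp i = - mat 1" by auto
    then show False using nz[of i] mat_neq_minus by (cases "i = 0") (simp_all add: Sp4_simps(2))
  qed
qed

end

lemma thin_hyp_group:
  assumes "0 < d" "0 < k" "\<not> finite_index Sp4Z (carrier (hyp_group d k))"
  shows "thin (carrier (hyp_group d k))"
  using assms zariski_dense_hyp_group subgroup_hyp_group by (simp add: thin_def hyp_group_simps)

definition free_of_finite_index :: "int \<Rightarrow> int \<Rightarrow> bool" where
  "free_of_finite_index d k \<longleftrightarrow> (\<exists>F. subgroup F (hyp_group d k) \<and>
    is_free_group ((hyp_group d k)\<lparr>carrier := F\<rparr>) \<and> finite_index (hyp_group d k) F)"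

lemma minus_R_half_period:
  "(minus_R 5 5 ^^ 5) x = - x" "(minus_R 2 4 ^^ 4) x = - x" "(minus_R 1 4 ^^ 6) x = - x"
  unfolding minus_R_pow_5_5_5 minus_R_pow_2_4_4 minus_R_pow_1_4_6
  by (simp_all add: vec_eq_iff forall_4)

text \<open>\<open>- R\<close> and \<open>R\<close> have the same \<open>m\<close>-th power when \<open>m\<close> is even. Thus \<open>R\<^sup>m = - 1\<close>, and the splitting is
amalgamated over the centre.\<close>
lemma hyp_group_even_period:
  assumes dk: "0 < d" "0 < k" and slope: "0 \<le> 6 * k - d - 12" and m: "1 \<le> m" "even m"
    and half: "\<And>x. (minus_R d k ^^ m) x = - x"
    and cone: "\<And>x y i. x \<in> {y, reflection d y} \<Longrightarrow> cone_K d k y \<Longrightarrow> i \<in> {1..<m} \<Longrightarrow>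
      cone_M d k ((minus_R d k ^^ i) x)"
  shows "R_mat d k [^]\<^bsub>Sp4Z\<^esub> m = - mat 1"
    and "is_amalgam (hyp_group d k) (generate Sp4Z {- mat 1, T_mat}) (generate Sp4Z {R_mat d k})
      (generate Sp4Z {- mat 1})"
    and "Sp4Z\<lparr>carrier := generate Sp4Z {- mat 1, T_mat}\<rparr> \<cong> integer_group \<times>\<times> integer_mod_group 2"
    and "Sp4Z\<lparr>carrier := generate Sp4Z {R_mat d k}\<rparr> \<cong> integer_mod_group (2 * m)"
    and "Sp4Z\<lparr>carrier := generate Sp4Z {- mat 1}\<rparr> \<cong> integer_mod_group 2"
    and "hyp_group d k \<cong> amalgam (integer_group \<times>\<times> integer_mod_group 2) (integer_mod_group (2 * m))
      (integer_mod_group 2) (\<lambda>h. (0, h)) (\<lambda>h. int m * h)"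
    and "free_of_finite_index d k" and "thin (carrier (hyp_group d k))"
proof -
  interpret ping_pong_cones d k
    using cone by (intro ping_pong_cones_finite[OF slope m(1) half])
  show R: "R_mat d k [^]\<^bsub>Sp4Z\<^esub> m = - mat 1"
    using R_pow_half_period[OF half] m(2) by simp
  then have period: "Rp (int m) = - mat 1" by (simp only: int_pow_int)
  have small: "Rp (int i) \<notin> {mat 1, - mat 1}" if i: "1 \<le> i" "i < m" for i :: nat
  proof -
    have "cone_M d k ((minus_R d k ^^ i) y)" if "cone_K d k y" for y
      using cone[of y y i] i that by simp
    then show ?thesis unfolding int_pow_int by (rule R_pow_nontrivial)
  qed
  note order = m(1) period small
  show "is_amalgam (hyp_group d k) (generate Sp4Z {- mat 1, T_mat}) (generate Sp4Z {R_mat d k})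
      (generate Sp4Z {- mat 1})"
    by (rule is_amalgam_hyp_group[OF order])
  show "Sp4Z\<lparr>carrier := generate Sp4Z {- mat 1, T_mat}\<rparr> \<cong> integer_group \<times>\<times> integer_mod_group 2"
    by (rule generate_signed_T_iso)
  show "Sp4Z\<lparr>carrier := generate Sp4Z {- mat 1}\<rparr> \<cong> integer_mod_group 2"
    by (rule generate_minus_one_iso)
  show "Sp4Z\<lparr>carrier := generate Sp4Z {R_mat d k}\<rparr> \<cong> integer_mod_group (2 * m)"
    by (rule generate_R_iso[OF Rp_order[OF order]])
  show "hyp_group d k \<cong> amalgam (integer_group \<times>\<times> integer_mod_group 2) (integer_mod_group (2 * m))
      (integer_mod_group 2) (\<lambda>h. (0, h)) (\<lambda>h. int m * h)"
    by (rule hyp_group_iso_amalgam[OF order])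
  have "2 \<le> m" using m by presburger
  then show "free_of_finite_index d k"
    unfolding free_of_finite_index_def using period small
    by (intro free_subgroup_finite_order[of m]) simp_all
  show "thin (carrier (hyp_group d k))"
    by (rule thin_hyp_group[OF dk splitting_infinite_index[OF splitting_signed[OF order]]])
qed

text \<open>Here the half-period \<open>5\<close> of \<open>- R\<close> is odd, and \<open>R\<close> itself has order \<open>5\<close>.\<close>
lemma hyp_group_5_5:
  "is_free_product (hyp_group 5 5) (generate Sp4Z {T_mat}) (generate Sp4Z {R_mat 5 5})"
  "Sp4Z\<lparr>carrier := generate Sp4Z {T_mat}\<rparr> \<cong> integer_group"
  "Sp4Z\<lparr>carrier := generate Sp4Z {R_mat 5 5}\<rparr> \<cong> integer_mod_group 5"
  "hyp_group 5 5 \<cong> free_product integer_group (integer_mod_group 5)"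
  "free_of_finite_index 5 5" "thin (carrier (hyp_group 5 5))"
proof -
  note half = minus_R_half_period(1)
  interpret ping_pong_cones 5 5
    by (rule ping_pong_cones_finite[OF _ _ half]) (use minus_R_pow_cone_5_5 in auto)
  have period: "Rp (int 5) = mat 1"
    using R_pow_half_period[OF half] by (simp only: int_pow_int) simp
  have small: "Rp (int i) \<notin> {mat 1, - mat 1}" if i: "1 \<le> i" "i < 5" for i :: nat
  proof -
    have "cone_M 5 5 ((minus_R 5 5 ^^ i) y)" if "cone_K 5 5 y" for y
      using minus_R_pow_cone_5_5[of y y i] i that by simp
    then show ?thesis unfolding int_pow_int by (rule R_pow_nontrivial)
  qed
  have ord: "Rp i = \<one>\<^bsub>Sp4Z\<^esub> \<longleftrightarrow> int 5 dvd i" and sign: "- mat 1 \<notin> range Rp" for i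
    using Rp_odd_period[of 5, OF _ period small] by simp_all
  show "is_free_product (hyp_group 5 5) (generate Sp4Z {T_mat}) (generate Sp4Z {R_mat 5 5})"
    by (rule is_free_product_hyp_group[OF sign])
  show "Sp4Z\<lparr>carrier := generate Sp4Z {T_mat}\<rparr> \<cong> integer_group"
    by (rule generate_T_iso)
  show "Sp4Z\<lparr>carrier := generate Sp4Z {R_mat 5 5}\<rparr> \<cong> integer_mod_group 5"
    by (rule generate_R_iso[OF ord])
  show "hyp_group 5 5 \<cong> free_product integer_group (integer_mod_group 5)"
    by (rule hyp_group_iso_free_product[OF ord sign])
  show "free_of_finite_index 5 5"
    unfolding free_of_finite_index_def using period small
    by (intro free_subgroup_finite_order[of 5]) simp_all
  show "thin (carrier (hyp_group 5 5))"
    by (rule thin_hyp_group[OF _ _ splitting_infinite_index[OF splitting_free[OF sign]]]) simp_all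
qed

lemma hyp_group_infinite_order:
  assumes dk: "0 < d" "0 < k" and slope: "0 \<le> 6 * k - d - 12"
    and cone: "\<And>x y i. x \<in> {y, reflection d y} \<Longrightarrow> cone_K d k y \<Longrightarrow> 1 \<le> i \<Longrightarrow> cone_M d k ((minus_R d k ^^ i) x)"
  shows "is_free_product (hyp_group d k) (generate Sp4Z {T_mat}) (generate Sp4Z {R_mat d k})"
    and "Sp4Z\<lparr>carrier := generate Sp4Z {R_mat d k}\<rparr> \<cong> integer_group"
    and "hyp_group d k \<cong> free_product integer_group integer_group"
    and "free_of_finite_index d k" and "thin (carrier (hyp_group d k))"
proof -
  interpret ping_pong_cones d k
    using slope cone by unfold_locales blast+
  have R: "Rp (int i) \<notin> {mat 1, - mat 1}" if i: "1 \<le> i" for i :: nat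
  proof -
    have "cone_M d k ((minus_R d k ^^ i) y)" if "cone_K d k y" for y
      using cone[of y y i] i that by simp
    then show ?thesis unfolding int_pow_int by (rule R_pow_nontrivial)
  qed
  note inf = Rp_infinite_order[OF R]
  have mod_0: "integer_mod_group 0 = integer_group" by (simp add: integer_mod_group_def)
  show "is_free_product (hyp_group d k) (generate Sp4Z {T_mat}) (generate Sp4Z {R_mat d k})"
    by (rule is_free_product_hyp_group[OF inf(3)])
  show "Sp4Z\<lparr>carrier := generate Sp4Z {R_mat d k}\<rparr> \<cong> integer_group"
    using generate_R_iso[OF inf(2)] by (simp only: mod_0)
  show "hyp_group d k \<cong> free_product integer_group integer_group"
    using hyp_group_iso_free_product[OF inf(2,3)] by (simp only: mod_0)
  show "free_of_finite_index d k"
    unfolding free_of_finite_index_def by (rule free_subgroup_infinite_order[OF inf(1)])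
  show "thin (carrier (hyp_group d k))"
    by (rule thin_hyp_group[OF dk splitting_infinite_index[OF splitting_free[OF inf(3)]]])
qed

lemmas hyp_group_2_4 =
  hyp_group_even_period[OF _ _ _ _ _ minus_R_half_period(2) minus_R_pow_cone_2_4, simplified]
lemmas hyp_group_1_4 =
  hyp_group_even_period[OF _ _ _ _ _ minus_R_half_period(3) minus_R_pow_cone_1_4, simplified]
lemmas hyp_group_16_8 = hyp_group_infinite_order[OF _ _ _ minus_R_pow_cone_16_8, simplified]
lemmas hyp_group_12_7 = hyp_group_infinite_order[OF _ _ _ minus_R_pow_cone_12_7, simplified]
lemmas hyp_group_8_6 = hyp_group_infinite_order[OF _ _ _ minus_R_pow_cone_8_6, simplified]
lemmas hyp_group_4_5 = hyp_group_infinite_order[OF _ _ _ minus_R_pow_cone_4_5, simplified]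

theorem theorem1:
  shows "(\<forall>d k. U_mat d k \<in> carrier Sp4Z \<and> T_mat \<in> carrier Sp4Z \<and> R_mat d k \<in> carrier Sp4Z \<and>
            generate Sp4Z {R_mat d k, T_mat} = generate Sp4Z {R_mat d k, T_mat, U_mat d k})
    \<comment> \<open>case 1\<close>
    \<and> hyp_case 5 5 [1/5, 2/5, 3/5, 4/5]
    \<and> is_free_product (hyp_group 5 5) (generate Sp4Z {T_mat}) (generate Sp4Z {R_mat 5 5})
    \<and> Sp4Z\<lparr>carrier := generate Sp4Z {T_mat}\<rparr> \<cong> integer_group
    \<and> Sp4Z\<lparr>carrier := generate Sp4Z {R_mat 5 5}\<rparr> \<cong> integer_mod_group 5
    \<and> hyp_group 5 5 \<cong> free_product integer_group (integer_mod_group 5)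
    \<comment> \<open>case 2\<close>
    \<and> hyp_case 2 4 [1/8, 3/8, 5/8, 7/8]
    \<and> R_mat 2 4 [^]\<^bsub>Sp4Z\<^esub> (4::nat) = - mat 1
    \<and> is_amalgam (hyp_group 2 4)
        (generate Sp4Z {R_mat 2 4 [^]\<^bsub>Sp4Z\<^esub> (4::nat), T_mat})
        (generate Sp4Z {R_mat 2 4})
        (generate Sp4Z {R_mat 2 4 [^]\<^bsub>Sp4Z\<^esub> (4::nat)})
    \<and> Sp4Z\<lparr>carrier := generate Sp4Z {R_mat 2 4 [^]\<^bsub>Sp4Z\<^esub> (4::nat), T_mat}\<rparr>
        \<cong> integer_group \<times>\<times> integer_mod_group 2
    \<and> Sp4Z\<lparr>carrier := generate Sp4Z {R_mat 2 4}\<rparr> \<cong> integer_mod_group 8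
    \<and> Sp4Z\<lparr>carrier := generate Sp4Z {R_mat 2 4 [^]\<^bsub>Sp4Z\<^esub> (4::nat)}\<rparr> \<cong> integer_mod_group 2
    \<and> hyp_group 2 4 \<cong>
        amalgam (integer_group \<times>\<times> integer_mod_group 2) (integer_mod_group 8) (integer_mod_group 2)
          (\<lambda>h. (0, h)) (\<lambda>h. 4 * h)
    \<comment> \<open>case 3\<close>
    \<and> hyp_case 1 4 [1/12, 5/12, 7/12, 11/12]
    \<and> R_mat 1 4 [^]\<^bsub>Sp4Z\<^esub> (6::nat) = - mat 1
    \<and> is_amalgam (hyp_group 1 4)
        (generate Sp4Z {R_mat 1 4 [^]\<^bsub>Sp4Z\<^esub> (6::nat), T_mat})
        (generate Sp4Z {R_mat 1 4})
        (generate Sp4Z {R_mat 1 4 [^]\<^bsub>Sp4Z\<^esub> (6::nat)})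
    \<and> Sp4Z\<lparr>carrier := generate Sp4Z {R_mat 1 4 [^]\<^bsub>Sp4Z\<^esub> (6::nat), T_mat}\<rparr>
        \<cong> integer_group \<times>\<times> integer_mod_group 2
    \<and> Sp4Z\<lparr>carrier := generate Sp4Z {R_mat 1 4}\<rparr> \<cong> integer_mod_group 12
    \<and> Sp4Z\<lparr>carrier := generate Sp4Z {R_mat 1 4 [^]\<^bsub>Sp4Z\<^esub> (6::nat)}\<rparr> \<cong> integer_mod_group 2
    \<and> hyp_group 1 4 \<cong>
        amalgam (integer_group \<times>\<times> integer_mod_group 2) (integer_mod_group 12) (integer_mod_group 2)
          (\<lambda>h. (0, h)) (\<lambda>h. 6 * h)
    \<comment> \<open>cases 4 to 7\<close>
    \<and> hyp_case 16 8 [1/2, 1/2, 1/2, 1/2]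
    \<and> hyp_case 12 7 [1/3, 1/2, 1/2, 2/3]
    \<and> hyp_case 8 6 [1/4, 1/2, 1/2, 3/4]
    \<and> hyp_case 4 5 [1/6, 1/2, 1/2, 5/6]
    \<and> (\<forall>(d, k) \<in> {(16, 8), (12, 7), (8, 6), (4, 5)}.
          is_free_product (hyp_group d k) (generate Sp4Z {T_mat}) (generate Sp4Z {R_mat d k})
        \<and> Sp4Z\<lparr>carrier := generate Sp4Z {R_mat d k}\<rparr> \<cong> integer_group
        \<and> hyp_group d k \<cong> free_product integer_group integer_group)
    \<comment> \<open>all seven cases\<close>
    \<and> (\<forall>(d, k) \<in> {(5, 5), (2, 4), (1, 4), (16, 8), (12, 7), (8, 6), (4, 5)}.
          (\<exists>F. subgroup F (hyp_group d k) \<and> is_free_group ((hyp_group d k)\<lparr>carrier := F\<rparr>)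
              \<and> finite_index (hyp_group d k) F)
        \<and> thin (carrier (hyp_group d k)))
    \<and> real_rank (carrier Sp4R) = 2"
proof (intro conjI)
  show "\<forall>d k. U_mat d k \<in> carrier Sp4Z \<and> T_mat \<in> carrier Sp4Z \<and> R_mat d k \<in> carrier Sp4Z \<and>
      generate Sp4Z {R_mat d k, T_mat} = generate Sp4Z {R_mat d k, T_mat, U_mat d k}"
    by (simp add: generate_R_T_U[symmetric])
  show "\<forall>(d, k) \<in> {(16, 8), (12, 7), (8, 6), (4, 5)}.
          is_free_product (hyp_group d k) (generate Sp4Z {T_mat}) (generate Sp4Z {R_mat d k})
        \<and> Sp4Z\<lparr>carrier := generate Sp4Z {R_mat d k}\<rparr> \<cong> integer_group
        \<and> hyp_group d k \<cong> free_product integer_group integer_group"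
    using hyp_group_16_8 hyp_group_12_7 hyp_group_8_6 hyp_group_4_5 by simp
  show "\<forall>(d, k) \<in> {(5, 5), (2, 4), (1, 4), (16, 8), (12, 7), (8, 6), (4, 5)}.
          (\<exists>F. subgroup F (hyp_group d k) \<and> is_free_group ((hyp_group d k)\<lparr>carrier := F\<rparr>)
              \<and> finite_index (hyp_group d k) F)
        \<and> thin (carrier (hyp_group d k))"
    using hyp_group_5_5 hyp_group_2_4 hyp_group_1_4 hyp_group_16_8 hyp_group_12_7 hyp_group_8_6 hyp_group_4_5
    by (simp add: free_of_finite_index_def)
qed (simp_all only: hyp_group_5_5 hyp_group_2_4 hyp_group_1_4 hyp_case_5_5 hyp_case_2_4 hyp_case_1_4
    hyp_case_16_8 hyp_case_12_7 hyp_case_8_6 hyp_case_4_5 real_rank_Sp4R)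

end
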